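(* Let $\{G_n\}_{n\ge 1}$ be a sequence of finite, simple, connected graphs such that $G_n$ is $d(n)$-regular, where $d(n)\to\infty$ as $n\to\infty$. Let $\Gamma_n$ be a uniform spanning tree of $G_n$. Then the local limit of $\Gamma_n$ is the Poisson$(1)$ Galton--Watson (branching process) tree conditioned to survive forever.
   Context: The uniform spanning tree (UST) of a finite connected graph $G$ is a uniformly random element of the finite set of spanning trees of $G$. For a graph $G$, a vertex $\rho$ and an integer $r\ge 0$, $B_G(\rho,r)$ denotes the induced subgraph of $G$ on the vertices at graph distance at most $r$ from $\rho$, rooted at $\rho$. Let $\mathcal{G}_\bullet$ be the space of all locally finite rooted graphs $(G,\rho)$ viewed up to root-preserving graph isomorphism, with the metric in which the distance between $(G_1,\rho_1)$ and $(G_2,\rho_2)$ is $2^{-R}$, where $R\in\{0,1,\dots\}\cup\{\infty\}$ is the maximal $R$ such that there is a root-preserving isomorphism between $B_{G_1}(\rho_1,R)$ and $B_{G_2}(\rho_2,R)$; it carries the Borel $\sigma$-algebra. The law of a random element $(G,\rho)$ of $\mathcal{G}_\bullet$ is the local limit of a sequence of (possibly random) finite graphs $H_n$ if for every integer $r\ge 0$ the random rooted graphs $B_{H_n}(\rho_n,r)$ converge in distribution to $B_G(\rho,r)$, where $\rho_n$ is a uniformly random vertex of $H_n$, drawn independently conditioned on $H_n$. The Poisson$(1)$ Galton--Watson tree conditioned to survive (forever) is the limit in distribution in $\mathcal{G}_\bullet$ (i.e., convergence in distribution of $B(\rho,r)$ for every $r$, $\rho$ being the root), as $m\to\infty$,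 of the rooted Galton--Watson tree with Poisson$(1)$ offspring distribution conditioned to survive $m$ generations; this limit is known to exist. *)

theory Defs
  imports "HOL-Probability.Probability"
begin

section \<open>Simple graphs\<close>

type_synonym 'a graph = "'a set \<times> 'a set set"

abbreviation verts :: "'a graph \<Rightarrow> 'a set" where
  "verts G \<equiv> fst G"

abbreviation edges :: "'a graph \<Rightarrow> 'a set set" where
  "edges G \<equiv> snd G"

definition simple_graph :: "'a graph \<Rightarrow> bool" where
  "simple_graph G \<longleftrightarrow> (\<forall>e\<in>edges G. e \<subseteq> verts G \<and> card e = 2)"

definition adj :: "'a graph \<Rightarrow> 'a rel" where
  "adj G = {(u, v). {u, v} \<in> edges G}"

definition nbrs :: "'a graph \<Rightarrow> 'a \<Rightarrow> 'a set" where
  "nbrs G v = {u. {v, u} \<in> edges G}"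

definition regular :: "nat \<Rightarrow> 'a graph \<Rightarrow> bool" where
  "regular d G \<longleftrightarrow> (\<forall>v\<in>verts G. card (nbrs G v) = d)"

definition locally_finite :: "'a graph \<Rightarrow> bool" where
  "locally_finite G \<longleftrightarrow> (\<forall>v\<in>verts G. finite (nbrs G v))"

definition gconnected :: "'a graph \<Rightarrow> bool" where
  "gconnected G \<longleftrightarrow> verts G \<noteq> {} \<and> (\<forall>u\<in>verts G. \<forall>v\<in>verts G. (u, v) \<in> (adj G)\<^sup>*)"

definition gdist :: "'a graph \<Rightarrow> 'a \<Rightarrow> 'a \<Rightarrow> enat" where
  "gdist G u v = Inf {enat n |n. (u, v) \<in> adj G ^^ n}"

definition gcycle :: "'a graph \<Rightarrow> 'a list \<Rightarrow> bool" where
  "gcycle G xs \<longleftrightarrow> 3 \<le> length xs \<and> distinct xs \<and>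
     (\<forall>i<length xs. {xs ! i, xs ! (Suc i mod length xs)} \<in> edges G)"

definition is_tree :: "'a graph \<Rightarrow> bool" where
  "is_tree G \<longleftrightarrow> gconnected G \<and> (\<nexists>xs. gcycle G xs)"

definition spanning_trees :: "'a graph \<Rightarrow> 'a graph set" where
  "spanning_trees G = {T. verts T = verts G \<and> edges T \<subseteq> edges G \<and> is_tree T}"

definition ust :: "'a graph \<Rightarrow> 'a graph pmf" where
  "ust G = pmf_of_set (spanning_trees G)"


section \<open>Rooted graphs up to isomorphism\<close>

type_synonym 'a rgraph = "'a graph \<times> 'a"

definition rball :: "nat \<Rightarrow> 'a rgraph \<Rightarrow> 'a rgraph" where
  "rball r = (\<lambda>(G, \<rho>).
     let B = {v \<in> verts G. gdist G \<rho> v \<le> enat r} in ((B, {e \<in> edges G. e \<subseteq> B}), \<rho>))"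

definition rgraph_iso :: "'a rgraph \<Rightarrow> 'b rgraph \<Rightarrow> bool" where
  "rgraph_iso = (\<lambda>(G, \<rho>) (H, \<sigma>). \<exists>f. bij_betw f (verts G) (verts H) \<and>
     (\<forall>u\<in>verts G. \<forall>v\<in>verts G. {u, v} \<in> edges G \<longleftrightarrow> {f u, f v} \<in> edges H) \<and> f \<rho> = \<sigma>)"

text \<open>Connectedness is part of the notion of a rooted graph here: the local distance only sees
  the connected component of the root.\<close>

definition rgraph :: "'a rgraph \<Rightarrow> bool" where
  "rgraph = (\<lambda>(G, \<rho>). simple_graph G \<and> gconnected G \<and> locally_finite G \<and> \<rho> \<in> verts G)"

subsection \<open>Distances and balls\<close>

lemma gdist_le_iff: "gdist G u v \<le> enat r \<longleftrightarrow> (\<exists>n\<le>r. (u, v) \<in> adj G ^^ n)"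
proof
  assume a: "gdist G u v \<le> enat r"
  let ?S = "{enat n |n. (u, v) \<in> adj G ^^ n}"
  have "?S \<noteq> {}"
    using a unfolding gdist_def by (metis Inf_empty enat_ord_simps(5) infinity_ileE top_enat_def)
  then have "Inf ?S \<in> ?S" by (meson wellorder_InfI ex_in_conv)
  then show "\<exists>n\<le>r. (u, v) \<in> adj G ^^ n"
    using a unfolding gdist_def by (smt (verit) enat_ord_simps(1) mem_Collect_eq)
next
  assume "\<exists>n\<le>r. (u, v) \<in> adj G ^^ n"
  then obtain n where n: "n \<le> r" "(u, v) \<in> adj G ^^ n" by blast
  have "gdist G u v \<le> enat n" unfolding gdist_def by (rule Inf_lower) (use n in blast)
  also have "enat n \<le> enat r" using n by simp
  finally show "gdist G u v \<le> enat r" .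
qed

definition bverts :: "nat \<Rightarrow> 'a rgraph \<Rightarrow> 'a set" where
  "bverts r X = {v \<in> verts (fst X). \<exists>n\<le>r. (snd X, v) \<in> adj (fst X) ^^ n}"

lemma rball_eq: "rball r X = ((bverts r X, {e \<in> edges (fst X). e \<subseteq> bverts r X}), snd X)"
  by (cases X) (simp add: rball_def bverts_def gdist_le_iff Let_def)

lemma rball_simps [simp]:
  "verts (fst (rball r X)) = bverts r X"
  "edges (fst (rball r X)) = {e \<in> edges (fst X). e \<subseteq> bverts r X}"
  "snd (rball r X) = snd X"
  by (simp_all add: rball_eq)

lemma adj_iff: "(u, v) \<in> adj G \<longleftrightarrow> {u, v} \<in> edges G"
  by (simp add: adj_def)

lemma adj_sym: "(u, v) \<in> adj G \<Longrightarrow> (v, u) \<in> adj G"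
  by (simp add: adj_def insert_commute)

lemma adj_verts: "simple_graph G \<Longrightarrow> (u, v) \<in> adj G \<Longrightarrow> u \<in> verts G \<and> v \<in> verts G"
  by (auto simp: adj_def simple_graph_def)

lemma rgraphD:
  assumes "rgraph X"
  shows "simple_graph (fst X)" "gconnected (fst X)" "locally_finite (fst X)" "snd X \<in> verts (fst X)"
  using assms by (auto simp: rgraph_def)

lemma rgraphI:
  assumes "simple_graph (fst X)" "gconnected (fst X)" "locally_finite (fst X)" "snd X \<in> verts (fst X)"
  shows "rgraph X"
  using assms by (cases X) (simp add: rgraph_def)

lemma bverts_subset: "bverts r X \<subseteq> verts (fst X)"
  by (auto simp: bverts_def)

lemma bverts_verts: "v \<in> bverts r X \<Longrightarrow> v \<in> verts (fst X)"
  by (simp add: bverts_def)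

lemma bverts_mono: "r \<le> s \<Longrightarrow> bverts r X \<subseteq> bverts s X"
  by (auto simp: bverts_def intro: order_trans)

lemma root_in_bverts: "snd X \<in> verts (fst X) \<Longrightarrow> snd X \<in> bverts r X"
  by (auto simp: bverts_def intro!: exI[of _ 0])

lemma bverts_walk:
  assumes "simple_graph (fst X)" "snd X \<in> verts (fst X)"
  shows "(snd X, v) \<in> adj (fst X) ^^ n \<Longrightarrow> n \<le> r \<Longrightarrow> (snd X, v) \<in> adj (fst (rball r X)) ^^ n"
proof (induction n arbitrary: v)
  case (Suc n)
  then obtain w where w: "(snd X, w) \<in> adj (fst X) ^^ n" "(w, v) \<in> adj (fst X)" by auto
  have "w \<in> verts (fst X)" "v \<in> verts (fst X)" using adj_verts[OF assms(1) w(2)] by auto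
  then have "w \<in> bverts r X" "v \<in> bverts r X"
    using w(1) Suc.prems Suc_leD[OF Suc.prems(2)] unfolding bverts_def by blast+
  then have "(w, v) \<in> adj (fst (rball r X))" using w(2) by (simp add: adj_iff)
  moreover have "(snd X, w) \<in> adj (fst (rball r X)) ^^ n" using Suc.IH[OF w(1)] Suc.prems(2) by simp
  ultimately show ?case by auto
qed simp

lemma relpow_mono_rel: "R \<subseteq> S \<Longrightarrow> R ^^ n \<subseteq> S ^^ n" for R S :: "'a rel"
  by (induction n) auto

lemma bverts_rball:
  assumes "simple_graph (fst X)" "snd X \<in> verts (fst X)"
  shows "bverts r (rball s X) = bverts (min r s) X"
proof
  have "adj (fst (rball s X)) \<subseteq> adj (fst X)" by (auto simp: adj_def)
  then have m: "(u, v) \<in> adj (fst (rball s X)) ^^ n \<Longrightarrow> (u, v) \<in> adj (fst X) ^^ n" for u v n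
    using relpow_mono_rel by blast
  show "bverts r (rball s X) \<subseteq> bverts (min r s) X"
  proof
    fix v assume v: "v \<in> bverts r (rball s X)"
    then obtain n where n: "n \<le> r" "(snd X, v) \<in> adj (fst X) ^^ n" and vs: "v \<in> bverts s X"
      using m unfolding bverts_def[of r] by fastforce
    obtain k where k: "k \<le> s" "(snd X, v) \<in> adj (fst X) ^^ k" using vs by (auto simp: bverts_def)
    have "v \<in> verts (fst X)" using vs by (rule bverts_verts)
    moreover have "\<exists>n\<le>min r s. (snd X, v) \<in> adj (fst X) ^^ n"
    proof (cases "r \<le> s")
      case True then show ?thesis using n by (intro exI[of _ n]) auto
    next
      case False then show ?thesis using k by (intro exI[of _ k]) auto
    qed
    ultimately show "v \<in> bverts (min r s) X" by (simp add: bverts_def)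
  qed
  show "bverts (min r s) X \<subseteq> bverts r (rball s X)"
  proof
    fix v assume v: "v \<in> bverts (min r s) X"
    then obtain n where n: "n \<le> r" "n \<le> s" "(snd X, v) \<in> adj (fst X) ^^ n"
      by (auto simp: bverts_def)
    have "v \<in> bverts s X" using v bverts_mono[of "min r s" s X] by auto
    then show "v \<in> bverts r (rball s X)"
      using bverts_walk[OF assms n(3,2)] n(1) by (auto simp: bverts_def[of r])
  qed
qed

lemma rball_rball:
  assumes "simple_graph (fst X)" "snd X \<in> verts (fst X)"
  shows "rball r (rball s X) = rball (min r s) X"
proof -
  have "bverts (min r s) X \<subseteq> bverts s X" by (rule bverts_mono) simp
  then show ?thesis
    unfolding rball_eq[of r] rball_eq[of "min r s"] bverts_rball[OF assms] by auto
qed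

lemma sym_adj: "sym (adj G)"
  by (auto intro: symI adj_sym)

lemma rgraph_rball:
  assumes "rgraph X" shows "rgraph (rball r X)"
proof -
  note X = rgraphD[OF assms]
  have reach: "(snd X, v) \<in> (adj (fst (rball r X)))\<^sup>*" if v: "v \<in> bverts r X" for v
  proof -
    obtain n where n: "n \<le> r" "(snd X, v) \<in> adj (fst X) ^^ n"
      using v unfolding bverts_def by blast
    show ?thesis by (rule relpow_imp_rtrancl[OF bverts_walk[OF X(1,4) n(2,1)]])
  qed
  have "gconnected (fst (rball r X))" unfolding gconnected_def
  proof (intro conjI ballI)
    show "verts (fst (rball r X)) \<noteq> {}" using root_in_bverts[OF X(4)] by auto
    fix u v assume "u \<in> verts (fst (rball r X))" "v \<in> verts (fst (rball r X))"
    then have u: "(snd X, u) \<in> (adj (fst (rball r X)))\<^sup>*"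
      and v: "(snd X, v) \<in> (adj (fst (rball r X)))\<^sup>*"
      using reach by auto
    have "(u, snd X) \<in> (adj (fst (rball r X)))\<^sup>*"
      by (rule symD[OF sym_rtrancl[OF sym_adj] u])
    then show "(u, v) \<in> (adj (fst (rball r X)))\<^sup>*" using v by (rule rtrancl_trans)
  qed
  moreover have "simple_graph (fst (rball r X))"
    using X(1) by (auto simp: simple_graph_def)
  moreover have "locally_finite (fst (rball r X))" unfolding locally_finite_def
  proof
    fix v assume "v \<in> verts (fst (rball r X))"
    then have "finite (nbrs (fst X) v)" using X(3) bverts_subset by (fastforce simp: locally_finite_def)
    then show "finite (nbrs (fst (rball r X)) v)" by (rule rev_finite_subset) (auto simp: nbrs_def)
  qed
  ultimately show ?thesis using root_in_bverts[OF X(4)] by (intro rgraphI) simp_all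
qed

lemma finite_bverts:
  assumes "rgraph X" shows "finite (bverts r X)"
proof (induction r)
  case 0
  then show ?case by (rule finite_subset[of _ "{snd X}"]) (auto simp: bverts_def)
next
  case (Suc r)
  note X = rgraphD[OF assms]
  have "bverts (Suc r) X \<subseteq> bverts r X \<union> (\<Union>w\<in>bverts r X. nbrs (fst X) w)"
  proof
    fix v assume "v \<in> bverts (Suc r) X"
    then obtain n where n: "n \<le> Suc r" "(snd X, v) \<in> adj (fst X) ^^ n" "v \<in> verts (fst X)"
      by (auto simp: bverts_def)
    show "v \<in> bverts r X \<union> (\<Union>w\<in>bverts r X. nbrs (fst X) w)"
    proof (cases "n \<le> r")
      case True then show ?thesis using n by (auto simp: bverts_def)
    next
      case False
      then have "n = Suc r" using n by simp
      then obtain w where w: "(snd X, w) \<in> adj (fst X) ^^ r" "(w, v) \<in> adj (fst X)" using n by auto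
      then have "w \<in> bverts r X" using adj_verts[OF X(1) w(2)] by (auto simp: bverts_def)
      then show ?thesis using w(2) by (auto simp: nbrs_def adj_iff)
    qed
  qed
  moreover have "finite (bverts r X \<union> (\<Union>w\<in>bverts r X. nbrs (fst X) w))"
    using Suc X(3) bverts_subset by (fastforce simp: locally_finite_def)
  ultimately show ?case by (rule finite_subset)
qed

lemma verts_eq_UN_bverts:
  assumes "rgraph X" shows "verts (fst X) = (\<Union>r. bverts r X)"
proof
  note X = rgraphD[OF assms]
  show "verts (fst X) \<subseteq> (\<Union>r. bverts r X)"
  proof
    fix v assume v: "v \<in> verts (fst X)"
    then have "(snd X, v) \<in> (adj (fst X))\<^sup>*" using X(2,4) by (auto simp: gconnected_def)
    then obtain n where "(snd X, v) \<in> adj (fst X) ^^ n" using rtrancl_imp_relpow by blast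
    then have "v \<in> bverts n X" using v by (auto simp: bverts_def)
    then show "v \<in> (\<Union>r. bverts r X)" by blast
  qed
qed (auto dest: bverts_verts)

subsection \<open>Isomorphisms\<close>

definition iso_map :: "('a \<Rightarrow> 'b) \<Rightarrow> 'a rgraph \<Rightarrow> 'b rgraph \<Rightarrow> bool" where
  "iso_map f X Y \<longleftrightarrow> bij_betw f (verts (fst X)) (verts (fst Y)) \<and>
     (\<forall>u\<in>verts (fst X). \<forall>v\<in>verts (fst X). {u, v} \<in> edges (fst X) \<longleftrightarrow> {f u, f v} \<in> edges (fst Y)) \<and>
     f (snd X) = snd Y"

lemma rgraph_iso_iff: "rgraph_iso X Y \<longleftrightarrow> (\<exists>f. iso_map f X Y)"
  by (cases X; cases Y) (simp add: rgraph_iso_def iso_map_def)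

lemma iso_mapD:
  assumes "iso_map f X Y"
  shows "bij_betw f (verts (fst X)) (verts (fst Y))"
    "\<And>u v. u \<in> verts (fst X) \<Longrightarrow> v \<in> verts (fst X) \<Longrightarrow>
       {u, v} \<in> edges (fst X) \<longleftrightarrow> {f u, f v} \<in> edges (fst Y)"
    "f (snd X) = snd Y"
  using assms by (auto simp: iso_map_def)

lemma rgraph_iso_refl: "rgraph_iso X X"
  unfolding rgraph_iso_iff by (rule exI[of _ "\<lambda>x. x"]) (simp add: iso_map_def bij_betw_def)

lemma iso_map_inv:
  assumes f: "iso_map f X Y" and r: "snd X \<in> verts (fst X)"
  shows "iso_map (the_inv_into (verts (fst X)) f) Y X"
proof -
  note F = iso_mapD[OF f]
  let ?g = "the_inv_into (verts (fst X)) f"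
  have g: "bij_betw ?g (verts (fst Y)) (verts (fst X))" using F(1) by (rule bij_betw_the_inv_into)
  have fg: "f (?g y) = y" if "y \<in> verts (fst Y)" for y
    using f_the_inv_into_f_bij_betw[OF F(1)] that by simp
  have "{u, v} \<in> edges (fst Y) \<longleftrightarrow> {?g u, ?g v} \<in> edges (fst X)"
    if "u \<in> verts (fst Y)" "v \<in> verts (fst Y)" for u v
    using F(2)[of "?g u" "?g v"] bij_betwE[OF g] that fg by simp
  moreover have "?g (snd Y) = snd X"
    using the_inv_into_f_eq[of f "verts (fst X)" "snd X" "snd Y"] r F(1,3) by (simp add: bij_betw_def)
  ultimately show ?thesis using g by (simp add: iso_map_def)
qed

lemma iso_map_comp:
  assumes "iso_map f X Y" "iso_map g Y Z"
  shows "iso_map (g \<circ> f) X Z"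
  using assms bij_betwE[OF iso_mapD(1)[OF assms(1)]]
  unfolding iso_map_def by (auto intro: bij_betw_trans)

lemma rgraph_iso_sym: "rgraph X \<Longrightarrow> rgraph_iso X Y \<Longrightarrow> rgraph_iso Y X"
  using iso_map_inv rgraphD(4) unfolding rgraph_iso_iff by metis

lemma rgraph_iso_trans: "rgraph_iso X Y \<Longrightarrow> rgraph_iso Y Z \<Longrightarrow> rgraph_iso X Z"
  using iso_map_comp unfolding rgraph_iso_iff by metis

lemma iso_map_walk:
  assumes "simple_graph (fst X)" "snd X \<in> verts (fst X)" "iso_map f X Y"
  shows "(snd X, v) \<in> adj (fst X) ^^ n \<Longrightarrow> (snd Y, f v) \<in> adj (fst Y) ^^ n"
proof (induction n arbitrary: v)
  case 0
  then show ?case using iso_mapD(3)[OF assms(3)] by simp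
next
  case (Suc n)
  then obtain w where w: "(snd X, w) \<in> adj (fst X) ^^ n" "(w, v) \<in> adj (fst X)" by auto
  have "(f w, f v) \<in> adj (fst Y)"
    using w(2) adj_verts[OF assms(1) w(2)] iso_mapD(2)[OF assms(3)] by (simp add: adj_iff)
  then show ?case using Suc.IH[OF w(1)] by auto
qed

lemma iso_map_bverts:
  assumes X: "rgraph X" and f: "iso_map f X Y" and v: "v \<in> bverts r X"
  shows "f v \<in> bverts r Y"
proof -
  note X' = rgraphD[OF X]
  obtain n where n: "n \<le> r" "(snd X, v) \<in> adj (fst X) ^^ n" using v unfolding bverts_def by blast
  have "f v \<in> verts (fst Y)" using bij_betwE[OF iso_mapD(1)[OF f]] bverts_verts[OF v] by blast
  moreover have "(snd Y, f v) \<in> adj (fst Y) ^^ n" by (rule iso_map_walk[OF X'(1,4) f n(2)])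
  ultimately show ?thesis using n(1) unfolding bverts_def by blast
qed

lemma iso_map_bverts_image:
  assumes X: "rgraph X" and Y: "rgraph Y" and f: "iso_map f X Y"
  shows "f ` bverts r X = bverts r Y"
proof
  show "f ` bverts r X \<subseteq> bverts r Y" using iso_map_bverts[OF X f] by blast
  let ?g = "the_inv_into (verts (fst X)) f"
  have g: "iso_map ?g Y X" using iso_map_inv[OF f rgraphD(4)[OF X]] .
  show "bverts r Y \<subseteq> f ` bverts r X"
  proof
    fix y assume y: "y \<in> bverts r Y"
    have "f (?g y) = y"
      using f_the_inv_into_f_bij_betw[OF iso_mapD(1)[OF f]] bverts_verts[OF y] by simp
    then show "y \<in> f ` bverts r X" using iso_map_bverts[OF Y g y] by (metis imageI)
  qed
qed

lemma iso_map_rball: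
  assumes X: "rgraph X" and Y: "rgraph Y" and f: "iso_map f X Y"
  shows "iso_map f (rball r X) (rball r Y)"
proof -
  note img = iso_map_bverts_image[OF assms, of r]
  have "inj_on f (bverts r X)"
    by (rule inj_on_subset[OF bij_betw_imp_inj_on[OF iso_mapD(1)[OF f]] bverts_subset])
  then have bij: "bij_betw f (bverts r X) (bverts r Y)" using img by (simp add: bij_betw_def)
  have "{u, v} \<in> edges (fst X) \<longleftrightarrow> {f u, f v} \<in> edges (fst Y)"
    if "u \<in> bverts r X" "v \<in> bverts r X" for u v
    using iso_mapD(2)[OF f] that[THEN bverts_verts] by simp
  moreover have "f u \<in> bverts r Y" if "u \<in> bverts r X" for u
    using iso_map_bverts[OF X f that] .
  ultimately show ?thesis using iso_mapD(3)[OF f] bij unfolding iso_map_def by simp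
qed

lemma rgraph_iso_rball:
  "rgraph X \<Longrightarrow> rgraph Y \<Longrightarrow> rgraph_iso X Y \<Longrightarrow> rgraph_iso (rball r X) (rball r Y)"
  using iso_map_rball unfolding rgraph_iso_iff by blast

lemma rgraph_iso_if_all_balls_iso:
  fixes X :: "'a rgraph" and Y :: "'b rgraph"
  assumes X: "rgraph X" and Y: "rgraph Y"
    and balls: "\<And>r. rgraph_iso (rball r X) (rball r Y)"
  shows "rgraph_iso X Y"
proof -
  note X' = rgraphD[OF X] and Y' = rgraphD[OF Y]
  define ext where "ext r f s g \<longleftrightarrow> iso_map g (rball s X) (rball s Y) \<and> (\<forall>v\<in>bverts r X. g v = f v)"
    for r f s and g :: "'a \<Rightarrow> 'b"
  define P where "P r f \<longleftrightarrow> (\<forall>s\<ge>r. \<exists>g. ext r f s g)" for r f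
  have restr: "iso_map g (rball r X) (rball r Y)" if "iso_map g (rball s X) (rball s Y)" "r \<le> s" for g r s
    using iso_map_rball[OF rgraph_rball[OF X] rgraph_rball[OF Y] that(1), of r] that(2)
    by (simp add: rball_rball X' Y' min_absorb1)
  have pigeon: "\<exists>f'. P (Suc r) f' \<and> (\<forall>v\<in>bverts r X. f' v = f v)"
    if hyp: "\<And>s. s \<ge> Suc r \<Longrightarrow> \<exists>g. ext r f s g" for r f
  proof -
    obtain G where G: "\<And>s. s \<ge> Suc r \<Longrightarrow> ext r f s (G s)" using hyp by metis
    define h where "h s = restrict (G s) (bverts (Suc r) X)" for s
    have "h ` {Suc r..} \<subseteq> bverts (Suc r) X \<rightarrow>\<^sub>E bverts (Suc r) Y"
    proof safe
      fix s v assume s: "Suc r \<le> s" and v: "v \<in> bverts (Suc r) X"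
      have "iso_map (G s) (rball (Suc r) X) (rball (Suc r) Y)"
        using G[OF s] restr s unfolding ext_def by blast
      then show "h s v \<in> bverts (Suc r) Y"
        using v bij_betwE[OF iso_mapD(1)] unfolding h_def by fastforce
    qed (auto simp: h_def)
    moreover have "finite (bverts (Suc r) X \<rightarrow>\<^sub>E bverts (Suc r) Y)"
      by (intro finite_PiE finite_bverts X Y)
    ultimately have "finite (h ` {Suc r..})" by (rule finite_subset)
    moreover have "infinite {Suc r..}" by (rule infinite_Ici)
    ultimately obtain s0 where s0: "s0 \<in> {Suc r..}" "infinite {s \<in> {Suc r..}. h s = h s0}"
      using pigeonhole_infinite by blast
    define f' where "f' = G s0"
    have eq: "G s v = f' v" if "h s = h s0" "v \<in> bverts (Suc r) X" for s v
      using that unfolding h_def f'_def by (metis restrict_apply')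
    have "P (Suc r) f'" unfolding P_def
    proof (intro allI impI)
      fix s assume s: "s \<ge> Suc r"
      obtain t where t: "t \<ge> s" "h t = h s0" "t \<ge> Suc r"
        using s0(2) unfolding infinite_nat_iff_unbounded_le by (metis (mono_tags, lifting) atLeast_iff mem_Collect_eq)
      have "iso_map (G t) (rball s X) (rball s Y)" using G[OF t(3)] restr t(1) unfolding ext_def by blast
      then have "ext (Suc r) f' s (G t)" unfolding ext_def using eq[OF t(2)] by blast
      then show "\<exists>g. ext (Suc r) f' s g" by blast
    qed
    moreover have "f' v = f v" if "v \<in> bverts r X" for v
      using G[of s0] s0(1) that unfolding ext_def f'_def by auto
    ultimately show ?thesis by blast
  qed
  have "\<exists>F. \<forall>r. P r (F r) \<and> (\<forall>v\<in>bverts r X. F (Suc r) v = F r v)"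
  proof (rule dependent_nat_choice[where P = P and Q = "\<lambda>r f f'. \<forall>v\<in>bverts r X. f' v = f v"])
    show "\<exists>f. P 0 f" unfolding P_def
    proof (rule exI[of _ "\<lambda>_. snd Y"], intro allI impI)
      fix s :: nat
      obtain g where g: "iso_map g (rball s X) (rball s Y)" using balls[of s] by (auto simp: rgraph_iso_iff)
      have "bverts 0 X \<subseteq> {snd X}" by (auto simp: bverts_def)
      then have "ext 0 (\<lambda>_. snd Y) s g" using g iso_mapD(3)[OF g] unfolding ext_def by auto
      then show "\<exists>g. ext 0 (\<lambda>_. snd Y) s g" by blast
    qed
    fix f r assume "P r f"
    then show "\<exists>f'. P (Suc r) f' \<and> (\<forall>v\<in>bverts r X. f' v = f v)"
      by (intro pigeon) (simp add: P_def)
  qed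
  then obtain F where F: "\<And>r. P r (F r)" "\<And>r v. v \<in> bverts r X \<Longrightarrow> F (Suc r) v = F r v" by blast
  have F_iso: "iso_map (F r) (rball r X) (rball r Y)" for r
  proof -
    obtain g where g: "iso_map g (rball r X) (rball r Y)" "\<And>v. v \<in> bverts r X \<Longrightarrow> g v = F r v"
      using F(1)[of r] unfolding P_def ext_def by blast
    have "bij_betw (F r) (bverts r X) (bverts r Y)"
      using iso_mapD(1)[OF g(1)] g(2) bij_betw_cong[of "bverts r X" g "F r"] by simp
    then show ?thesis using g root_in_bverts[OF X'(4), of r] unfolding iso_map_def by auto
  qed
  have F_mono: "F s v = F r v" if "r \<le> s" "v \<in> bverts r X" for r s v
    using that(1)
  proof (induction s rule: dec_induct)
    case (step n) then show ?case using F(2) bverts_mono[of r n X] that(2) by auto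
  qed simp
  define h where "h v = F (LEAST r. v \<in> bverts r X) v" for v
  have h: "h v = F r v" if "v \<in> bverts r X" for r v
    unfolding h_def using F_mono[of "LEAST r. v \<in> bverts r X" r v] that
    by (metis LeastI Least_le)
  have common: "\<exists>r. u \<in> bverts r X \<and> v \<in> bverts r X" if uv: "u \<in> verts (fst X)" "v \<in> verts (fst X)" for u v
  proof -
    obtain a b where "u \<in> bverts a X" "v \<in> bverts b X"
      using uv equalityD1[OF verts_eq_UN_bverts[OF X]] by blast
    then have "u \<in> bverts (max a b) X" "v \<in> bverts (max a b) X"
      using bverts_mono[of a "max a b" X] bverts_mono[of b "max a b" X] by auto
    then show ?thesis by blast
  qed
  have "iso_map h X Y" unfolding iso_map_def
  proof (intro conjI ballI)
    show "bij_betw h (verts (fst X)) (verts (fst Y))" unfolding bij_betw_def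
    proof
      show "inj_on h (verts (fst X))"
      proof (rule inj_onI)
        fix u v assume uv: "u \<in> verts (fst X)" "v \<in> verts (fst X)" "h u = h v"
        obtain r where r: "u \<in> bverts r X" "v \<in> bverts r X" using common[OF uv(1,2)] by blast
        then have "F r u = F r v" using uv(3) h by simp
        then show "u = v" using iso_mapD(1)[OF F_iso[of r]] r by (simp add: bij_betw_def inj_on_def)
      qed
      have im: "h ` bverts r X = bverts r Y" for r
      proof -
        have "h ` bverts r X = F r ` bverts r X" using h by (simp cong: image_cong)
        then show ?thesis using iso_mapD(1)[OF F_iso[of r]] by (simp add: bij_betw_def)
      qed
      show "h ` verts (fst X) = verts (fst Y)"
        unfolding verts_eq_UN_bverts[OF X] verts_eq_UN_bverts[OF Y] image_UN im ..
    qed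
    show "h (snd X) = snd Y"
      using h[OF root_in_bverts[OF X'(4), of 0]] iso_mapD(3)[OF F_iso[of 0]] by simp
    fix u v assume uv: "u \<in> verts (fst X)" "v \<in> verts (fst X)"
    obtain r where r: "u \<in> bverts r X" "v \<in> bverts r X" using common[OF uv] by blast
    have fr: "F r u \<in> bverts r Y" "F r v \<in> bverts r Y"
      using bij_betwE[OF iso_mapD(1)[OF F_iso[of r]]] r by simp_all
    show "{u, v} \<in> edges (fst X) \<longleftrightarrow> {h u, h v} \<in> edges (fst Y)"
      using iso_mapD(2)[OF F_iso[of r], of u v] r fr h[OF r(1)] h[OF r(2)] by simp
  qed
  then show ?thesis by (auto simp: rgraph_iso_iff)
qed

lemma ex_nat_rgraph_iso:
  fixes X :: "'a rgraph"
  assumes "rgraph X"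
  shows "\<exists>Y :: nat rgraph. rgraph Y \<and> rgraph_iso X Y"
proof -
  note X = rgraphD[OF assms]
  have "countable (verts (fst X))"
    unfolding verts_eq_UN_bverts[OF assms]
    by (intro countable_UN countable_finite finite_bverts[OF assms] countableI_type)
  define f where "f = to_nat_on (verts (fst X))"
  have inj: "inj_on f (verts (fst X))"
    using \<open>countable (verts (fst X))\<close> unfolding f_def by (rule inj_on_to_nat_on)
  have sub: "e \<subseteq> verts (fst X)" if "e \<in> edges (fst X)" for e using that X(1) by (auto simp: simple_graph_def)
  define Y :: "nat rgraph" where "Y = ((f ` verts (fst X), (`) f ` edges (fst X)), f (snd X))"
  have edge: "{u, v} \<in> edges (fst X) \<longleftrightarrow> {f u, f v} \<in> edges (fst Y)"
    if uv: "u \<in> verts (fst X)" "v \<in> verts (fst X)" for u v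
  proof
    assume "{f u, f v} \<in> edges (fst Y)"
    then obtain e where e: "e \<in> edges (fst X)" "f ` {u, v} = f ` e" by (auto simp: Y_def)
    then have "{u, v} = e" using inj_on_image_eq_iff[OF inj, of "{u, v}" e] uv sub[OF e(1)] by simp
    then show "{u, v} \<in> edges (fst X)" using e by simp
  next
    assume "{u, v} \<in> edges (fst X)"
    then have "f ` {u, v} \<in> edges (fst Y)" unfolding Y_def by (simp del: image_insert)
    then show "{f u, f v} \<in> edges (fst Y)" by simp
  qed
  have iso: "iso_map f X Y"
    using inj edge unfolding iso_map_def by (auto simp: Y_def bij_betw_def)
  have "simple_graph (fst Y)" unfolding simple_graph_def
  proof
    fix e assume "e \<in> edges (fst Y)"
    then obtain e' where e': "e' \<in> edges (fst X)" "e = f ` e'" by (auto simp: Y_def)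
    have "card e = card e'" using e'(2) inj sub[OF e'(1)] by (metis card_image inj_on_subset)
    then show "e \<subseteq> verts (fst Y) \<and> card e = 2" using e' X(1) sub by (auto simp: Y_def simple_graph_def)
  qed
  moreover have "gconnected (fst Y)" unfolding gconnected_def
  proof (intro conjI ballI)
    show "verts (fst Y) \<noteq> {}" using X(4) by (auto simp: Y_def)
    have step: "(f u, f v) \<in> adj (fst Y)" if "(u, v) \<in> adj (fst X)" for u v
      using that edge adj_verts[OF X(1) that] by (simp add: adj_iff)
    have walk: "(f u, f v) \<in> (adj (fst Y))\<^sup>*" if "(u, v) \<in> (adj (fst X))\<^sup>*" for u v
      using that by induction (auto intro: rtrancl_into_rtrancl step)
    fix u v assume "u \<in> verts (fst Y)" "v \<in> verts (fst Y)"
    then show "(u, v) \<in> (adj (fst Y))\<^sup>*" using X(2) walk by (auto simp: Y_def gconnected_def)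
  qed
  moreover have "locally_finite (fst Y)" unfolding locally_finite_def
  proof
    fix y assume "y \<in> verts (fst Y)"
    then obtain v where v: "v \<in> verts (fst X)" "y = f v" by (auto simp: Y_def)
    have "nbrs (fst Y) y \<subseteq> f ` nbrs (fst X) v"
    proof
      fix z assume "z \<in> nbrs (fst Y) y"
      then have yz: "{y, z} \<in> edges (fst Y)" by (simp add: nbrs_def)
      then obtain e where e: "e \<in> edges (fst X)" "{y, z} = f ` e"
        by (metis Y_def fst_conv image_iff snd_conv)
      then have "z \<in> f ` e" by blast
      then obtain u where u: "u \<in> verts (fst X)" "z = f u" using sub[OF e(1)] by blast
      then show "z \<in> f ` nbrs (fst X) v" using yz v edge[of v u] by (auto simp: nbrs_def)
    qed
    then show "finite (nbrs (fst Y) y)"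
      using X(3) v(1) by (meson finite_imageI finite_subset locally_finite_def)
  qed
  moreover have "snd Y \<in> verts (fst Y)" using X(4) by (simp add: Y_def)
  ultimately have "rgraph Y" by (intro rgraphI)
  then show ?thesis using iso unfolding rgraph_iso_iff by blast
qed

subsection \<open>The space of rooted graphs up to isomorphism\<close>

text \<open>Connected locally finite graphs are countable, so graphs on subsets of \<open>nat\<close> represent
  all isomorphism classes.\<close>

definition rgraph_equiv :: "nat rgraph \<Rightarrow> nat rgraph \<Rightarrow> bool" where
  "rgraph_equiv X Y \<longleftrightarrow> rgraph X \<and> rgraph Y \<and> rgraph_iso X Y"

lemma part_equivp_rgraph_equiv: "part_equivp rgraph_equiv"
proof (rule part_equivpI)
  have "rgraph (({0::nat}, {}), 0)"
    by (auto simp: rgraph_def simple_graph_def gconnected_def locally_finite_def nbrs_def)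
  then show "\<exists>X. rgraph_equiv X X" using rgraph_iso_refl unfolding rgraph_equiv_def by blast
  show "symp rgraph_equiv" by (auto intro!: sympI simp: rgraph_equiv_def rgraph_iso_sym)
  show "transp rgraph_equiv" by (auto intro!: transpI intro: rgraph_iso_trans simp: rgraph_equiv_def)
qed

quotient_type gbullet = "nat rgraph" / partial: rgraph_equiv
  by (rule part_equivp_rgraph_equiv)

lift_definition gball :: "nat \<Rightarrow> gbullet \<Rightarrow> gbullet" is rball
  by (simp add: rgraph_equiv_def rgraph_rball rgraph_iso_rball)

text \<open>Only meaningful if \<open>rgraph X\<close> holds; the witness then exists by \<open>ex_nat_rgraph_iso\<close>.\<close>

definition iso_class :: "'a rgraph \<Rightarrow> gbullet" where
  "iso_class X = abs_gbullet (SOME Y. rgraph Y \<and> rgraph_iso X Y)"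

lemma gball_gball: "gball r (gball s x) = gball (min r s) x"
  by transfer (simp add: rgraph_equiv_def rball_rball rgraphD rgraph_iso_refl rgraph_rball)

lemma gball_eq_mono: "gball s x = gball s y \<Longrightarrow> r \<le> s \<Longrightarrow> gball r x = gball r y"
  using gball_gball[of r s x] gball_gball[of r s y] by (simp add: min_absorb1)

lemma gbullet_eqI: "(\<And>r. gball r x = gball r y) \<Longrightarrow> x = y"
proof transfer
  fix X Y :: "nat rgraph"
  assume X: "rgraph_equiv X X" and Y: "rgraph_equiv Y Y"
    and b: "\<And>r. rgraph_equiv (rball r X) (rball r Y)"
  have "rgraph_iso X Y"
    by (rule rgraph_iso_if_all_balls_iso) (use X Y b in \<open>simp_all add: rgraph_equiv_def\<close>)
  then show "rgraph_equiv X Y" using X Y by (simp add: rgraph_equiv_def)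
qed

lemma gball_0: "gball 0 x = gball 0 y"
proof transfer
  fix X Y :: "nat rgraph" assume "rgraph_equiv X X" "rgraph_equiv Y Y"
  then have X: "rgraph X" and Y: "rgraph Y" by (auto simp: rgraph_equiv_def)
  note X' = rgraphD[OF X] and Y' = rgraphD[OF Y]
  have b: "bverts 0 X = {snd X}" "bverts 0 Y = {snd Y}" using X'(4) Y'(4) unfolding bverts_def by auto
  have "card {a} \<noteq> 2" for a :: nat by simp
  then have "{a} \<notin> edges (fst X)" "{a} \<notin> edges (fst Y)" for a
    using X'(1) Y'(1) unfolding simple_graph_def by blast+
  then have "iso_map (\<lambda>_. snd Y) (rball 0 X) (rball 0 Y)"
    by (auto simp: iso_map_def b bij_betw_def)
  then show "rgraph_equiv (rball 0 X) (rball 0 Y)"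
    using X Y unfolding rgraph_equiv_def rgraph_iso_iff by (blast intro: rgraph_rball)
qed

instantiation gbullet :: metric_space
begin

definition dist_gbullet :: "gbullet \<Rightarrow> gbullet \<Rightarrow> real" where
  "dist_gbullet x y =
     (if \<forall>R. gball R x = gball R y then 0 else (1/2) ^ (GREATEST R. gball R x = gball R y))"

definition uniformity_gbullet :: "(gbullet \<times> gbullet) filter" where
  "uniformity_gbullet = (INF e\<in>{0<..}. principal {(x, y). dist x y < e})"

definition open_gbullet :: "gbullet set \<Rightarrow> bool" where
  "open_gbullet U = (\<forall>x\<in>U. \<forall>\<^sub>F (x', y) in uniformity. x' = x \<longrightarrow> y \<in> U)"

lemma dist_gbullet_less_iff: "dist x y < (1/2) ^ n \<longleftrightarrow> gball (Suc n) x = gball (Suc n) (y :: gbullet)"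
proof (cases "\<forall>R. gball R x = gball R y")
  case False
  then obtain N where N: "gball N x \<noteq> gball N y" by blast
  let ?P = "\<lambda>R. gball R x = gball R y"
  have bd: "R \<le> N" if "?P R" for R
  proof (rule ccontr)
    assume "\<not> R \<le> N"
    then show False using gball_eq_mono[OF that, of N] N by simp
  qed
  have P: "?P (Greatest ?P)" by (rule GreatestI_nat[of ?P 0 N]) (use gball_0 bd in auto)
  have "?P (Suc n) \<longleftrightarrow> Suc n \<le> Greatest ?P"
  proof
    assume "?P (Suc n)"
    then show "Suc n \<le> Greatest ?P" by (rule Greatest_le_nat) (rule bd)
  qed (rule gball_eq_mono[OF P])
  moreover have "dist x y < (1/2) ^ n \<longleftrightarrow> n < Greatest ?P"
    using False by (auto simp: dist_gbullet_def power_strict_decreasing_iff)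
  ultimately show ?thesis by auto
qed (simp add: dist_gbullet_def)

instance
proof
  show "uniformity = (INF e\<in>{0<..}. principal {(x :: gbullet, y). dist x y < e})"
    by (rule uniformity_gbullet_def)
  show "open U = (\<forall>x\<in>U. \<forall>\<^sub>F (x', y) in uniformity. x' = x \<longrightarrow> y \<in> U)" for U :: "gbullet set"
    by (rule open_gbullet_def)
  show "dist x y = 0 \<longleftrightarrow> x = y" for x y :: gbullet
    by (auto simp: dist_gbullet_def intro: gbullet_eqI)
  show "dist x y \<le> dist x z + dist y z" for x y z :: gbullet
  proof (rule ccontr)
    assume "\<not> ?thesis"
    then have lt: "dist x z + dist y z < dist x y" by simp
    have nonneg: "0 \<le> dist a b" for a b :: gbullet by (simp add: dist_gbullet_def)
    obtain N where N: "dist x y = (1/2) ^ N"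
      using lt nonneg[of x z] nonneg[of y z] by (auto simp: dist_gbullet_def split: if_splits)
    have "dist x z < (1/2) ^ N" "dist y z < (1/2) ^ N" using lt N nonneg[of x z] nonneg[of y z] by auto
    then have "dist x y < (1/2) ^ N" unfolding dist_gbullet_less_iff by simp
    then show False using N by simp
  qed
qed

end


section \<open>Local limits\<close>

definition conv_in_distr :: "(nat \<Rightarrow> 'b :: metric_space measure) \<Rightarrow> 'b measure \<Rightarrow> bool" where
  "conv_in_distr M N \<longleftrightarrow> (\<forall>f :: 'b \<Rightarrow> real. continuous_on UNIV f \<longrightarrow> bounded (range f) \<longrightarrow>
     (\<lambda>n. \<integral>x. f x \<partial>M n) \<longlonglongrightarrow> (\<integral>x. f x \<partial>N))"

definition uniform_root :: "'a graph pmf \<Rightarrow> 'a rgraph pmf" where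
  "uniform_root H = do {G \<leftarrow> H; \<rho> \<leftarrow> pmf_of_set (verts G); return_pmf (G, \<rho>)}"

text \<open>The ball is taken before passing to the isomorphism class, so the finite graphs may be
  disconnected.\<close>

definition local_limit :: "(nat \<Rightarrow> 'a graph pmf) \<Rightarrow> gbullet measure \<Rightarrow> bool" where
  "local_limit H \<mu> \<longleftrightarrow> prob_space \<mu> \<and> sets \<mu> = sets borel \<and>
     (\<forall>r. conv_in_distr
        (\<lambda>n. distr (measure_pmf (uniform_root (H n))) borel (\<lambda>X. iso_class (rball r X)))
        (distr \<mu> borel (gball r)))"


section \<open>Galton--Watson trees\<close>

text \<open>Individuals are words over \<open>nat\<close> (Ulam--Harris notation); the sample point \<open>k\<close> assigns to
  every potential individual \<open>w\<close> its number \<open>k w\<close> of children \<open>w @ [0], \<dots>, w @ [k w - 1]\<close>.\<close>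

definition gw_space :: "nat pmf \<Rightarrow> (nat list \<Rightarrow> nat) measure" where
  "gw_space \<xi> = (\<Pi>\<^sub>M w\<in>UNIV. measure_pmf \<xi>)"

inductive_set gw_verts :: "(nat list \<Rightarrow> nat) \<Rightarrow> nat list set" for k where
  root: "[] \<in> gw_verts k"
| child: "w \<in> gw_verts k \<Longrightarrow> i < k w \<Longrightarrow> w @ [i] \<in> gw_verts k"

definition gw_tree :: "(nat list \<Rightarrow> nat) \<Rightarrow> nat list rgraph" where
  "gw_tree k = ((gw_verts k, {{w, w @ [i]} |w i. w \<in> gw_verts k \<and> i < k w}), [])"

definition survives :: "nat \<Rightarrow> (nat list \<Rightarrow> nat) \<Rightarrow> bool" where
  "survives m k \<longleftrightarrow> (\<exists>w\<in>gw_verts k. length w = m)"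

definition gw_conditioned :: "nat pmf \<Rightarrow> nat \<Rightarrow> gbullet measure" where
  "gw_conditioned \<xi> m = distr
     (uniform_measure (gw_space \<xi>) {k \<in> space (gw_space \<xi>). survives m k})
     borel (\<lambda>k. iso_class (gw_tree k))"

text \<open>\<open>gw_conditioned_to_survive \<xi> \<mu>\<close>: \<open>\<mu>\<close> is the law of the Galton--Watson tree with offspring
  law \<open>\<xi>\<close> conditioned to survive forever, i.e. the limit in distribution of the trees conditioned
  to survive \<open>m\<close> generations.\<close>

definition gw_conditioned_to_survive :: "nat pmf \<Rightarrow> gbullet measure \<Rightarrow> bool" where
  "gw_conditioned_to_survive \<xi> \<mu> \<longleftrightarrow> prob_space \<mu> \<and> sets \<mu> = sets borel \<and>
     (\<forall>r. conv_in_distr (\<lambda>m. distr (gw_conditioned \<xi> m) borel (gball r)) (distr \<mu> borel (gball r)))"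

end

theory Submission
  imports Defs "HOL-Real_Asymp.Real_Asymp"
begin

text \<open>
  For a \<open>d\<close>-regular simple graph on \<open>N\<close> vertices the effective resistance of every edge is at
  least \<open>2/d - 2/d\<^sup>2\<close>, while Foster's theorem gives their sum \<open>N - 1\<close>. Hence the resistance of
  most edges \<open>xy\<close> is close to \<open>2/d\<close>, which forces the potential of the unit current flow from \<open>x\<close> to
  \<open>y\<close> to be close in energy to \<open>(\<one>\<^sub>x - \<one>\<^sub>y)/d\<close>. These potentials are test flows that bound
  from above the probability that a copy of a finite tree consisting of such edges lies in the
  spanning tree, and indicator functions are test functions that bound from above the probability
  that no further edge is attached to its inner vertices. Altogether the probability of each
  possible ball is asymptotically at most its probability in the limit. Edges of large resistance
  are excluded by transporting mass from such an edge to the roots that see it.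

  The limit law is a probability measure, so it remains to prevent mass from escaping. The root
  degree has mean \<open>2 - 2/N\<close>, the limit degree has mean 2, so the upper bounds make the root degree
  uniformly integrable, and mass transport extends tightness to balls of every radius.
\<close>

section \<open>Trees as edge sets\<close>

text \<open>For a ball with \<open>k\<close> vertices, of which \<open>a\<close> are inner and
  \<open>l = k - a\<close> lie at the last level, there are at most
  \<open>card V * d ^ (k - 1)\<close> embedded copies. Joining a vertex to \<open>s\<close>
  contracted ones has probability about \<open>(1 + 1/s) / d\<close>, and the product over
  \<open>1 \<le> s < k\<close> telescopes to \<open>k / d ^ (k - 1)\<close>. Keeping further edges
  away from the inner vertices costs \<open>exp (- a) * (k - a) / k\<close>, where
  \<open>exp (- a)\<close> comes from the outer ends of the deleted edges and
  \<open>(k - a) / k\<close> from the shrinking boundary of the contracted set. The product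
  \<open>l * exp (- a)\<close> bounds the expected number of isomorphisms from the ball. The Poisson
  tree gives the same number: its plane orderings cancel the factorials and leave
  \<open>exp (- a)\<close>, and conditioning a critical tree on survival weights by the number
  \<open>l\<close> of vertices through which it can survive. Counting isomorphisms instead of
  classes makes the automorphisms drop out of the comparison. Each edge is added or deleted given
  the earlier ones, so the potential theory is developed for trees that contain \<open>A\<close> and
  avoid \<open>B\<close>.\<close>

definition conn :: "'a set set \<Rightarrow> 'a rel" where
  "conn F = {(u, v). {u, v} \<in> F}\<^sup>*"

lemma conn_adj: "conn F = (adj (V, F))\<^sup>*"
  by (simp add: conn_def adj_def)

lemma conn_refl [simp]: "(u, u) \<in> conn F"
  by (simp add: conn_def)

lemma conn_trans: "(u, v) \<in> conn F \<Longrightarrow> (v, w) \<in> conn F \<Longrightarrow> (u, w) \<in> conn F"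
  unfolding conn_def by (rule rtrancl_trans)

lemma conn_sym: "(u, v) \<in> conn F \<Longrightarrow> (v, u) \<in> conn F"
  unfolding conn_def by (rule symD[OF sym_rtrancl]) (auto simp: sym_def insert_commute)

lemma conn_commute: "(u, v) \<in> conn F \<longleftrightarrow> (v, u) \<in> conn F"
  by (rule iffI; erule conn_sym)

lemma conn_mono: "F \<subseteq> F' \<Longrightarrow> conn F \<subseteq> conn F'"
  unfolding conn_def by (rule rtrancl_mono) auto

lemma conn_edge: "{u, v} \<in> F \<Longrightarrow> (u, v) \<in> conn F"
  unfolding conn_def by auto

text \<open>A walk can be cut at its first and last use of the new edge. If both cuts lie at the
  same endpoint, the edge can be skipped altogether, so only the two crossings remain.\<close>

lemma conn_insert:
  "(a, b) \<in> conn (insert {z, w} F) \<longleftrightarrow>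
     (a, b) \<in> conn F \<or> (a, z) \<in> conn F \<and> (w, b) \<in> conn F \<or> (a, w) \<in> conn F \<and> (z, b) \<in> conn F"
proof -
  let ?r = "{(u, v). {u, v} \<in> F}"
  have "{(u, v). {u, v} \<in> insert {z, w} F} = insert (z, w) (insert (w, z) ?r)"
    by (auto simp: doubleton_eq_iff)
  then have "conn (insert {z, w} F) = (insert (z, w) (insert (w, z) ?r))\<^sup>*"
    by (simp add: conn_def)
  then show ?thesis
    unfolding rtrancl_insert conn_def[symmetric]
    by simp (meson conn_refl conn_trans)
qed

text \<open>Acyclicity through connectivity alone: it passes to subsets and is preserved by
  exchanges of edges through transitivity of \<open>conn\<close>, without handling cycles as
  lists.\<close>

definition bridges :: "'a set set \<Rightarrow> bool" where
  "bridges F \<longleftrightarrow> (\<forall>u v. {u, v} \<in> F \<longrightarrow> (u, v) \<notin> conn (F - {{u, v}}))"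

lemma bridgesD: "bridges F \<Longrightarrow> {u, v} \<in> F \<Longrightarrow> (u, v) \<notin> conn (F - {{u, v}})"
  by (auto simp: bridges_def)

lemma bridges_subset: "bridges F \<Longrightarrow> F' \<subseteq> F \<Longrightarrow> bridges F'"
  unfolding bridges_def using conn_mono by (meson Diff_mono order_refl subset_iff)

text \<open>A shortest walk repeats no vertex, since the segment between two occurrences could be
  cut out.\<close>

lemma simple_path_of_rtrancl:
  assumes "(u, v) \<in> r\<^sup>*"
  obtains p where "p \<noteq> []" "hd p = u" "last p = v" "distinct p"
    "\<And>i. Suc i < length p \<Longrightarrow> (p ! i, p ! Suc i) \<in> r"
proof -
  define P where "P n p \<longleftrightarrow> length p = n \<and> p \<noteq> [] \<and> hd p = u \<and> last p = v \<and>
    (\<forall>i. Suc i < length p \<longrightarrow> (p ! i, p ! Suc i) \<in> r)" for n p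
  have "\<exists>p. p \<noteq> [] \<and> hd p = u \<and> last p = v \<and> (\<forall>i. Suc i < length p \<longrightarrow> (p ! i, p ! Suc i) \<in> r)"
    using assms
  proof (induction rule: rtrancl_induct)
    case base
    then show ?case by (intro exI[of _ "[u]"]) auto
  next
    case (step y z)
    then obtain p where p: "p \<noteq> []" "hd p = u" "last p = y"
      "\<And>i. Suc i < length p \<Longrightarrow> (p ! i, p ! Suc i) \<in> r" by blast
    have "((p @ [z]) ! i, (p @ [z]) ! Suc i) \<in> r" if "Suc i < length (p @ [z])" for i
    proof (cases "Suc i < length p")
      case True
      then show ?thesis using p(4)[OF True] by (simp add: nth_append)
    next
      case False
      then have "i = length p - 1" using that by simp
      then show ?thesis using step(2) p(1,3) by (auto simp: nth_append last_conv_nth)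
    qed
    then show ?case using p by (intro exI[of _ "p @ [z]"]) auto
  qed
  then have ex: "\<exists>n p. P n p" by (auto simp: P_def)
  define n where "n = (LEAST n. \<exists>p. P n p)"
  obtain p where p: "P n p" using LeastI_ex[OF ex] unfolding n_def by blast
  have "distinct p"
  proof (rule ccontr)
    assume "\<not> distinct p"
    then obtain i j where ij: "i < j" "j < length p" "p ! i = p ! j"
      by (metis distinct_conv_nth linorder_neqE_nat)
    define q where "q = take (Suc i) p @ drop (Suc j) p"
    have lq: "length q = length p - (j - i)" using ij by (auto simp: q_def)
    have "(q ! k, q ! Suc k) \<in> r" if k: "Suc k < length q" for k
    proof -
      have st: "Suc m < length p \<Longrightarrow> (p ! m, p ! Suc m) \<in> r" for m using p by (auto simp: P_def)
      have a: "q ! m = p ! m" if "m \<le> i" for m using that ij by (auto simp: q_def nth_append)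
      have b: "q ! m = p ! (m + (j - i))" if "m > i" "m < length q" for m
      proof -
        have "q ! m = p ! (Suc j + (m - Suc i))" using that ij by (auto simp: q_def nth_append min_def)
        also have "Suc j + (m - Suc i) = m + (j - i)" using that ij by auto
        finally show ?thesis .
      qed
      consider "Suc k \<le> i" | "k = i" | "k > i" by linarith
      then show ?thesis
      proof cases
        case 1
        then show ?thesis using a st[of k] ij by auto
      next
        case 2
        have "q ! k = p ! j" using a 2 ij by simp
        moreover have "q ! Suc k = p ! Suc j" using b[of "Suc k"] k 2 ij by (simp add: Suc_diff_le)
        ultimately show ?thesis using st[of j] k lq 2 ij by auto
      next
        case 3
        then show ?thesis using b[of k] b[of "Suc k"] st[of "k + (j - i)"] k lq by auto
      qed
    qed
    moreover have "q \<noteq> []" "hd q = u" using p ij by (auto simp: q_def P_def hd_append)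
    moreover have "last q = v"
    proof (cases "Suc j < length p")
      case True
      then show ?thesis using p by (simp add: q_def P_def)
    next
      case False
      \<comment> \<open>If the cut removes the whole tail, the new walk ends at position
        \<open>i\<close>, which carries the same vertex.\<close>
      then have "j = length p - 1" using ij by simp
      then have "last p = p ! i" using ij p by (auto simp: last_conv_nth P_def)
      then show ?thesis using False p ij by (simp add: q_def P_def take_Suc_conv_app_nth)
    qed
    ultimately have "P (length q) q" by (auto simp: P_def)
    then have "n \<le> length q" unfolding n_def by (intro Least_le) blast
    then show False using lq ij p by (auto simp: P_def)
  qed
  then show ?thesis using that[of p] p by (auto simp: P_def)
qed

text \<open>A cycle without its closing edge still joins the ends of that edge. Conversely, a simple
  path that joins the ends of an edge and avoids it closes up to a cycle; it has at least three
  vertices because its ends differ and a single step would be the avoided edge.\<close>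

lemma bridges_iff_no_gcycle:
  assumes "\<And>e. e \<in> F \<Longrightarrow> card e = 2"
  shows "bridges F \<longleftrightarrow> (\<nexists>xs. gcycle (V, F) xs)"
proof
  assume br: "bridges F"
  show "\<nexists>xs. gcycle (V, F) xs"
  proof
    assume "\<exists>xs. gcycle (V, F) xs"
    then obtain xs where xs: "3 \<le> length xs" "distinct xs"
      "\<And>i. i < length xs \<Longrightarrow> {xs ! i, xs ! (Suc i mod length xs)} \<in> F" by (auto simp: gcycle_def)
    define m where "m = length xs - 1"
    have m: "Suc m = length xs" "m \<ge> 2" using xs(1) by (auto simp: m_def)
    let ?e = "{xs ! m, xs ! 0}"
    have "?e \<in> F" using xs(3)[of m] m by simp
    have "(xs ! 0, xs ! i) \<in> conn (F - {?e})" if "i \<le> m" for i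
      using that
    proof (induction i)
      case (Suc i)
      have "{xs ! i, xs ! Suc i} \<in> F" using xs(3)[of i] m Suc.prems by simp
      moreover have "{xs ! i, xs ! Suc i} \<noteq> ?e"
      proof
        assume "{xs ! i, xs ! Suc i} = ?e"
        then consider "xs ! i = xs ! m" | "xs ! i = xs ! 0" "xs ! Suc i = xs ! m"
          by (auto simp: doubleton_eq_iff)
        moreover have inj: "a = b" if "xs ! a = xs ! b" "a \<le> m" "b \<le> m" for a b
          using that xs(2) m by (simp add: nth_eq_iff_index_eq)
        ultimately show False
        proof cases
          case 1
          then show False using inj[OF 1] Suc.prems by simp
        next
          case 2
          then show False using inj[OF 2(1)] inj[OF 2(2)] Suc.prems m by simp
        qed
      qed
      ultimately have "(xs ! i, xs ! Suc i) \<in> conn (F - {?e})" by (intro conn_edge) simp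
      then show ?case using Suc conn_trans by (metis Suc_leD)
    qed simp
    from conn_sym[OF this[of m]] have "(xs ! m, xs ! 0) \<in> conn (F - {?e})" by simp
    then show False using bridgesD[OF br \<open>?e \<in> F\<close>] by simp
  qed
next
  assume nc: "\<nexists>xs. gcycle (V, F) xs"
  show "bridges F" unfolding bridges_def
  proof (intro allI impI notI)
    fix u v assume uv: "{u, v} \<in> F" and c: "(u, v) \<in> conn (F - {{u, v}})"
    obtain p where p: "p \<noteq> []" "hd p = u" "last p = v" "distinct p"
      "\<And>i. Suc i < length p \<Longrightarrow> {p ! i, p ! Suc i} \<in> F - {{u, v}}"
      using simple_path_of_rtrancl[OF c[unfolded conn_def]] by auto
    have ne: "u \<noteq> v" using assms[OF uv] by auto
    have "length p \<noteq> 1" using p(1-3) ne by (auto simp: length_Suc_conv)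
    moreover have "length p \<noteq> 2"
    proof
      assume l: "length p = 2"
      then have "{p ! 0, p ! 1} \<noteq> {u, v}" using p(5)[of 0] by auto
      then show False using l p(1-3) by (auto simp: hd_conv_nth last_conv_nth)
    qed
    moreover have "length p \<noteq> 0" using p(1) by simp
    ultimately have l: "length p \<ge> 3" by linarith
    have "{p ! i, p ! (Suc i mod length p)} \<in> F" if "i < length p" for i
    proof (cases "Suc i < length p")
      case True
      then show ?thesis using p(5)[OF True] by simp
    next
      case False
      then have "Suc i = length p" using that by simp
      then have "p ! i = v" "p ! (Suc i mod length p) = u"
        using p(1-3) by (auto simp: hd_conv_nth last_conv_nth dest: arg_cong[where f = "\<lambda>x. x - 1"])
      then show ?thesis using uv by (simp add: insert_commute)
    qed
    then have "gcycle (V, F) p" using l p(4) by (simp add: gcycle_def)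
    then show False using nc by blast
  qed
qed

text \<open>Components plus edges make vertices. In the induction a new bridge merges two different
  components into one, so their number drops by exactly one.\<close>

lemma card_bridges:
  assumes "finite V" "\<And>e. e \<in> F \<Longrightarrow> e \<subseteq> V \<and> card e = 2" "bridges F"
  shows "card ((\<lambda>v. {u\<in>V. (v, u) \<in> conn F}) ` V) + card F = card V"
proof -
  have "finite F" using assms(1,2) by (meson PowI finite_Pow_iff finite_subset subsetI)
  then show ?thesis using assms
  proof (induction F rule: finite_induct)
    case empty
    have "conn {} = Id" by (auto simp: conn_def)
    then have "(\<lambda>v. {u\<in>V. (v, u) \<in> conn {}}) ` V = (\<lambda>v. {v}) ` V" by (intro image_cong) auto
    then show ?case by (simp add: card_image)
  next
    case (insert e F)
    obtain z w where e: "e = {z, w}" "z \<noteq> w" using insert.prems(2)[of e] by (auto simp: card_2_iff)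
    have zw: "z \<in> V" "w \<in> V" using insert.prems(2)[of e] e by auto
    have F: "insert e F - {{z, w}} = F" using insert.hyps e by auto
    have nc: "(z, w) \<notin> conn F" using bridgesD[OF insert.prems(3), of z w] e F by simp
    define C where "C v = {u\<in>V. (v, u) \<in> conn F}" for v
    define C' where "C' v = {u\<in>V. (v, u) \<in> conn (insert e F)}" for v
    have C_eq: "C u = C v" if "(u, v) \<in> conn F" for u v
      unfolding C_def using that by (intro set_eqI) (simp, meson conn_trans conn_sym)
    have C_in: "v \<in> C v" if "v \<in> V" for v using that by (simp add: C_def)
    have C'1: "C' v = C z \<union> C w" if "(v, z) \<in> conn F \<or> (v, w) \<in> conn F" for v
      unfolding C_def C'_def e(1) conn_insert using that by (intro set_eqI) (simp, meson conn_trans conn_sym)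
    have C'2: "C' v = C v" if "\<not> ((v, z) \<in> conn F \<or> (v, w) \<in> conn F)" for v
      unfolding C_def C'_def e(1) conn_insert using that by blast
    have im: "C ` V = insert (C z) (insert (C w) (C ` {v\<in>V. \<not> ((v, z) \<in> conn F \<or> (v, w) \<in> conn F)}))"
      (is "_ = insert _ (insert _ ?R)")
    proof -
      have "C v = C z \<or> C v = C w" if "(v, z) \<in> conn F \<or> (v, w) \<in> conn F" for v
        using that C_eq[of v z] C_eq[of v w] by blast
      then show ?thesis using zw by blast
    qed
    have im': "C' ` V = insert (C z \<union> C w) ?R"
    proof
      show "C' ` V \<subseteq> insert (C z \<union> C w) ?R" using C'1 C'2 by fastforce
      show "insert (C z \<union> C w) ?R \<subseteq> C' ` V" using C'1[of z] C'2 zw by (auto simp: image_iff)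
    qed
    have mem: "u \<in> C v \<longleftrightarrow> u \<in> V \<and> (v, u) \<in> conn F" for u v by (simp add: C_def)
    have notR: "X \<notin> ?R" if "z \<in> X \<or> w \<in> X" for X
      using that mem by blast
    have "C z \<noteq> C w" using nc mem[of w z] C_in[OF zw(2)] by metis
    then have "C z \<notin> insert (C w) ?R" "C w \<notin> ?R" "C z \<union> C w \<notin> ?R"
      using C_in[OF zw(1)] C_in[OF zw(2)] notR by blast+
    moreover have "finite ?R" using insert.prems(1) by simp
    ultimately have "card (C ` V) = Suc (Suc (card ?R))" "card (C' ` V) = Suc (card ?R)"
      unfolding im im' by auto
    moreover have "card (C ` V) + card F = card V"
      unfolding C_def using insert bridges_subset[OF insert.prems(3), of F] by auto
    ultimately show ?case using insert.hyps unfolding C'_def by simp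
  qed
qed

lemma card_tree_edges:
  assumes "finite V" "V \<noteq> {}" "\<And>e. e \<in> F \<Longrightarrow> e \<subseteq> V \<and> card e = 2" "bridges F"
    "\<And>u v. u \<in> V \<Longrightarrow> v \<in> V \<Longrightarrow> (u, v) \<in> conn F"
  shows "card F + 1 = card V"
proof -
  have "(\<lambda>v. {u\<in>V. (v, u) \<in> conn F}) ` V = {V}" using assms(2,5) by auto
  then show ?thesis using card_bridges[OF assms(1,3,4)] by simp
qed

text \<open>Removing \<open>e\<close> leaves \<open>x\<close>, \<open>z\<close> on one side and
  \<open>w\<close>, \<open>y\<close> on the other, so \<open>{z, w}\<close> is a bridge. If another
  edge lay on a cycle, the cycle would pass through \<open>{z, w}\<close>, and the rest of it would
  join \<open>z\<close> to \<open>w\<close> without that edge.\<close>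

lemma bridges_exchange:
  assumes "bridges T" "e \<in> T" "e = {x, y}"
    and z: "(x, z) \<in> conn (T - {e})" and w: "(w, y) \<in> conn (T - {e})"
  shows "bridges (insert {z, w} (T - {e}))"
proof -
  let ?F = "T - {e}"
  have nxy: "(x, y) \<notin> conn ?F" using bridgesD[OF assms(1)] assms(2,3) by simp
  have nzw: "(z, w) \<notin> conn ?F"
    using nxy conn_trans[OF conn_trans[OF z _] w] by blast
  show ?thesis unfolding bridges_def
  proof (intro allI impI notI)
    fix a b assume ab: "{a, b} \<in> insert {z, w} ?F"
      and c: "(a, b) \<in> conn (insert {z, w} ?F - {{a, b}})"
    show False
    proof (cases "{a, b} = {z, w}")
      case True
      then have "conn (insert {z, w} ?F - {{a, b}}) \<subseteq> conn ?F" by (intro conn_mono) auto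
      then have "(a, b) \<in> conn ?F" using c by blast
      then show False using True nzw by (metis conn_sym doubleton_eq_iff)
    next
      case False
      let ?H = "?F - {{a, b}}"
      have "insert {z, w} ?F - {{a, b}} = insert {z, w} ?H" using False by auto
      then have c': "(a, b) \<in> conn (insert {z, w} ?H)" using c by simp
      have "{a, b} \<in> ?F" using ab False by simp
      then have abF: "(a, b) \<in> conn ?F" by (rule conn_edge)
      have "(a, b) \<notin> conn ?H"
        using bridgesD[OF bridges_subset[OF assms(1), of ?F] \<open>{a, b} \<in> ?F\<close>] by auto
      then have "(a, z) \<in> conn ?H \<and> (w, b) \<in> conn ?H \<or> (a, w) \<in> conn ?H \<and> (z, b) \<in> conn ?H"
        using c' by (simp add: conn_insert)
      then have "(a, z) \<in> conn ?F \<and> (w, b) \<in> conn ?F \<or> (a, w) \<in> conn ?F \<and> (z, b) \<in> conn ?F"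
        using conn_mono[of ?H ?F] by auto
      then have "(z, w) \<in> conn ?F" using abF by (meson conn_sym conn_trans)
      then show False using nzw by simp
    qed
  qed
qed

text \<open>The index set consists of the edges of the unique path from \<open>x\<close> to
  \<open>y\<close>, oriented along it, so the sum telescopes.\<close>

lemma bridges_path:
  assumes T: "bridges T" and "finite V" and c: "(x, y) \<in> conn T" and sub: "\<And>e. e \<in> T \<Longrightarrow> e \<subseteq> V \<and> card e = 2"
  shows "(\<Sum>(z, w)\<in>{(z, w). {z, w} \<in> T \<and> (x, z) \<in> conn (T - {{z, w}}) \<and> (w, y) \<in> conn (T - {{z, w}})}.
      f z - f w :: real) = f x - f y"
proof -
  obtain p where p: "p \<noteq> []" "hd p = x" "last p = y" "distinct p"
    "\<And>i. Suc i < length p \<Longrightarrow> {p ! i, p ! Suc i} \<in> T"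
    using simple_path_of_rtrancl[OF c[unfolded conn_def]] by auto
  define m where "m = length p - 1"
  have m: "length p = Suc m" using p(1) by (simp add: m_def)
  have p0: "p ! 0 = x" and pm: "p ! m = y" using p(1-3) m by (auto simp: hd_conv_nth last_conv_nth)
  have left: "(x, p ! i) \<in> conn (T - {{p ! i, p ! Suc i}})" if "i < m" for i
  proof -
    have "(x, p ! j) \<in> conn (T - {{p ! i, p ! Suc i}})" if "j \<le> i" for j
      using that
    proof (induction j)
      case (Suc j)
      have "{p ! j, p ! Suc j} \<noteq> {p ! i, p ! Suc i}"
        using p(4) m Suc.prems \<open>i < m\<close> by (auto simp: doubleton_eq_iff nth_eq_iff_index_eq)
      then have "(p ! j, p ! Suc j) \<in> conn (T - {{p ! i, p ! Suc i}})"
        using p(5)[of j] m Suc.prems \<open>i < m\<close> by (intro conn_edge) auto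
      then show ?case using Suc conn_trans by (metis Suc_leD)
    qed (simp add: p0)
    then show ?thesis by simp
  qed
  have right: "(p ! Suc i, y) \<in> conn (T - {{p ! i, p ! Suc i}})" if "i < m" for i
  proof -
    have "(p ! Suc i, p ! j) \<in> conn (T - {{p ! i, p ! Suc i}})" if "Suc i \<le> j" "j \<le> m" for j
      using that
    proof (induction j rule: dec_induct)
      case (step j)
      have "{p ! j, p ! Suc j} \<noteq> {p ! i, p ! Suc i}"
        using p(4) m step by (auto simp: doubleton_eq_iff nth_eq_iff_index_eq)
      then have "(p ! j, p ! Suc j) \<in> conn (T - {{p ! i, p ! Suc i}})"
        using p(5)[of j] m step by (intro conn_edge) auto
      then show ?case using step conn_trans by (metis Suc_leD)
    qed simp
    then show ?thesis using pm that by auto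
  qed
  let ?S = "{(z, w). {z, w} \<in> T \<and> (x, z) \<in> conn (T - {{z, w}}) \<and> (w, y) \<in> conn (T - {{z, w}})}"
  have "?S = (\<lambda>i. (p ! i, p ! Suc i)) ` {..<m}"
  proof
    show "(\<lambda>i. (p ! i, p ! Suc i)) ` {..<m} \<subseteq> ?S" using left right p(5) m by auto
    show "?S \<subseteq> (\<lambda>i. (p ! i, p ! Suc i)) ` {..<m}"
    proof (clarify)
      fix z w assume zw: "{z, w} \<in> T" "(x, z) \<in> conn (T - {{z, w}})" "(w, y) \<in> conn (T - {{z, w}})"
      have nzw: "(z, w) \<notin> conn (T - {{z, w}})" using bridgesD[OF T zw(1)] .
      \<comment> \<open>A path that missed \<open>{z, w}\<close> would join \<open>x\<close> to
        \<open>y\<close> without this edge, and by the two side conditions also \<open>z\<close> to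
        \<open>w\<close>.\<close>
      have "\<exists>i<m. {p ! i, p ! Suc i} = {z, w}"
      proof (rule ccontr)
        assume no: "\<not> ?thesis"
        have "(x, p ! j) \<in> conn (T - {{z, w}})" if "j \<le> m" for j
          using that
        proof (induction j)
          case (Suc j)
          then have "(p ! j, p ! Suc j) \<in> conn (T - {{z, w}})"
            using no p(5)[of j] m by (intro conn_edge) auto
          then show ?case using Suc conn_trans by (metis Suc_leD)
        qed (simp add: p0)
        then have "(x, y) \<in> conn (T - {{z, w}})" using pm by auto
        then show False using nzw zw by (meson conn_sym conn_trans)
      qed
      then obtain i where i: "i < m" "{p ! i, p ! Suc i} = {z, w}" by blast
      show "(z, w) \<in> (\<lambda>i. (p ! i, p ! Suc i)) ` {..<m}"
      proof (cases "p ! i = z")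
        case True
        then show ?thesis using i by (auto simp: doubleton_eq_iff)
      next
        case False
        then have "p ! i = w" using i by (auto simp: doubleton_eq_iff)
        \<comment> \<open>The opposite orientation would put \<open>w\<close> on the side of
          \<open>x\<close> together with \<open>z\<close>.\<close>
        then have "(x, w) \<in> conn (T - {{z, w}})" using left[OF i(1)] i(2) by simp
        then show ?thesis using nzw zw(2) by (meson conn_sym conn_trans)
      qed
    qed
  qed
  moreover have "inj_on (\<lambda>i. (p ! i, p ! Suc i)) {..<m}"
    using p(4) m by (auto simp: inj_on_def nth_eq_iff_index_eq)
  ultimately have "(\<Sum>(z, w)\<in>?S. f z - f w) = (\<Sum>i<m. f (p ! i) - f (p ! Suc i))"
    by (simp add: sum.reindex)
  also have "\<dots> = f x - f y" using sum_lessThan_telescope'[of "\<lambda>i. f (p ! i)" m] p0 pm by simp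
  finally show ?thesis .
qed

section \<open>Kirchhoff's theorem for conditioned spanning trees\<close>

locale finite_conn_graph =
  fixes V :: "'a set" and E :: "'a set set"
  assumes finite_V: "finite V"
    and V_nonempty: "V \<noteq> {}"
    and edgeD: "e \<in> E \<Longrightarrow> e \<subseteq> V \<and> card e = 2"
    and connE: "u \<in> V \<Longrightarrow> v \<in> V \<Longrightarrow> (u, v) \<in> conn E"
begin

definition trees :: "'a set set set" where
  "trees = {T. T \<subseteq> E \<and> bridges T \<and> (\<forall>u\<in>V. \<forall>v\<in>V. (u, v) \<in> conn T)}"

text \<open>These trees stand for the spanning trees of the graph with \<open>A\<close> contracted
  and \<open>B\<close> deleted. Keeping them as subsets of \<open>trees\<close> avoids the
  construction of minors, and conditional probabilities become quotients of cardinalities.\<close>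

definition trees_with :: "'a set set \<Rightarrow> 'a set set \<Rightarrow> 'a set set set" where
  "trees_with A B = {T\<in>trees. A \<subseteq> T \<and> T \<inter> B = {}}"

definition arcs :: "'a set set \<Rightarrow> ('a \<times> 'a) set" where
  "arcs X = {(z, w). {z, w} \<in> X}"

text \<open>The Dirichlet form. Every edge occurs in \<open>arcs X\<close> with both orientations,
  hence the division by 2.\<close>

definition en :: "'a set set \<Rightarrow> ('a \<Rightarrow> real) \<Rightarrow> ('a \<Rightarrow> real) \<Rightarrow> real" where
  "en X f g = (\<Sum>(z, w)\<in>arcs X. (f z - f w) * (g z - g w)) / 2"

lemma finite_E: "finite E"
  using finite_V edgeD by (meson PowI finite_Pow_iff finite_subset subsetI)

lemma finite_trees: "finite trees"
  using finite_E by (auto simp: trees_def intro: finite_subset[of _ "Pow E"])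

lemma finite_trees_with: "finite (trees_with A B)"
  using finite_trees by (simp add: trees_with_def)

lemma edge_in_V: "{u, v} \<in> E \<Longrightarrow> u \<in> V \<and> v \<in> V \<and> u \<noteq> v"
  using edgeD[of "{u, v}"] by (cases "u = v") auto

lemma finite_arcs: "X \<subseteq> E \<Longrightarrow> finite (arcs X)"
  by (rule finite_subset[of _ "V \<times> V"]) (use finite_V edge_in_V in \<open>auto simp: arcs_def\<close>)

lemma treesD:
  assumes "T \<in> trees"
  shows "T \<subseteq> E" "bridges T" "u \<in> V \<Longrightarrow> v \<in> V \<Longrightarrow> (u, v) \<in> conn T"
  using assms by (auto simp: trees_def)

lemma card_tree:
  assumes "T \<in> trees"
  shows "card T + 1 = card V"
proof (rule card_tree_edges[OF finite_V V_nonempty _ treesD(2,3)[OF assms]])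
  show "e \<subseteq> V \<and> card e = 2" if "e \<in> T" for e
    using that treesD(1)[OF assms] edgeD by blast
qed

lemma trees_nonempty: "trees \<noteq> {}"
proof -
  define P where "P T \<longleftrightarrow> T \<subseteq> E \<and> (\<forall>u\<in>V. \<forall>v\<in>V. (u, v) \<in> conn T)" for T
  have "P E" using connE by (simp add: P_def)
  then obtain T where T: "P T" "\<And>T'. card T' < card T \<Longrightarrow> \<not> P T'"
    using exists_least_iff[of "\<lambda>n. \<exists>T. P T \<and> card T = n"] by blast
  have fin: "finite T" using T(1) finite_E finite_subset by (auto simp: P_def)
  have "bridges T" unfolding bridges_def
  proof (intro allI impI notI)
    fix u v assume uv: "{u, v} \<in> T" and c: "(u, v) \<in> conn (T - {{u, v}})"
    have "(a, b) \<in> conn (T - {{u, v}})" if "(a, b) \<in> conn T" for a b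
    proof -
      have "(a, b) \<in> conn (insert {u, v} (T - {{u, v}}))" using that uv by (simp add: insert_absorb)
      then show ?thesis unfolding conn_insert using c by (meson conn_sym conn_trans)
    qed
    then have "P (T - {{u, v}})" using T(1) by (auto simp: P_def)
    moreover have "card (T - {{u, v}}) < card T" using uv fin by (metis card_Diff1_less)
    ultimately show False using T(2) by blast
  qed
  then show ?thesis using T(1) by (auto simp: trees_def P_def)
qed

lemma tree_exchange:
  assumes T: "T \<in> trees" "{x, y} \<in> T" and zw: "{z, w} \<in> E"
    and z: "(x, z) \<in> conn (T - {{x, y}})" and w: "(w, y) \<in> conn (T - {{x, y}})"
  shows "insert {z, w} (T - {{x, y}}) \<in> trees" "{z, w} \<notin> T - {{x, y}}"
proof -
  let ?F = "T - {{x, y}}"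
  have nxy: "(x, y) \<notin> conn ?F" using bridgesD[OF treesD(2)[OF T(1)] T(2)] .
  show "{z, w} \<notin> ?F"
    using nxy conn_trans[OF conn_trans[OF z conn_edge] w] by blast
  have br: "bridges (insert {z, w} ?F)" by (rule bridges_exchange[OF treesD(2)[OF T(1)] T(2) refl z w])
  have "(x, z) \<in> conn (insert {z, w} ?F)" "(w, y) \<in> conn (insert {z, w} ?F)"
    using z w conn_mono[of ?F "insert {z, w} ?F"] by blast+
  moreover have "(z, w) \<in> conn (insert {z, w} ?F)" by (rule conn_edge) simp
  ultimately have xy: "(x, y) \<in> conn (insert {z, w} ?F)" by (meson conn_trans)
  have "(u, v) \<in> conn (insert {z, w} ?F)" if "u \<in> V" "v \<in> V" for u v
  proof -
    have "insert {x, y} ?F = T" using T(2) by auto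
    then have "(u, v) \<in> conn (insert {x, y} ?F)" using treesD(3)[OF T(1) that] by simp
    moreover have "(a, b) \<in> conn ?F \<Longrightarrow> (a, b) \<in> conn (insert {z, w} ?F)" for a b
      using conn_mono[of ?F "insert {z, w} ?F"] by blast
    ultimately show ?thesis using xy unfolding conn_insert[of u v x y] by (meson conn_sym conn_trans)
  qed
  then show "insert {z, w} ?F \<in> trees"
    using br zw treesD(1)[OF T(1)] by (auto simp: trees_def)
qed

lemma tree_sides:
  assumes T: "T \<in> trees" "{x, y} \<in> T" and z: "z \<in> V"
  shows "(y, z) \<in> conn (T - {{x, y}}) \<longleftrightarrow> (x, z) \<notin> conn (T - {{x, y}})"
proof -
  let ?F = "T - {{x, y}}"
  have nxy: "(x, y) \<notin> conn ?F" using bridgesD[OF treesD(2)[OF T(1)] T(2)] .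
  have x: "x \<in> V" using T treesD(1)[OF T(1)] edge_in_V by blast
  have "insert {x, y} ?F = T" using T(2) by auto
  then have "(x, z) \<in> conn (insert {x, y} ?F)" using treesD(3)[OF T(1) x z] by simp
  then have "(x, z) \<in> conn ?F \<or> (y, z) \<in> conn ?F" unfolding conn_insert by blast
  then show ?thesis using nxy by (meson conn_sym conn_trans)
qed

text \<open>Both sides count the same forests, those with two components of which one contains
  \<open>x\<close>, \<open>z\<close> and the other \<open>w\<close>, \<open>y\<close>. Adding
  \<open>{x, y}\<close> to the forest gives a tree on the left, adding \<open>{z, w}\<close> one on
  the right; neither edge meets the conditions imposed by \<open>A\<close> and
  \<open>B\<close>.\<close>

lemma card_exchange:
  assumes e: "{x, y} \<in> E" "{x, y} \<notin> A" "{x, y} \<notin> B"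
    and zw: "{z, w} \<in> E" "{z, w} \<notin> A" "{z, w} \<notin> B"
  shows "card {T \<in> trees_with (insert {x, y} A) B.
            (x, z) \<in> conn (T - {{x, y}}) \<and> (w, y) \<in> conn (T - {{x, y}})} =
         card {T \<in> trees_with A B. {z, w} \<in> T \<and>
            (x, z) \<in> conn (T - {{z, w}}) \<and> (w, y) \<in> conn (T - {{z, w}})}" (is "card ?L = card ?R")
proof (rule bij_betw_same_card)
  show "bij_betw (\<lambda>T. insert {z, w} (T - {{x, y}})) ?L ?R"
  proof (rule bij_betwI[where g = "\<lambda>T. insert {x, y} (T - {{z, w}})"])
    show "(\<lambda>T. insert {z, w} (T - {{x, y}})) \<in> ?L \<rightarrow> ?R"
    proof
      fix T assume T: "T \<in> ?L"
      then have T': "T \<in> trees" "{x, y} \<in> T" by (auto simp: trees_with_def)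
      have c: "(x, z) \<in> conn (T - {{x, y}})" "(w, y) \<in> conn (T - {{x, y}})" using T by auto
      note X = tree_exchange[OF T' zw(1) c]
      have "insert {z, w} (T - {{x, y}}) - {{z, w}} = T - {{x, y}}" using X(2) by auto
      then show "insert {z, w} (T - {{x, y}}) \<in> ?R"
        using X(1) c T e zw by (auto simp: trees_with_def)
    qed
    show "(\<lambda>T. insert {x, y} (T - {{z, w}})) \<in> ?R \<rightarrow> ?L"
    proof
      fix T assume T: "T \<in> ?R"
      then have T': "T \<in> trees" "{z, w} \<in> T" by (auto simp: trees_with_def)
      have c: "(x, z) \<in> conn (T - {{z, w}})" "(w, y) \<in> conn (T - {{z, w}})" using T by auto
      note X = tree_exchange[OF T' e(1) conn_sym[OF c(1)] conn_sym[OF c(2)]]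
      have "insert {x, y} (T - {{z, w}}) - {{x, y}} = T - {{z, w}}" using X(2) by auto
      then show "insert {x, y} (T - {{z, w}}) \<in> ?L"
        using X(1) c T e zw by (auto simp: trees_with_def)
    qed
    show "insert {x, y} (insert {z, w} (T - {{x, y}}) - {{z, w}}) = T" if T: "T \<in> ?L" for T
    proof -
      have T': "T \<in> trees" "{x, y} \<in> T" using T by (auto simp: trees_with_def)
      have c: "(x, z) \<in> conn (T - {{x, y}})" "(w, y) \<in> conn (T - {{x, y}})" using T by auto
      show ?thesis using tree_exchange(2)[OF T' zw(1) c] T'(2) by blast
    qed
    show "insert {z, w} (insert {x, y} (T - {{z, w}}) - {{x, y}}) = T" if T: "T \<in> ?R" for T
    proof -
      have T': "T \<in> trees" "{z, w} \<in> T" using T by (auto simp: trees_with_def)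
      have c: "(x, z) \<in> conn (T - {{z, w}})" "(w, y) \<in> conn (T - {{z, w}})" using T by auto
      show ?thesis using tree_exchange(2)[OF T' e(1) conn_sym[OF c(1)] conn_sym[OF c(2)]] T'(2) by blast
    qed
  qed
qed

lemma sum_arcs_swap:
  "(\<Sum>(z, w)\<in>arcs X. h w z) = (\<Sum>(z, w)\<in>arcs X. h z w)"
  by (rule sum.reindex_bij_witness[where i = prod.swap and j = prod.swap])
    (auto simp: arcs_def insert_commute)

text \<open>The conditional probability of \<open>e\<close> given that the uniform spanning tree
  contains \<open>A\<close> and avoids \<open>B\<close>. It is 0 if there is no such tree. For empty
  \<open>A\<close> and \<open>B\<close> it is the effective resistance between the ends of an
  edge.\<close>

definition prob_edge :: "'a set set \<Rightarrow> 'a set set \<Rightarrow> 'a set \<Rightarrow> real" where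
  "prob_edge A B e = card (trees_with (insert e A) B) / card (trees_with A B)"

text \<open>The potential \<open>v z\<close> is the fraction of trees that contain \<open>xy\<close> and connect \<open>z\<close> to \<open>x\<close> without
  it. Replacing \<open>xy\<close> by an edge \<open>zw\<close> from the side of \<open>x\<close> to the side of \<open>y\<close> gives the trees whose
  path from \<open>x\<close> to \<open>y\<close> traverses \<open>zw\<close>, so \<open>v z - v w\<close> is the mean net flow of that path along \<open>zw\<close>.\<close>

theorem kirchhoff:
  assumes e: "{x, y} \<in> E" "{x, y} \<notin> A" "{x, y} \<notin> B" and ne: "trees_with A B \<noteq> {}"
  obtains v where "v x - v y = prob_edge A B {x, y}"
    "\<And>z w. {z, w} \<in> A \<Longrightarrow> v z = v w"
    "\<And>f. (\<And>z w. {z, w} \<in> A \<Longrightarrow> f z = f w) \<Longrightarrow> en (E - A - B) v f = f x - f y"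
proof -
  let ?e = "{x, y}"
  define TR where "TR = trees_with (insert ?e A) B"
  define N where "N = real (card (trees_with A B))"
  have N: "N > 0" using ne finite_trees_with by (simp add: N_def card_gt_0_iff)
  define v where "v z = real (card {T\<in>TR. (x, z) \<in> conn (T - {?e})}) / N" for z
  have TR: "T \<in> trees" "?e \<in> T" "A \<subseteq> T" "T \<inter> B = {}" if "T \<in> TR" for T
    using that by (auto simp: TR_def trees_with_def)
  have fTR: "finite TR" by (simp add: TR_def finite_trees_with)
  have xy: "x \<in> V" "y \<in> V" using edge_in_V[OF e(1)] by auto
  have "{T\<in>TR. (x, x) \<in> conn (T - {?e})} = TR" by simp
  moreover have "{T\<in>TR. (x, y) \<in> conn (T - {?e})} = {}"
    using bridgesD[OF treesD(2)[OF TR(1)] TR(2)] by blast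
  ultimately have 1: "v x - v y = prob_edge A B ?e"
    unfolding v_def by (simp add: prob_edge_def TR_def N_def del: Collect_empty_eq)
  have 2: "v z = v w" if zw: "{z, w} \<in> A" for z w
  proof -
    have "(x, z) \<in> conn (T - {?e}) \<longleftrightarrow> (x, w) \<in> conn (T - {?e})" if T: "T \<in> TR" for T
    proof -
      have "{z, w} \<in> T - {?e}" using TR(3)[OF T] zw e by auto
      then have "(z, w) \<in> conn (T - {?e})" by (rule conn_edge)
      then show ?thesis by (meson conn_sym conn_trans)
    qed
    then show ?thesis by (simp add: v_def cong: conj_cong)
  qed
  have 3: "en (E - A - B) v f = f x - f y" if f: "\<And>z w. {z, w} \<in> A \<Longrightarrow> f z = f w" for f
  proof -
    let ?X = "E - A - B"
    \<comment> \<open>In \<open>c z w\<close> the edge \<open>xy\<close> separates \<open>x\<close>,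
      \<open>z\<close> from \<open>w\<close>, \<open>y\<close>. The set \<open>S T\<close> is the
      path of \<open>T\<close> from \<open>x\<close> to \<open>y\<close>, to which
      \<open>bridges_path\<close> applies.\<close>
    define c where "c z w = real (card {T\<in>TR. (x, z) \<in> conn (T - {?e}) \<and> (w, y) \<in> conn (T - {?e})})" for z w
    define S where "S T = {(z, w). {z, w} \<in> T \<and> (x, z) \<in> conn (T - {{z, w}}) \<and> (w, y) \<in> conn (T - {{z, w}})}" for T
    have fX: "finite (arcs ?X)" by (intro finite_arcs) auto
    have dv: "N * (v z - v w) = c z w - c w z" if zw: "(z, w) \<in> arcs ?X" for z w
    proof -
      have zwV: "z \<in> V" "w \<in> V" using zw edge_in_V by (auto simp: arcs_def)
      have card_sum: "real (card {T\<in>TR. P T}) = (\<Sum>T\<in>TR. of_bool (P T))" for P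
        using fTR by (simp add: sum_of_bool_eq Int_def)
      \<comment> \<open>Trees with \<open>z\<close> and \<open>w\<close> on the same side of
        \<open>xy\<close> cancel.\<close>
      have "of_bool ((x, z) \<in> conn (T - {?e})) - of_bool ((x, w) \<in> conn (T - {?e})) =
          of_bool ((x, z) \<in> conn (T - {?e}) \<and> (w, y) \<in> conn (T - {?e})) -
          (of_bool ((x, w) \<in> conn (T - {?e}) \<and> (z, y) \<in> conn (T - {?e})) :: real)" if T: "T \<in> TR" for T
        using tree_sides[OF TR(1,2)[OF T] zwV(1)] tree_sides[OF TR(1,2)[OF T] zwV(2)]
        unfolding conn_commute[of _ y] by simp
      then have "(\<Sum>T\<in>TR. of_bool ((x, z) \<in> conn (T - {?e}))) - (\<Sum>T\<in>TR. of_bool ((x, w) \<in> conn (T - {?e}))) = c z w - c w z"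
        unfolding c_def card_sum sum_subtractf[symmetric] by (rule sum.cong[OF refl])
      then show ?thesis unfolding v_def card_sum using N by (simp add: right_diff_distrib)
    qed
    have cS: "c z w = (\<Sum>T\<in>trees_with A B. of_bool ((z, w) \<in> S T))" if zw: "(z, w) \<in> arcs ?X" for z w
    proof -
      have "c z w = real (card {T \<in> trees_with A B. {z, w} \<in> T \<and>
            (x, z) \<in> conn (T - {{z, w}}) \<and> (w, y) \<in> conn (T - {{z, w}})})"
        unfolding c_def TR_def using card_exchange[OF e, of z w] zw by (simp add: arcs_def)
      then show ?thesis using finite_trees_with by (simp add: S_def sum_of_bool_eq Int_def)
    qed
    have tree_sum: "(\<Sum>(z, w)\<in>arcs ?X. of_bool ((z, w) \<in> S T) * (f z - f w)) = f x - f y"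
      if T: "T \<in> trees_with A B" for T
    proof -
      have T': "T \<in> trees" "A \<subseteq> T" "T \<inter> B = {}" using T by (auto simp: trees_with_def)
      have ST: "S T \<subseteq> arcs T" by (auto simp: S_def arcs_def)
      have fT: "finite (arcs T)" using treesD(1)[OF T'(1)] by (rule finite_arcs)
      have "(\<Sum>(z, w)\<in>arcs ?X. of_bool ((z, w) \<in> S T) * (f z - f w)) =
        (\<Sum>p\<in>arcs ?X \<inter> S T. f (fst p) - f (snd p))"
        using fX by (subst sum.inter_restrict) (auto intro!: sum.cong)
      also have "\<dots> = (\<Sum>p\<in>S T. f (fst p) - f (snd p))"
      proof (rule sum.mono_neutral_left)
        show "finite (S T)" using fT ST by (rule rev_finite_subset)
        show "\<forall>p\<in>S T - arcs ?X \<inter> S T. f (fst p) - f (snd p) = 0"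
        proof
          fix p assume p: "p \<in> S T - arcs ?X \<inter> S T"
          obtain z w where zw: "p = (z, w)" by force
          have "{z, w} \<in> T" using p ST zw by (auto simp: arcs_def)
          \<comment> \<open>A path edge outside \<open>?X\<close> lies in \<open>A\<close>, because
            \<open>T\<close> avoids \<open>B\<close>; along it \<open>f\<close> has no drop.\<close>
          then have "{z, w} \<in> A" using p zw T' treesD(1)[OF T'(1)] by (auto simp: arcs_def)
          then show "f (fst p) - f (snd p) = 0" using f zw by simp
        qed
      qed simp
      also have "\<dots> = f x - f y"
        using bridges_path[OF treesD(2)[OF T'(1)] finite_V treesD(3)[OF T'(1) xy], of f] edgeD treesD(1)[OF T'(1)]
        by (auto simp: S_def case_prod_unfold)
      finally show ?thesis .
    qed
    have "2 * N * en ?X v f = (\<Sum>(z, w)\<in>arcs ?X. N * (v z - v w) * (f z - f w))"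
      by (simp add: en_def case_prod_unfold mult.assoc flip: sum_distrib_left)
    also have "\<dots> = (\<Sum>(z, w)\<in>arcs ?X. c z w * (f z - f w) + c w z * (f w - f z))"
    proof (rule sum.cong[OF refl], clarify)
      fix z w assume "(z, w) \<in> arcs ?X"
      then have "N * (v z - v w) * (f z - f w) = (c z w - c w z) * (f z - f w)" by (simp only: dv)
      then show "N * (v z - v w) * (f z - f w) = c z w * (f z - f w) + c w z * (f w - f z)"
        by (simp add: algebra_simps)
    qed
    also have "\<dots> = (\<Sum>(z, w)\<in>arcs ?X. c z w * (f z - f w)) + (\<Sum>(z, w)\<in>arcs ?X. c w z * (f w - f z))"
      by (simp add: sum.distrib case_prod_unfold)
    also have "\<dots> = 2 * (\<Sum>(z, w)\<in>arcs ?X. c z w * (f z - f w))"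
      by (subst sum_arcs_swap[of "\<lambda>z w. c z w * (f z - f w)"]) simp
    also have "(\<Sum>(z, w)\<in>arcs ?X. c z w * (f z - f w)) =
       (\<Sum>p\<in>arcs ?X. \<Sum>T\<in>trees_with A B. of_bool (p \<in> S T) * (f (fst p) - f (snd p)))"
      by (rule sum.cong[OF refl]) (use cS in \<open>auto simp: sum_distrib_right\<close>)
    also have "\<dots> = (\<Sum>T\<in>trees_with A B. \<Sum>p\<in>arcs ?X. of_bool (p \<in> S T) * (f (fst p) - f (snd p)))"
      by (rule sum.swap)
    also have "\<dots> = (\<Sum>T\<in>trees_with A B. f x - f y)"
      by (rule sum.cong[OF refl]) (use tree_sum in \<open>simp add: case_prod_unfold\<close>)
    also have "\<dots> = N * (f x - f y)" by (simp add: N_def)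
    finally show ?thesis using N by simp
  qed
  show ?thesis by (rule that[OF 1 2 3])
qed

end

section \<open>Energy estimates\<close>

context finite_conn_graph
begin

lemma en_commute: "en X f g = en X g f"
  by (simp add: en_def mult.commute)

lemma en_nonneg: "0 \<le> en X f f"
  unfolding en_def by (auto intro!: sum_nonneg)

lemma en_add: "en X (\<lambda>z. f z + g z) h = en X f h + en X g h"
  by (simp add: en_def case_prod_unfold algebra_simps sum.distrib sum_subtractf add_divide_distrib diff_divide_distrib)

lemma en_scale: "en X (\<lambda>z. c * f z) h = c * en X f h"
  by (simp add: en_def case_prod_unfold sum_distrib_left algebra_simps)

lemma en_sum: "finite S \<Longrightarrow> en X (\<lambda>z. \<Sum>s\<in>S. F s z) h = (\<Sum>s\<in>S. en X (F s) h)"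
proof (induction S rule: finite_induct)
  case empty
  then show ?case by (simp add: en_def)
next
  case (insert s S)
  then show ?case using en_add[of X "F s" "\<lambda>z. \<Sum>s\<in>S. F s z" h] by simp
qed

lemma en_diff: "en X (\<lambda>z. f z - g z) h = en X f h - en X g h"
  using en_add[of X f "\<lambda>z. - 1 * g z" h] unfolding en_scale by simp

lemma en_mono: "X \<subseteq> Y \<Longrightarrow> Y \<subseteq> E \<Longrightarrow> en X f f \<le> en Y f f"
  unfolding en_def by (intro divide_right_mono sum_mono2 finite_arcs) (auto simp: arcs_def)

lemma en_Cauchy_Schwarz: "(en X f g)\<^sup>2 \<le> en X f f * en X g g"
proof -
  have "(\<Sum>p\<in>arcs X. (f (fst p) - f (snd p)) * (g (fst p) - g (snd p)))\<^sup>2 \<le>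
      (\<Sum>p\<in>arcs X. (f (fst p) - f (snd p))\<^sup>2) * (\<Sum>p\<in>arcs X. (g (fst p) - g (snd p))\<^sup>2)"
    by (rule Cauchy_Schwarz_ineq_sum)
  then show ?thesis
    by (simp add: en_def case_prod_unfold power2_eq_square field_simps)
qed

definition enorm :: "('a \<Rightarrow> real) \<Rightarrow> real" where
  "enorm f = sqrt (en E f f)"

lemma enorm_L2_set: "enorm f = L2_set (\<lambda>p. f (fst p) - f (snd p)) (arcs E) / sqrt 2"
  by (simp add: enorm_def en_def L2_set_def real_sqrt_divide case_prod_unfold power2_eq_square)

lemma enorm_nonneg [simp]: "0 \<le> enorm f"
  using en_nonneg by (simp add: enorm_def)

lemma enorm_triangle: "enorm (\<lambda>z. f z + g z) \<le> enorm f + enorm g"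
proof -
  have "L2_set (\<lambda>p. f (fst p) - f (snd p) + (g (fst p) - g (snd p))) (arcs E) \<le>
      L2_set (\<lambda>p. f (fst p) - f (snd p)) (arcs E) + L2_set (\<lambda>p. g (fst p) - g (snd p)) (arcs E)"
    by (rule L2_set_triangle_ineq)
  then show ?thesis unfolding enorm_L2_set add_divide_distrib[symmetric]
    by (intro divide_right_mono) (simp_all add: algebra_simps)
qed

lemma enorm_scale: "enorm (\<lambda>z. c * f z) = \<bar>c\<bar> * enorm f"
proof -
  have "en E (\<lambda>z. c * f z) (\<lambda>z. c * f z) = c\<^sup>2 * en E f f"
    using en_scale[of E c f "\<lambda>z. c * f z"] en_commute[of E f "\<lambda>z. c * f z"] en_scale[of E c f f]
    by (simp add: power2_eq_square)
  then show ?thesis by (simp add: enorm_def real_sqrt_mult)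
qed

lemma enorm_sum_le: "finite S \<Longrightarrow> enorm (\<lambda>z. \<Sum>s\<in>S. F s z) \<le> (\<Sum>s\<in>S. enorm (F s))"
proof (induction S rule: finite_induct)
  case empty
  then show ?case by (simp add: enorm_def en_def)
next
  case (insert s S)
  have "enorm (\<lambda>z. F s z + (\<Sum>s\<in>S. F s z)) \<le> enorm (F s) + enorm (\<lambda>z. \<Sum>s\<in>S. F s z)"
    by (rule enorm_triangle)
  then show ?case using insert by simp
qed

section \<open>Variational bounds for edge probabilities and Foster's theorem\<close>

lemma prob_edge_nonneg: "0 \<le> prob_edge A B e"
  by (simp add: prob_edge_def)

lemma card_trees_insert:
  "real (card (trees_with (insert e A) B)) = prob_edge A B e * card (trees_with A B)"
proof (cases "trees_with A B = {}")
  case True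
  then have "trees_with (insert e A) B = {}" by (auto simp: trees_with_def)
  then show ?thesis using True by simp
next
  case False
  then show ?thesis using finite_trees_with by (simp add: prob_edge_def)
qed

lemma card_trees_delete:
  "real (card (trees_with A (insert e B))) = (1 - prob_edge A B e) * card (trees_with A B)"
proof -
  have "trees_with A B = trees_with (insert e A) B \<union> trees_with A (insert e B)"
    "trees_with (insert e A) B \<inter> trees_with A (insert e B) = {}"
    by (auto simp: trees_with_def)
  then have "card (trees_with A B) = card (trees_with (insert e A) B) + card (trees_with A (insert e B))"
    using finite_trees_with by (metis card_Un_disjoint)
  then show ?thesis using card_trees_insert[of e A B] by (simp add: algebra_simps)
qed

text \<open>Dirichlet's principle by Cauchy-Schwarz. The potential \<open>v\<close> of
  \<open>kirchhoff\<close> pairs with \<open>f\<close> to \<open>f x - f y\<close>, and its own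
  energy equals its drop, the edge probability. The functions constant on \<open>A\<close> are the
  functions on the contracted graph.\<close>

lemma dirichlet:
  assumes e: "{x, y} \<in> E" "{x, y} \<notin> A" "{x, y} \<notin> B" and ne: "trees_with A B \<noteq> {}"
    and f: "\<And>z w. {z, w} \<in> A \<Longrightarrow> f z = f w"
  shows "(f x - f y)\<^sup>2 \<le> prob_edge A B {x, y} * en (E - A - B) f f"
proof -
  obtain v where v: "v x - v y = prob_edge A B {x, y}"
    "\<And>z w. {z, w} \<in> A \<Longrightarrow> v z = v w"
    "\<And>f. (\<And>z w. {z, w} \<in> A \<Longrightarrow> f z = f w) \<Longrightarrow> en (E - A - B) v f = f x - f y"
    using kirchhoff[OF e ne] by blast
  show ?thesis
    using en_Cauchy_Schwarz[of "E - A - B" v f] v(3)[OF f] v(3)[OF v(2)] v(1) by simp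
qed

lemma const_on_conn:
  assumes "\<And>z w. {z, w} \<in> A \<Longrightarrow> f z = f w" "(u, v) \<in> conn A"
  shows "f u = f v"
  using assms(2) unfolding conn_def by (induction rule: rtrancl_induct) (use assms(1) in auto)

text \<open>Thomson's principle for the contraction of \<open>S\<close>, the test flow being the gradient of a
  function \<open>g\<close> on the uncontracted graph.\<close>

lemma prob_edge_le_energy:
  assumes e: "{x, y} \<in> E" "{x, y} \<notin> A" and ne: "trees_with A {} \<noteq> {}"
    and S: "finite S" "S \<noteq> {}" "\<And>s. s \<in> S \<Longrightarrow> (x, s) \<in> conn A"
    and g: "\<And>f. en E g f = f y - (\<Sum>s\<in>S. f s) / card S"
  shows "prob_edge A {} {x, y} \<le> en E g g"
proof -
  let ?p = "prob_edge A {} {x, y}"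
  obtain v where v: "v x - v y = ?p"
    "\<And>z w. {z, w} \<in> A \<Longrightarrow> v z = v w"
    "\<And>f. (\<And>z w. {z, w} \<in> A \<Longrightarrow> f z = f w) \<Longrightarrow> en (E - A - {}) v f = f x - f y"
    using kirchhoff[OF e(1,2) _ ne] by blast
  \<comment> \<open>The set \<open>S\<close> is contracted with \<open>x\<close>, so the average of
    \<open>v\<close> over \<open>S\<close> is its value at \<open>x\<close>.\<close>
  have "v s = v x" if "s \<in> S" for s using const_on_conn[of A v, OF v(2) S(3)[OF that]] by simp
  then have "(\<Sum>s\<in>S. v s) / card S = v x" using S(1,2) by simp
  then have "en E g v = - ?p" using g[of v] v(1) by simp
  \<comment> \<open>The edges of \<open>A\<close> carry no drop of \<open>v\<close>, hence
    contribute nothing to the pairing, although \<open>g\<close> may vary along them.\<close>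
  moreover have "en E g v = en (E - A) g v" unfolding en_def
    by (intro arg_cong[where f = "\<lambda>t. t / 2"] sum.mono_neutral_right finite_arcs)
      (auto simp: arcs_def dest: v(2))
  ultimately have "?p\<^sup>2 = (en (E - A) g v)\<^sup>2" by simp
  also have "\<dots> \<le> en (E - A) g g * en (E - A) v v" by (rule en_Cauchy_Schwarz)
  also have "en (E - A) v v = ?p" using v(3)[OF v(2)] v(1) by simp
  also have "en (E - A) g g * ?p \<le> en E g g * ?p"
    by (intro mult_right_mono en_mono prob_edge_nonneg) auto
  finally have "?p * ?p \<le> en E g g * ?p" by (simp add: power2_eq_square)
  then show ?thesis using prob_edge_nonneg[of A "{}" "{x, y}"] en_nonneg[of E g]
    by (cases "?p = 0") auto
qed

lemma card_arcs: "X \<subseteq> E \<Longrightarrow> card (arcs X) = 2 * card X"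
proof -
  assume X: "X \<subseteq> E"
  then have "finite X" using finite_E finite_subset by blast
  then show ?thesis using X
  proof (induction X rule: finite_induct)
    case empty
    then show ?case by (simp add: arcs_def)
  next
    case (insert e X)
    obtain a b where e: "e = {a, b}" "a \<noteq> b" using edgeD[of e] insert.prems by (auto simp: card_2_iff)
    have "arcs (insert e X) = insert (a, b) (insert (b, a) (arcs X))"
      unfolding arcs_def e(1) by (auto simp: doubleton_eq_iff)
    moreover have "(a, b) \<notin> insert (b, a) (arcs X)" "(b, a) \<notin> arcs X"
      using insert.hyps e by (auto simp: arcs_def insert_commute)
    moreover have "finite (arcs X)" using insert.prems by (intro finite_arcs) auto
    ultimately show ?case using insert by simp
  qed
qed

text \<open>Double counting: the edge probabilities add up to the mean number of edges of a spanning
  tree, and this number is constant. The factor 2 counts both orientations.\<close>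

lemma foster: "(\<Sum>(z, w)\<in>arcs E. prob_edge {} {} {z, w}) = 2 * (real (card V) - 1)"
proof -
  have t: "trees_with {} {} = trees" by (simp add: trees_with_def)
  have c: "0 < card trees" using finite_trees trees_nonempty by (simp add: card_gt_0_iff)
  have "(\<Sum>(z, w)\<in>arcs E. prob_edge {} {} {z, w}) * card trees =
      (\<Sum>p\<in>arcs E. real (card {T\<in>trees. p \<in> arcs T}))"
    using c by (simp add: prob_edge_def t case_prod_unfold sum_distrib_right arcs_def trees_with_def)
  also have "\<dots> = (\<Sum>p\<in>arcs E. \<Sum>T\<in>trees. of_bool (p \<in> arcs T))"
    using finite_trees by (simp add: sum_of_bool_eq Int_def)
  also have "\<dots> = (\<Sum>T\<in>trees. \<Sum>p\<in>arcs E. of_bool (p \<in> arcs T))" by (rule sum.swap)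
  also have "\<dots> = (\<Sum>T\<in>trees. 2 * (real (card V) - 1))"
  proof (rule sum.cong[OF refl])
    fix T assume T: "T \<in> trees"
    have "arcs E \<inter> arcs T = arcs T" using treesD(1)[OF T] by (auto simp: arcs_def)
    then have "(\<Sum>p\<in>arcs E. of_bool (p \<in> arcs T)) = real (card (arcs T))"
      using finite_arcs[of E] by (simp add: sum_of_bool_eq Int_def)
    also have "\<dots> = 2 * (real (card V) - 1)"
      using card_arcs[OF treesD(1)[OF T]] card_tree[OF T] by simp
    finally show "(\<Sum>p\<in>arcs E. of_bool (p \<in> arcs T)) = 2 * (real (card V) - 1)" .
  qed
  also have "\<dots> = 2 * (real (card V) - 1) * card trees" by simp
  finally show ?thesis using c by simp
qed

end

section \<open>Regular graphs: currents compared with dipoles\<close>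

locale regular_graph = finite_conn_graph +
  fixes d :: nat
  assumes d_pos: "0 < d"
    and card_nbrs: "v \<in> V \<Longrightarrow> card {u. {v, u} \<in> E} = d"
begin

abbreviation nb :: "'a \<Rightarrow> 'a set" where
  "nb v \<equiv> {u. {v, u} \<in> E}"

lemma finite_nb: "finite (nb v)"
  by (rule finite_subset[OF _ finite_V]) (use edge_in_V in auto)

lemma arcs_Sigma: "arcs E = Sigma V nb"
  using edge_in_V by (auto simp: arcs_def)

lemma card_arcs_E: "card (arcs E) = card V * d"
  unfolding arcs_Sigma by (subst card_SigmaI) (use finite_V finite_nb card_nbrs in auto)

text \<open>Summation by parts; regularity makes the diagonal coefficient the constant
  \<open>d\<close>.\<close>

lemma en_laplace:
  fixes f g :: "'a \<Rightarrow> real"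
  shows "en E f g = (\<Sum>z\<in>V. f z * (real d * g z - (\<Sum>w\<in>nb z. g w)))"
proof -
  have "2 * en E f g = (\<Sum>(z, w)\<in>arcs E. f z * (g z - g w) + f w * (g w - g z))"
    unfolding en_def by (simp add: case_prod_unfold algebra_simps)
  also have "\<dots> = (\<Sum>(z, w)\<in>arcs E. f z * (g z - g w)) + (\<Sum>(z, w)\<in>arcs E. f w * (g w - g z))"
    by (simp add: sum.distrib case_prod_unfold)
  also have "\<dots> = 2 * (\<Sum>(z, w)\<in>arcs E. f z * (g z - g w))"
    by (subst sum_arcs_swap[of "\<lambda>z w. f z * (g z - g w)"]) simp
  also have "(\<Sum>(z, w)\<in>arcs E. f z * (g z - g w)) = (\<Sum>z\<in>V. \<Sum>w\<in>nb z. f z * (g z - g w))"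
    unfolding arcs_Sigma by (rule sum.Sigma[symmetric]) (use finite_V finite_nb in auto)
  also have "\<dots> = (\<Sum>z\<in>V. f z * (d * g z - (\<Sum>w\<in>nb z. g w)))"
    by (rule sum.cong[OF refl]) (simp add: sum_distrib_left[symmetric] sum_subtractf card_nbrs)
  finally show ?thesis by simp
qed

text \<open>The second term treats all pairs in \<open>S\<close> as if they were adjacent. For
  values of order \<open>1/d\<close> on boundedly many vertices it is of order \<open>1/d^2\<close>,
  one order below the first term.\<close>

lemma en_support_le:
  fixes f :: "'a \<Rightarrow> real"
  assumes "S \<subseteq> V" "\<And>z. z \<notin> S \<Longrightarrow> f z = 0"
  shows "en E f f \<le> d * (\<Sum>z\<in>S. (f z)\<^sup>2) + (\<Sum>z\<in>S. \<bar>f z\<bar>)\<^sup>2"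
proof -
  have fS: "finite S" using assms(1) finite_V finite_subset by blast
  have nbS: "(\<Sum>w\<in>nb z. \<bar>f w\<bar>) \<le> (\<Sum>w\<in>S. \<bar>f w\<bar>)" for z
  proof -
    have "(\<Sum>w\<in>nb z. \<bar>f w\<bar>) = (\<Sum>w\<in>nb z \<inter> S. \<bar>f w\<bar>)"
      by (rule sum.mono_neutral_right) (use finite_nb assms(2) in auto)
    also have "\<dots> \<le> (\<Sum>w\<in>S. \<bar>f w\<bar>)" by (rule sum_mono2) (use fS in auto)
    finally show ?thesis .
  qed
  have "en E f f = (\<Sum>z\<in>S. f z * (d * f z - (\<Sum>w\<in>nb z. f w)))"
    unfolding en_laplace by (rule sum.mono_neutral_right) (use assms finite_V in auto)
  also have "\<dots> \<le> (\<Sum>z\<in>S. d * (f z)\<^sup>2 + \<bar>f z\<bar> * (\<Sum>w\<in>S. \<bar>f w\<bar>))"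
  proof (rule sum_mono)
    fix z
    have "- (f z * (\<Sum>w\<in>nb z. f w)) \<le> \<bar>f z * (\<Sum>w\<in>nb z. f w)\<bar>" by linarith
    also have "\<dots> \<le> \<bar>f z\<bar> * (\<Sum>w\<in>S. \<bar>f w\<bar>)" unfolding abs_mult
      by (intro mult_left_mono order_trans[OF sum_abs nbS]) simp
    finally show "f z * (d * f z - (\<Sum>w\<in>nb z. f w)) \<le> d * (f z)\<^sup>2 + \<bar>f z\<bar> * (\<Sum>w\<in>S. \<bar>f w\<bar>)"
      by (simp add: algebra_simps power2_eq_square)
  qed
  also have "\<dots> = d * (\<Sum>z\<in>S. (f z)\<^sup>2) + (\<Sum>z\<in>S. \<bar>f z\<bar>)\<^sup>2"
    unfolding sum.distrib sum_distrib_left[symmetric] sum_distrib_right[symmetric]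
    by (simp add: power2_eq_square)
  finally show ?thesis .
qed

definition dipole :: "'a \<Rightarrow> 'a \<Rightarrow> 'a \<Rightarrow> real" where
  "dipole x y z = (of_bool (z = x) - of_bool (z = y)) / d"

definition excess :: "'a set \<Rightarrow> real" where
  "excess e = prob_edge {} {} e - 2 / d + 2 / d\<^sup>2"

text \<open>The witness \<open>v\<close> is the potential of the unit current flow from \<open>x\<close> to \<open>y\<close>, determined up to
  an additive constant.\<close>

definition close_pair :: "real \<Rightarrow> 'a \<Rightarrow> 'a \<Rightarrow> bool" where
  "close_pair K x y \<longleftrightarrow>
     (\<exists>v. (\<forall>f. en E v f = f x - f y) \<and> enorm (\<lambda>z. v z - dipole x y z) \<le> K)"

text \<open>The edge \<open>xy\<close> itself contributes \<open>4/d^2\<close>, each of the other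
  \<open>2 * (d - 1)\<close> edges at \<open>x\<close> or \<open>y\<close> contributes
  \<open>1/d^2\<close>.\<close>

lemma en_dipole:
  assumes "{x, y} \<in> E"
  shows "en E (dipole x y) (dipole x y) = 2 / d + 2 / d\<^sup>2"
proof -
  have xy: "x \<in> V" "y \<in> V" "x \<noteq> y" using edge_in_V[OF assms] by auto
  have nxx: "{z} \<notin> E" for z using edgeD[of "{z}"] by auto
  have s: "(\<Sum>w\<in>nb z. dipole x y w) = (of_bool (x \<in> nb z) - of_bool (y \<in> nb z)) / d" for z
  proof -
    have "(\<Sum>w\<in>nb z. dipole x y w) = ((\<Sum>w\<in>nb z. of_bool (w = x)) - (\<Sum>w\<in>nb z. of_bool (w = y))) / d"
      by (simp add: dipole_def sum_divide_distrib[symmetric] sum_subtractf)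
    also have "\<dots> = (of_bool (x \<in> nb z) - of_bool (y \<in> nb z)) / d"
      using finite_nb[of z] by (simp add: of_bool_def)
    finally show ?thesis .
  qed
  have "en E (dipole x y) (dipole x y) =
      (\<Sum>z\<in>{x, y}. dipole x y z * (d * dipole x y z - (\<Sum>w\<in>nb z. dipole x y w)))"
    unfolding en_laplace by (rule sum.mono_neutral_right) (use xy finite_V in \<open>auto simp: dipole_def\<close>)
  also have "\<dots> = 2 / d + 2 / d\<^sup>2"
    using xy assms nxx d_pos unfolding s
    by (simp add: dipole_def insert_commute power2_eq_square field_simps)
  finally show ?thesis .
qed

text \<open>Expand the energy of \<open>v - dipole x y\<close>. The energy of \<open>v\<close> is
  the edge probability, the mixed term is \<open>2/d\<close> because \<open>v\<close> pairs with any
  function to its drop, and \<open>en_dipole\<close> gives the last term. Hence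
  \<open>excess\<close> is itself an energy, which explains its sign and the square root.\<close>

lemma close_pair_edge:
  assumes "{x, y} \<in> E"
  shows "0 \<le> excess {x, y}" "close_pair (sqrt (excess {x, y})) x y"
proof -
  have "trees_with {} {} \<noteq> {}" using trees_nonempty by (simp add: trees_with_def)
  then obtain v where v: "v x - v y = prob_edge {} {} {x, y}"
    "\<And>f. en (E - {} - {}) v f = f x - f y"
    using kirchhoff[OF assms, of "{}" "{}"] by auto
  let ?h = "dipole x y"
  have xy: "x \<noteq> y" using edge_in_V[OF assms] by simp
  have vh: "en E v ?h = 2 / d" using v(2)[of ?h] xy by (simp add: dipole_def)
  have "en E (\<lambda>z. v z - ?h z) (\<lambda>z. v z - ?h z) = en E v v - 2 * en E v ?h + en E ?h ?h"
    unfolding en_diff en_commute[of E _ "\<lambda>z. v z - ?h z"] using en_commute[of E ?h v] by simp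
  also have "\<dots> = excess {x, y}" using v(1) v(2)[of v] vh en_dipole[OF assms] by (simp add: excess_def)
  finally have *: "en E (\<lambda>z. v z - ?h z) (\<lambda>z. v z - ?h z) = excess {x, y}" .
  show "0 \<le> excess {x, y}" using en_nonneg[of E "\<lambda>z. v z - ?h z"] * by simp
  have "enorm (\<lambda>z. v z - ?h z) \<le> sqrt (excess {x, y})" using * by (simp add: enorm_def)
  then show "close_pair (sqrt (excess {x, y})) x y" unfolding close_pair_def
    using v(2) by (intro exI[of _ v]) auto
qed

lemma close_pair_refl: "close_pair 0 x x"
  unfolding close_pair_def by (intro exI[of _ "\<lambda>_. 0"]) (simp add: en_def enorm_def dipole_def)

lemma close_pair_sym:
  assumes "close_pair K x y" shows "close_pair K y x"
proof -
  obtain v where v: "\<And>f. en E v f = f x - f y" "enorm (\<lambda>z. v z - dipole x y z) \<le> K"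
    using assms by (auto simp: close_pair_def)
  have "(\<lambda>z. - 1 * v z - dipole y x z) = (\<lambda>z. - 1 * (v z - dipole x y z))"
    by (simp add: dipole_def fun_eq_iff diff_divide_distrib)
  then have "enorm (\<lambda>z. - 1 * v z - dipole y x z) \<le> K"
    using v(2) enorm_scale[of "- 1" "\<lambda>z. v z - dipole x y z"] by simp
  moreover have "en E (\<lambda>z. - 1 * v z) f = f y - f x" for f unfolding en_scale v(1) by simp
  ultimately show ?thesis unfolding close_pair_def by blast
qed

text \<open>Potentials and dipoles both add up along a path, so the deviation obeys the triangle
  inequality. This extends closeness from edges to all pairs of vertices of a small tree.\<close>

lemma close_pair_trans:
  assumes "close_pair K x y" "close_pair K' y w"
  shows "close_pair (K + K') x w"
proof -
  obtain v where v: "\<And>f. en E v f = f x - f y" "enorm (\<lambda>z. v z - dipole x y z) \<le> K"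
    using assms by (auto simp: close_pair_def)
  obtain v' where v': "\<And>f. en E v' f = f y - f w" "enorm (\<lambda>z. v' z - dipole y w z) \<le> K'"
    using assms by (auto simp: close_pair_def)
  have "(\<lambda>z. v z + v' z - dipole x w z) = (\<lambda>z. (v z - dipole x y z) + (v' z - dipole y w z))"
    by (simp add: dipole_def fun_eq_iff diff_divide_distrib)
  then have "enorm (\<lambda>z. v z + v' z - dipole x w z) \<le> K + K'"
    using v(2) v'(2) enorm_triangle[of "\<lambda>z. v z - dipole x y z" "\<lambda>z. v' z - dipole y w z"] by simp
  moreover have "en E (\<lambda>z. v z + v' z) f = f x - f w" for f unfolding en_add v(1) v'(1) by simp
  ultimately show ?thesis unfolding close_pair_def by (intro exI[of _ "\<lambda>z. v z + v' z"]) simp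
qed

lemma close_pair_mono: "close_pair K x y \<Longrightarrow> K \<le> K' \<Longrightarrow> close_pair K' x y"
  unfolding close_pair_def by (meson order_trans)

text \<open>The test flow is the average \<open>g\<close> of the unit current flows from
  \<open>y\<close> to the points of \<open>S\<close>. In energy norm it is within \<open>K\<close>
  of the average \<open>h\<close> of the dipoles, which is \<open>1/d\<close> at \<open>y\<close>
  and \<open>-1/(card S * d)\<close> on \<open>S\<close>; \<open>en_support_le\<close> then yields
  \<open>d * (1 + 1/card S) / d^2 + (2/d)^2\<close> for the energy of \<open>h\<close>.\<close>

lemma prob_edge_contract_le:
  assumes e: "{x, y} \<in> E" "{x, y} \<notin> A" and ne: "trees_with A {} \<noteq> {}"
    and S: "S \<subseteq> V" "x \<in> S" "y \<notin> S" "\<And>s. s \<in> S \<Longrightarrow> (x, s) \<in> conn A"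
    and K: "\<And>s. s \<in> S \<Longrightarrow> close_pair K y s"
  shows "prob_edge A {} {x, y} \<le> (sqrt ((1 + 1 / card S) / d + 4 / d\<^sup>2) + K)\<^sup>2"
proof -
  let ?k = "real (card S)"
  have fS: "finite S" using S(1) finite_V finite_subset by blast
  have k: "?k > 0" using S(2) fS by (auto simp: card_gt_0_iff)
  have yV: "y \<in> V" using edge_in_V[OF e(1)] by simp
  have "\<forall>s\<in>S. \<exists>v. (\<forall>f. en E v f = f y - f s) \<and> enorm (\<lambda>z. v z - dipole y s z) \<le> K"
    using K by (auto simp: close_pair_def)
  then obtain v where v: "\<And>s f. s \<in> S \<Longrightarrow> en E (v s) f = f y - f s"
    "\<And>s. s \<in> S \<Longrightarrow> enorm (\<lambda>z. v s z - dipole y s z) \<le> K" by metis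
  define g where "g = (\<lambda>z. 1 / ?k * (\<Sum>s\<in>S. v s z))"
  define h where "h = (\<lambda>z. 1 / ?k * (\<Sum>s\<in>S. dipole y s z))"
  have "en E g f = f y - (\<Sum>s\<in>S. f s) / ?k" for f
  proof -
    have "(\<Sum>s\<in>S. en E (v s) f) = (\<Sum>s\<in>S. f y - f s)" by (rule sum.cong[OF refl v(1)])
    then show ?thesis unfolding g_def en_scale en_sum[OF fS] using k by (simp add: sum_subtractf diff_divide_distrib)
  qed
  then have p: "prob_edge A {} {x, y} \<le> en E g g"
    using S by (intro prob_edge_le_energy[OF e ne fS]) auto
  have "(\<lambda>z. g z - h z) = (\<lambda>z. 1 / ?k * (\<Sum>s\<in>S. v s z - dipole y s z))"
    by (simp add: g_def h_def sum_subtractf diff_divide_distrib)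
  then have "enorm (\<lambda>z. g z - h z) = 1 / ?k * enorm (\<lambda>z. \<Sum>s\<in>S. v s z - dipole y s z)"
    using enorm_scale[of "1 / ?k"] k by simp
  also have "\<dots> \<le> 1 / ?k * (\<Sum>s\<in>S. enorm (\<lambda>z. v s z - dipole y s z))"
    using k by (intro mult_left_mono enorm_sum_le fS) simp
  also have "\<dots> \<le> 1 / ?k * (\<Sum>s\<in>S. K)" using k by (intro mult_left_mono sum_mono v(2)) auto
  also have "\<dots> = K" using k by simp
  finally have gh: "enorm (\<lambda>z. g z - h z) \<le> K" .
  have h_eq: "h z = (if z = y then 1 / d else if z \<in> S then - (1 / (?k * d)) else 0)" for z
  proof -
    have "(\<Sum>s\<in>S. dipole y s z) = (?k * of_bool (z = y) - (\<Sum>s\<in>S. of_bool (z = s))) / d"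
      by (simp add: dipole_def sum_divide_distrib[symmetric] sum_subtractf)
    also have "(\<Sum>s\<in>S. of_bool (z = s)) = (of_bool (z \<in> S) :: real)"
      using fS by (simp add: of_bool_def)
    finally show ?thesis using k S(3) unfolding h_def by (auto simp: of_bool_def)
  qed
  have "en E h h \<le> d * (\<Sum>z\<in>insert y S. (h z)\<^sup>2) + (\<Sum>z\<in>insert y S. \<bar>h z\<bar>)\<^sup>2"
    by (rule en_support_le) (use S(1) yV h_eq in auto)
  also have "(\<Sum>z\<in>insert y S. (h z)\<^sup>2) = (1 + 1 / ?k) / d\<^sup>2"
  proof -
    have "(\<Sum>z\<in>S. (h z)\<^sup>2) = (\<Sum>z\<in>S. (1 / (?k * d))\<^sup>2)"
      using S(3) by (intro sum.cong) (auto simp: h_eq)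
    also have "\<dots> = 1 / ?k / d\<^sup>2" using k by (simp add: power2_eq_square)
    finally show ?thesis using fS S(3) by (simp add: h_eq add_divide_distrib power_divide)
  qed
  also have "(\<Sum>z\<in>insert y S. \<bar>h z\<bar>) = 2 / d"
  proof -
    have "(\<Sum>z\<in>S. \<bar>h z\<bar>) = (\<Sum>z\<in>S. 1 / (?k * d))"
      using S(3) by (intro sum.cong) (auto simp: h_eq)
    also have "\<dots> = 1 / d" using k by simp
    finally show ?thesis using fS S(3) by (simp add: h_eq)
  qed
  finally have "en E h h \<le> (1 + 1 / ?k) / d + 4 / d\<^sup>2"
    using d_pos by (simp add: power2_eq_square field_simps)
  then have "enorm h \<le> sqrt ((1 + 1 / ?k) / d + 4 / d\<^sup>2)" by (simp add: enorm_def)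
  moreover have "enorm g \<le> enorm (\<lambda>z. g z - h z) + enorm h"
    using enorm_triangle[of "\<lambda>z. g z - h z" h] by simp
  ultimately have "enorm g \<le> sqrt ((1 + 1 / ?k) / d + 4 / d\<^sup>2) + K" using gh by linarith
  then have "(enorm g)\<^sup>2 \<le> (sqrt ((1 + 1 / ?k) / d + 4 / d\<^sup>2) + K)\<^sup>2" by (intro power_mono) auto
  moreover have "(enorm g)\<^sup>2 = en E g g" using en_nonneg by (simp add: enorm_def)
  ultimately show ?thesis using p by simp
qed

text \<open>Dirichlet's principle with \<open>1/d\<close> at \<open>y\<close>, \<open>-1/D\<close>
  on \<open>S\<close> and 0 elsewhere. About \<open>d\<close> edges leave \<open>y\<close> and at
  most \<open>D\<close> leave \<open>S\<close> outside \<open>B\<close>, and the values are the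
  reciprocals that minimise energy per squared drop. The function is constant along
  \<open>A\<close>, whose edges stay inside \<open>S\<close>. The last factor absorbs the edges
  between \<open>y\<close> and \<open>S\<close>.\<close>

lemma prob_edge_delete_ge:
  assumes e: "{x, y} \<in> E" "{x, y} \<notin> A" "{x, y} \<notin> B" and ne: "trees_with A B \<noteq> {}"
    and S: "finite S" "x \<in> S" "y \<notin> S" and A: "\<And>e. e \<in> A \<Longrightarrow> e \<subseteq> S"
    and D: "D > 0" "real (card {(s, w). {s, w} \<in> E - B \<and> s \<in> S \<and> w \<notin> S}) \<le> D"
  shows "(1 / d + 1 / D) * (1 - 2 * card S / d) \<le> prob_edge A B {x, y}"
proof -
  define a where "a = 1 / real d"
  define b where "b = 1 / D"
  have ab: "a > 0" "b > 0" using d_pos D by (auto simp: a_def b_def)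
  define f where "f z = (if z = y then a else if z \<in> S then - b else 0)" for z
  let ?X = "E - A - B"
  have fX: "finite (arcs ?X)" by (intro finite_arcs) auto
  have fA: "f z = f w" if "{z, w} \<in> A" for z w
    using A[OF that] S(3) by (auto simp: f_def)
  \<comment> \<open>The square is distributed over the two orientations: \<open>a^2\<close> goes to
    arcs that leave \<open>y\<close>, \<open>b^2\<close> to arcs that leave \<open>S\<close>, and
    the mixed term of an edge between \<open>y\<close> and \<open>S\<close> to the arc from
    \<open>y\<close>.\<close>
  define u where "u z w = a\<^sup>2 * of_bool (z = y) + b\<^sup>2 * of_bool (z \<in> S \<and> w \<notin> S) +
     2 * a * b * of_bool (z = y \<and> w \<in> S)" for z w
  have "(f z - f w)\<^sup>2 = u z w + u w z" if "(z, w) \<in> arcs ?X" for z w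
  proof -
    have "z \<noteq> w" using that edge_in_V by (auto simp: arcs_def)
    then show ?thesis using S(3) by (auto simp: f_def u_def power2_eq_square algebra_simps)
  qed
  then have "2 * en ?X f f = (\<Sum>(z, w)\<in>arcs ?X. u z w + u w z)"
    unfolding en_def by (auto simp: power2_eq_square intro!: sum.cong)
  also have "\<dots> = 2 * (\<Sum>(z, w)\<in>arcs ?X. u z w)"
    using sum_arcs_swap[of u ?X] by (simp add: sum.distrib case_prod_unfold)
  finally have "en ?X f f = (\<Sum>p\<in>arcs ?X. u (fst p) (snd p))" by (simp add: case_prod_unfold)
  also have "\<dots> = a\<^sup>2 * card {p\<in>arcs ?X. fst p = y} + b\<^sup>2 * card {p\<in>arcs ?X. fst p \<in> S \<and> snd p \<notin> S}
      + 2 * a * b * card {p\<in>arcs ?X. fst p = y \<and> snd p \<in> S}"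
    using fX by (simp add: u_def sum.distrib sum_distrib_left[symmetric] sum_of_bool_eq Int_def)
  also have "\<dots> \<le> a\<^sup>2 * d + b\<^sup>2 * D + 2 * a * b * card S"
  proof (intro add_mono mult_left_mono)
    have yV: "y \<in> V" using edge_in_V[OF e(1)] by simp
    have "card {p\<in>arcs ?X. fst p = y} \<le> card (Pair y ` nb y)"
      by (rule card_mono) (use finite_nb in \<open>auto simp: arcs_def\<close>)
    also have "\<dots> \<le> card (nb y)" by (rule card_image_le) (rule finite_nb)
    finally show "real (card {p\<in>arcs ?X. fst p = y}) \<le> d" using card_nbrs[OF yV] by simp
    have "card {p\<in>arcs ?X. fst p = y \<and> snd p \<in> S} \<le> card (Pair y ` S)"
      by (rule card_mono) (use S in auto)
    also have "\<dots> \<le> card S" by (rule card_image_le) (rule S(1))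
    finally show "real (card {p\<in>arcs ?X. fst p = y \<and> snd p \<in> S}) \<le> card S" by simp
    have "card {p\<in>arcs ?X. fst p \<in> S \<and> snd p \<notin> S} \<le> card {(s, w). {s, w} \<in> E - B \<and> s \<in> S \<and> w \<notin> S}"
    proof (rule card_mono)
      show "finite {(s, w). {s, w} \<in> E - B \<and> s \<in> S \<and> w \<notin> S}"
        by (rule finite_subset[OF _ finite_arcs[of E]]) (auto simp: arcs_def)
    qed (auto simp: arcs_def)
    then show "real (card {p\<in>arcs ?X. fst p \<in> S \<and> snd p \<notin> S}) \<le> D" using D(2) by linarith
  qed (use ab in auto)
  also have "\<dots> = (a + b) + 2 * a * b * card S"
    using d_pos D by (simp add: a_def b_def power2_eq_square)
  finally have en: "en ?X f f \<le> (a + b) + 2 * a * b * card S" .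
  have "(f x - f y)\<^sup>2 = (a + b)\<^sup>2"
    using S by (auto simp: f_def power2_eq_square algebra_simps)
  then have "(a + b)\<^sup>2 \<le> prob_edge A B {x, y} * en ?X f f"
    using dirichlet[of x y A B f, OF e ne fA] by simp
  also have "\<dots> \<le> prob_edge A B {x, y} * ((a + b) + 2 * a * b * card S)"
    by (intro mult_left_mono en prob_edge_nonneg)
  finally have 1: "(a + b)\<^sup>2 \<le> prob_edge A B {x, y} * ((a + b) + 2 * a * b * card S)" .
  \<comment> \<open>The factor is chosen such that its product with \<open>a + b\<close> contains
    \<open>- 2 * a * b * card S\<close>, which cancels the mixed term; what remains besides
    \<open>a + b\<close> is negative.\<close>
  have "(a + b) * (1 - 2 * card S * a) * ((a + b) + 2 * a * b * card S) \<le> (a + b)\<^sup>2"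
  proof -
    have "(1 - 2 * card S * a) * ((a + b) + 2 * a * b * card S) =
        (a + b) - 2 * card S * a\<^sup>2 - 4 * (card S)\<^sup>2 * a\<^sup>2 * b"
      by (simp add: algebra_simps power2_eq_square)
    also have "\<dots> \<le> a + b"
    proof -
      have "0 \<le> 2 * card S * a\<^sup>2" "0 \<le> 4 * (card S)\<^sup>2 * a\<^sup>2 * b" using ab by auto
      then show ?thesis by linarith
    qed
    finally have "(a + b) * ((1 - 2 * card S * a) * ((a + b) + 2 * a * b * card S)) \<le> (a + b) * (a + b)"
      using ab by (intro mult_left_mono) auto
    then show ?thesis by (simp add: power2_eq_square mult.assoc)
  qed
  then have "(a + b) * (1 - 2 * card S * a) * ((a + b) + 2 * a * b * card S) \<le>
      prob_edge A B {x, y} * ((a + b) + 2 * a * b * card S)" using 1 by linarith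
  moreover have "(a + b) + 2 * a * b * card S > 0" using ab by (simp add: add_pos_nonneg)
  ultimately have "(a + b) * (1 - 2 * card S * a) \<le> prob_edge A B {x, y}" by (rule mult_right_le_imp_le)
  then show ?thesis by (simp add: a_def b_def)
qed

text \<open>Delete the edges of \<open>B\<close> one at a time. After \<open>j\<close> deletions at
  most \<open>card S * d - j\<close> edges leave \<open>S\<close>, which is the \<open>D\<close> of
  \<open>prob_edge_delete_ge\<close>; the next edge is avoided with conditional probability at most
  \<open>1 - q \<le> exp (- q)\<close>. The bound on \<open>card B\<close> keeps all denominators
  positive.\<close>

lemma card_trees_avoid_le:
  assumes S: "finite S" "S \<subseteq> V" and A: "\<And>e. e \<in> A \<Longrightarrow> e \<subseteq> S" and d: "2 * card S \<le> d"
    and B: "finite B" "\<And>e. e \<in> B \<Longrightarrow> e \<in> E \<and> (\<exists>x y. e = {x, y} \<and> x \<in> S \<and> y \<notin> S)"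
    and card_B: "card B < card S * d"
  shows "real (card (trees_with A B)) \<le> card (trees_with A {}) *
    exp (- (\<Sum>j<card B. (1 / d + 1 / (real (card S * d) - j)) * (1 - 2 * card S / d)))"
  using B card_B
proof (induction B rule: finite_induct)
  case empty
  then show ?case by simp
next
  case (insert e B)
  let ?q = "\<lambda>j. (1 / d + 1 / (real (card S * d) - real j)) * (1 - 2 * card S / d)"
  obtain x y where xy: "e = {x, y}" "x \<in> S" "y \<notin> S" "{x, y} \<in> E"
    using insert.prems(1)[of e] by auto
  have IH: "real (card (trees_with A B)) \<le> card (trees_with A {}) * exp (- (\<Sum>j<card B. ?q j))"
    using insert by auto
  have eA: "{x, y} \<notin> A" using A xy(3) by blast
  have "real (card (trees_with A (insert e B))) \<le> exp (- ?q (card B)) * card (trees_with A B)"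
  proof (cases "trees_with A B = {}")
    case True
    then show ?thesis using card_trees_delete[of A e B] by simp
  next
    case False
    let ?out = "\<lambda>X. {(s, w). {s, w} \<in> X \<and> s \<in> S \<and> w \<notin> S}"
    have fin: "finite (?out E)"
      by (rule finite_subset[OF _ finite_arcs[of E]]) (auto simp: arcs_def)
    have split: "?out E = ?out (E - B) \<union> ?out B" "?out (E - B) \<inter> ?out B = {}"
      using insert.prems(1) by auto
    have fin': "finite (?out B)" "finite (?out (E - B))" using fin split(1) by simp_all
    have "card (?out E) = card (?out (E - B)) + card (?out B)"
      unfolding split(1) by (rule card_Un_disjoint[OF fin'(2,1) split(2)])
    moreover have "card (?out E) \<le> card S * d"
    proof -
      have "?out E \<subseteq> Sigma S nb" by auto
      then have "card (?out E) \<le> card (Sigma S nb)"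
        by (rule card_mono[rotated]) (use S finite_nb in auto)
      also have "\<dots> = card S * d"
      proof -
        have "(\<Sum>a\<in>S. card (nb a)) = (\<Sum>a\<in>S. d)"
          using S(2) card_nbrs by (intro sum.cong) auto
        then show ?thesis using S(1) finite_nb by (subst card_SigmaI) auto
      qed
      finally show ?thesis .
    qed
    \<comment> \<open>Each deleted edge has one end in \<open>S\<close> and one outside, so it
      accounts for an arc of the boundary.\<close>
    moreover have "card B \<le> card (?out B)"
    proof -
      have "B \<subseteq> (\<lambda>(s, w). {s, w}) ` ?out B" using insert.prems(1) by force
      then have "card B \<le> card ((\<lambda>(s, w). {s, w}) ` ?out B)"
        by (rule card_mono[rotated]) (rule finite_imageI[OF fin'(1)])
      also have "\<dots> \<le> card (?out B)" by (rule card_image_le[OF fin'(1)])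
      finally show ?thesis .
    qed
    ultimately have "real (card (?out (E - B))) \<le> real (card S * d) - card B" by linarith
    moreover have "real (card S * d) - card B > 0"
    proof -
      have "card B < card S * d" using insert.prems(2) insert.hyps by simp
      then have "real (card B) < real (card S * d)" by (rule of_nat_less_iff[THEN iffD2])
      then show ?thesis by linarith
    qed
    ultimately have "?q (card B) \<le> prob_edge A B {x, y}"
      using insert.hyps xy False S A eA by (intro prob_edge_delete_ge) auto
    then have "1 - prob_edge A B e \<le> 1 - ?q (card B)" using xy by simp
    also have "\<dots> \<le> exp (- ?q (card B))" using exp_ge_add_one_self[of "- ?q (card B)"] by simp
    finally show ?thesis unfolding card_trees_delete by (rule mult_right_mono) simp
  qed
  also have "\<dots> \<le> exp (- ?q (card B)) * (card (trees_with A {}) * exp (- (\<Sum>j<card B. ?q j)))"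
    by (intro mult_left_mono IH) simp
  also have "\<dots> = card (trees_with A {}) * exp (- (\<Sum>j<card (insert e B). ?q j))"
    using insert.hyps by (simp add: exp_diff exp_minus field_simps exp_add)
  finally show ?case .
qed

text \<open>A Markov inequality for the excess. By \<open>foster\<close> all excesses add up to only
  \<open>2 * card V / d - 2\<close> over the arcs. Where the excess is above \<open>t\<close>, the
  main part \<open>2/d\<close> of the probability is at most \<open>2 / (d * t)\<close> times the
  excess.\<close>

lemma sum_bad_prob_edge_le:
  fixes t :: real
  assumes "t > 0"
  shows "(\<Sum>(z, w)\<in>{(z, w)\<in>arcs E. excess {z, w} > t}. prob_edge {} {} {z, w})
    \<le> 2 * card V / d * (1 + 2 / (d * t))"
proof -
  let ?bad = "{(z, w)\<in>arcs E. excess {z, w} > t}"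
  have fin: "finite (arcs E)" by (rule finite_arcs) simp
  have ex: "0 \<le> excess {fst p, snd p}" if "p \<in> arcs E" for p
    using close_pair_edge(1)[of "fst p" "snd p"] that by (auto simp: arcs_def case_prod_unfold)
  have "(\<Sum>(z, w)\<in>?bad. prob_edge {} {} {z, w}) \<le> (\<Sum>(z, w)\<in>?bad. excess {z, w} * (1 + 2 / (d * t)))"
  proof (rule sum_mono, clarify)
    fix z w assume "excess {z, w} > t"
    then have "2 / d \<le> excess {z, w} * (2 / (d * t))" using assms d_pos by (simp add: field_simps)
    moreover have "prob_edge {} {} {z, w} \<le> excess {z, w} + 2 / d" by (simp add: excess_def)
    ultimately show "prob_edge {} {} {z, w} \<le> excess {z, w} * (1 + 2 / (d * t))"
      by (simp add: distrib_left)
  qed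
  also have "\<dots> = (\<Sum>(z, w)\<in>?bad. excess {z, w}) * (1 + 2 / (d * t))"
    by (simp add: sum_distrib_right case_prod_unfold)
  also have "(\<Sum>(z, w)\<in>?bad. excess {z, w}) \<le> (\<Sum>(z, w)\<in>arcs E. excess {z, w})"
    by (rule sum_mono2) (use fin ex in auto)
  also have "(\<Sum>(z, w)\<in>arcs E. excess {z, w}) =
      (\<Sum>(z, w)\<in>arcs E. prob_edge {} {} {z, w}) + card (arcs E) * (2 / d\<^sup>2 - 2 / d)"
    by (simp add: excess_def case_prod_unfold sum.distrib sum_subtractf algebra_simps)
  also have "\<dots> = 2 * (real (card V) - 1) + card V * d * (2 / d\<^sup>2 - 2 / d)"
    unfolding foster card_arcs_E by simp
  also have "\<dots> = 2 * card V / d - 2"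
    using d_pos by (simp add: field_simps power2_eq_square)
  also have "\<dots> \<le> 2 * card V / d" by simp
  finally show ?thesis using assms by (simp add: mult_right_mono)
qed

end

section \<open>Galton--Watson trees as rooted graphs\<close>

lemma gw_verts_snoc: "w @ [i] \<in> gw_verts k \<longleftrightarrow> w \<in> gw_verts k \<and> i < k w"
proof
  assume "w @ [i] \<in> gw_verts k"
  then show "w \<in> gw_verts k \<and> i < k w" by (cases rule: gw_verts.cases) auto
qed (auto intro: gw_verts.child)

lemma gw_verts_butlast: "w \<in> gw_verts k \<Longrightarrow> w \<noteq> [] \<Longrightarrow> butlast w \<in> gw_verts k \<and> last w < k (butlast w)"
  using gw_verts_snoc[of "butlast w" "last w" k] by simp

lemma gw_verts_iff: "w \<in> gw_verts k \<longleftrightarrow> (\<forall>i<length w. w ! i < k (take i w))"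
proof (induction w rule: rev_induct)
  case Nil
  then show ?case by (simp add: gw_verts.root)
next
  case (snoc i w)
  then show ?case unfolding gw_verts_snoc by (auto simp: nth_append less_Suc_eq)
qed

lemma gw_tree_simps [simp]:
  "verts (fst (gw_tree k)) = gw_verts k" "snd (gw_tree k) = []"
  by (simp_all add: gw_tree_def)

lemma gw_tree_edge_iff:
  "{u, v} \<in> edges (fst (gw_tree k)) \<longleftrightarrow>
     v \<in> gw_verts k \<and> v \<noteq> [] \<and> u = butlast v \<or> u \<in> gw_verts k \<and> u \<noteq> [] \<and> v = butlast u"
proof -
  have "{u, v} \<in> edges (fst (gw_tree k)) \<longleftrightarrow>
     (\<exists>w i. w @ [i] \<in> gw_verts k \<and> (u = w \<and> v = w @ [i] \<or> u = w @ [i] \<and> v = w))"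
    unfolding gw_verts_snoc by (auto simp: gw_tree_def doubleton_eq_iff)
  also have "\<dots> \<longleftrightarrow> v \<in> gw_verts k \<and> v \<noteq> [] \<and> u = butlast v \<or> u \<in> gw_verts k \<and> u \<noteq> [] \<and> v = butlast u"
    by (metis append_butlast_last_id butlast_snoc snoc_eq_iff_butlast)
  finally show ?thesis .
qed

lemma gw_tree_walk: "w \<in> gw_verts k \<Longrightarrow> ([], w) \<in> adj (fst (gw_tree k)) ^^ length w"
proof (induction w rule: rev_induct)
  case (snoc i w)
  then have w: "w \<in> gw_verts k" by (simp add: gw_verts_snoc)
  have "(w, w @ [i]) \<in> adj (fst (gw_tree k))" using snoc.prems by (simp add: adj_iff gw_tree_edge_iff)
  then show ?case using snoc.IH[OF w] by auto
qed simp

lemma gw_tree_walk_length: "([], w) \<in> adj (fst (gw_tree k)) ^^ n \<Longrightarrow> length w \<le> n"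
proof (induction n arbitrary: w)
  case (Suc n)
  then obtain u where u: "([], u) \<in> adj (fst (gw_tree k)) ^^ n" "(u, w) \<in> adj (fst (gw_tree k))" by auto
  have "length w \<le> Suc (length u)" using u(2) by (auto simp: adj_iff gw_tree_edge_iff)
  then show ?case using Suc.IH[OF u(1)] by simp
qed simp

lemma bverts_gw_tree: "bverts r (gw_tree k) = {w \<in> gw_verts k. length w \<le> r}"
  unfolding bverts_def using gw_tree_walk gw_tree_walk_length by fastforce

lemma rgraph_gw_tree: "rgraph (gw_tree k)"
proof (rule rgraphI)
  show "simple_graph (fst (gw_tree k))" unfolding simple_graph_def
    by (auto simp: gw_tree_def intro: gw_verts.child)
  have r: "([], u) \<in> (adj (fst (gw_tree k)))\<^sup>*" if "u \<in> gw_verts k" for u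
    using gw_tree_walk[OF that] by (rule relpow_imp_rtrancl)
  have "(u, v) \<in> (adj (fst (gw_tree k)))\<^sup>*" if "u \<in> gw_verts k" "v \<in> gw_verts k" for u v
    using symD[OF sym_rtrancl[OF sym_adj] r[OF that(1)]] r[OF that(2)] by (rule rtrancl_trans)
  then show "gconnected (fst (gw_tree k))" by (auto simp: gconnected_def intro: gw_verts.root)
  show "locally_finite (fst (gw_tree k))" unfolding locally_finite_def
  proof
    fix v assume "v \<in> verts (fst (gw_tree k))"
    have "nbrs (fst (gw_tree k)) v \<subseteq> insert (butlast v) ((\<lambda>i. v @ [i]) ` {..<k v})"
    proof
      fix u assume "u \<in> nbrs (fst (gw_tree k)) v"
      then consider "u \<in> gw_verts k" "u \<noteq> []" "v = butlast u" | "u = butlast v"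
        by (auto simp: nbrs_def gw_tree_edge_iff)
      then show "u \<in> insert (butlast v) ((\<lambda>i. v @ [i]) ` {..<k v})"
      proof cases
        case 1
        then have "u = v @ [last u]" "last u < k v" using gw_verts_butlast[of u k] by auto
        then show ?thesis by blast
      qed simp
    qed
    then show "finite (nbrs (fst (gw_tree k)) v)" by (rule finite_subset) simp
  qed
qed (simp add: gw_verts.root)

lemma finite_bverts_gw: "finite (bverts r (gw_tree k))"
  by (rule finite_bverts[OF rgraph_gw_tree])

lemma rball_gw_edge_iff:
  "{u, v} \<in> edges (fst (rball r (gw_tree k))) \<longleftrightarrow>
     v \<in> bverts r (gw_tree k) \<and> v \<noteq> [] \<and> u = butlast v \<or> u \<in> bverts r (gw_tree k) \<and> u \<noteq> [] \<and> v = butlast u"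
proof -
  have "butlast x \<in> bverts r (gw_tree k)" if "x \<in> bverts r (gw_tree k)" "x \<noteq> []" for x
    using that gw_verts_butlast[of x k] by (auto simp: bverts_gw_tree)
  then show ?thesis unfolding rball_simps
    by (auto simp: gw_tree_edge_iff bverts_gw_tree simp del: gw_tree_simps)
qed

text \<open>Siblings may be numbered with gaps, so that the class is closed under removal of any
  longest word, as the induction below requires.\<close>

definition word_tree :: "nat list set \<Rightarrow> bool" where
  "word_tree W \<longleftrightarrow> finite W \<and> [] \<in> W \<and> (\<forall>w\<in>W. w \<noteq> [] \<longrightarrow> butlast w \<in> W)"

lemma word_tree_bverts: "word_tree (bverts r (gw_tree k))"
  using gw_verts_butlast[of _ k] finite_bverts_gw[of r k]
  by (auto simp: word_tree_def bverts_gw_tree gw_verts.root)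

text \<open>A word of maximal length is the parent of no other word, so it can be removed as a
  leaf.\<close>

lemma word_tree_induct [consumes 1, case_names root insert]:
  assumes "word_tree W" "P {[]}"
    and step: "\<And>W w. word_tree W \<Longrightarrow> w \<notin> W \<Longrightarrow> w \<noteq> [] \<Longrightarrow> butlast w \<in> W \<Longrightarrow> P W \<Longrightarrow> P (insert w W)"
  shows "P W"
  using assms(1)
proof (induction "card W" arbitrary: W rule: less_induct)
  case less
  have W: "finite W" "[] \<in> W" "\<And>w. w \<in> W \<Longrightarrow> w \<noteq> [] \<Longrightarrow> butlast w \<in> W"
    using less.prems by (auto simp: word_tree_def)
  show ?case
  proof (cases "W = {[]}")
    case False
    define m where "m = Max (length ` W)"
    have m: "length w \<le> m" if "w \<in> W" for w using that W(1) by (simp add: m_def)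
    have "m \<in> length ` W" unfolding m_def using W by (intro Max_in) auto
    then obtain w where w: "w \<in> W" "length w = m" by auto
    have "w \<noteq> []"
    proof
      assume "w = []"
      then have "W \<subseteq> {[]}" using m w by auto
      then show False using False W(2) by auto
    qed
    have "butlast u \<noteq> w" if "u \<in> W" "u \<noteq> []" for u
      using m[OF that(1)] w that(2) by (metis One_nat_def diff_less dual_order.strict_trans2
          length_butlast length_greater_0_conv less_irrefl zero_less_one)
    then have t: "word_tree (W - {w})" using W \<open>w \<noteq> []\<close> by (auto simp: word_tree_def)
    have "P (W - {w})" using less.hyps[OF _ t] W(1) w(1) by (metis card_Diff1_less)
    moreover have "butlast w \<in> W - {w}"
      using W(3)[OF w(1) \<open>w \<noteq> []\<close>] \<open>w \<noteq> []\<close>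
      by (metis Diff_iff append_butlast_last_id append_self_conv list.distinct(1) singletonD)
    ultimately have "P (insert w (W - {w}))" using step[OF t _ \<open>w \<noteq> []\<close>] by blast
    then show ?thesis using w(1) by (simp add: insert_absorb)
  qed (use assms(2) in simp)
qed

section \<open>Counting isomorphisms\<close>

text \<open>Each isomorphism is one concrete embedded tree, to which estimates for given edges
  apply; the number of automorphisms is divided out later. Extensionality identifies maps that agree
  on the vertices, so that the set is finite for finite graphs.\<close>

definition isos :: "'a rgraph \<Rightarrow> 'b rgraph \<Rightarrow> ('a \<Rightarrow> 'b) set" where
  "isos X Y = {f \<in> extensional (verts (fst X)). iso_map f X Y}"

lemma iso_map_cong:
  assumes "\<And>v. v \<in> verts (fst X) \<Longrightarrow> f v = g v" "snd X \<in> verts (fst X)"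
  shows "iso_map f X Y \<longleftrightarrow> iso_map g X Y"
  using assms bij_betw_cong[of "verts (fst X)" f g] unfolding iso_map_def by auto

lemma isos_subset: "isos X Y \<subseteq> verts (fst X) \<rightarrow>\<^sub>E verts (fst Y)"
proof
  fix f assume f: "f \<in> isos X Y"
  then have "bij_betw f (verts (fst X)) (verts (fst Y))" by (simp add: isos_def iso_map_def)
  then show "f \<in> verts (fst X) \<rightarrow>\<^sub>E verts (fst Y)"
    using f bij_betwE[of f "verts (fst X)" "verts (fst Y)"] by (simp add: isos_def PiE_iff)
qed

lemma finite_isos: "finite (verts (fst X)) \<Longrightarrow> finite (verts (fst Y)) \<Longrightarrow> finite (isos X Y)"
  by (rule finite_subset[OF isos_subset]) (intro finite_PiE)

lemma card_isos_le:
  assumes Y: "rgraph Y" "rgraph Z" and X: "snd X \<in> verts (fst X)"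
    and fin: "finite (verts (fst X))" "finite (verts (fst Z))"
    and YZ: "rgraph_iso Y Z"
  shows "card (isos X Y) \<le> card (isos X Z)"
proof -
  obtain g where g: "iso_map g Y Z" using YZ by (auto simp: rgraph_iso_iff)
  let ?F = "\<lambda>f. restrict (g \<circ> f) (verts (fst X))"
  have "?F f \<in> isos X Z" if "f \<in> isos X Y" for f
    using that iso_map_comp[of f X Y g Z] g iso_map_cong[of X "?F f" "g \<circ> f" Z] X
    by (auto simp: isos_def)
  moreover have "inj_on ?F (isos X Y)"
  proof (rule inj_onI)
    fix f f' assume f: "f \<in> isos X Y" "f' \<in> isos X Y" and eq: "?F f = ?F f'"
    show "f = f'"
    proof (rule extensionalityI[of _ "verts (fst X)"])
      fix v assume v: "v \<in> verts (fst X)"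
      then have "g (f v) = g (f' v)" using fun_cong[OF eq, of v] by simp
      moreover have "f v \<in> verts (fst Y)" "f' v \<in> verts (fst Y)"
        using f v isos_subset[of X Y] by (auto simp: PiE_iff)
      ultimately show "f v = f' v"
        using bij_betw_imp_inj_on[OF iso_mapD(1)[OF g]] by (auto dest: inj_onD)
    qed (use f in \<open>auto simp: isos_def\<close>)
  qed
  ultimately show ?thesis
    by (intro card_inj_on_le[of ?F]) (auto intro: finite_isos fin)
qed

lemma card_isos_eq:
  assumes Y: "rgraph Y" "rgraph Z" and X: "snd X \<in> verts (fst X)"
    and fin: "finite (verts (fst X))" "finite (verts (fst Y))" "finite (verts (fst Z))"
    and YZ: "rgraph_iso Y Z"
  shows "card (isos X Y) = card (isos X Z)"
  using card_isos_le[OF Y X fin(1,3) YZ] card_isos_le[OF Y(2,1) X fin(1,2) rgraph_iso_sym[OF Y(1) YZ]]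
  by simp

lemma isos_self_nonempty: "snd X \<in> verts (fst X) \<Longrightarrow> isos X X \<noteq> {}"
proof -
  assume X: "snd X \<in> verts (fst X)"
  have "iso_map (\<lambda>x. x) X X" by (simp add: iso_map_def bij_betw_def)
  then have "restrict (\<lambda>x. x) (verts (fst X)) \<in> isos X X"
    using iso_map_cong[of X "restrict (\<lambda>x. x) (verts (fst X))" "\<lambda>x. x" X] X by (simp add: isos_def)
  then show ?thesis by blast
qed

text \<open>The last fact makes the image exact: a vertex below level \<open>r\<close> has all its
  neighbours in the ball, so the surrounding graph has no further edge there. At level
  \<open>r\<close> nothing is known about further edges.\<close>

lemma rball_gw_iso_facts:
  assumes X: "rgraph X" and f: "iso_map f (rball r (gw_tree k)) (rball r X)"
  shows "bij_betw f (bverts r (gw_tree k)) (bverts r X)" "f [] = snd X"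
    "\<And>w. w \<in> bverts r (gw_tree k) \<Longrightarrow> w \<noteq> [] \<Longrightarrow> {f (butlast w), f w} \<in> edges (fst X)"
    "\<And>w y. w \<in> bverts r (gw_tree k) \<Longrightarrow> length w < r \<Longrightarrow> {f w, y} \<in> edges (fst X) \<Longrightarrow>
       y \<in> f ` bverts r (gw_tree k)"
proof -
  show bij: "bij_betw f (bverts r (gw_tree k)) (bverts r X)" using iso_mapD(1)[OF f] by simp
  show "f [] = snd X" using iso_mapD(3)[OF f] by simp
  show "{f (butlast w), f w} \<in> edges (fst X)" if w: "w \<in> bverts r (gw_tree k)" "w \<noteq> []" for w
  proof -
    have "butlast w \<in> bverts r (gw_tree k)" using word_tree_bverts[of r k] w by (auto simp: word_tree_def)
    then have "{f (butlast w), f w} \<in> edges (fst (rball r X))"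
      using iso_mapD(2)[OF f, of "butlast w" w] w rball_gw_edge_iff[of "butlast w" w r k]
      by (simp del: rball_simps(2))
    then show ?thesis by simp
  qed
  show "y \<in> f ` bverts r (gw_tree k)"
    if w: "w \<in> bverts r (gw_tree k)" "length w < r" and y: "{f w, y} \<in> edges (fst X)" for w y
  proof -
    note X' = rgraphD[OF X] and G' = rgraphD[OF rgraph_gw_tree[of k]]
    have "w \<in> gw_verts k" using w by (simp add: bverts_gw_tree)
    then have "([], w) \<in> adj (fst (rball r (gw_tree k))) ^^ length w"
      using bverts_walk[OF G'(1,4), of w "length w" r] gw_tree_walk[of w k] w(2) by simp
    then have "(snd (rball r X), f w) \<in> adj (fst (rball r X)) ^^ length w"
      using iso_map_walk[OF rgraphD(1,4)[OF rgraph_rball[OF rgraph_gw_tree]] f] by simp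
    moreover have "adj (fst (rball r X)) \<subseteq> adj (fst X)" by (auto simp: adj_def)
    ultimately have "(snd X, f w) \<in> adj (fst X) ^^ length w"
      using relpow_mono_rel[of "adj (fst (rball r X))" "adj (fst X)" "length w"] by auto
    then have "(snd X, y) \<in> adj (fst X) ^^ Suc (length w)" using y by (auto simp: adj_iff)
    moreover have "y \<in> verts (fst X)" using adj_verts[OF X'(1)] y by (auto simp: adj_iff)
    ultimately have "y \<in> bverts r X" using Suc_leI[OF w(2)] unfolding bverts_def by blast
    then show ?thesis using bij by (auto simp: bij_betw_def)
  qed
qed

section \<open>Embedded trees in a uniform spanning tree\<close>

text \<open>The bound of \<open>prob_edge_contract_le\<close> for \<open>s\<close> contracted
  vertices, with deviation \<open>\<eta>\<close> per edge and at most \<open>2 * r\<close> edges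
  between two vertices of the ball.\<close>

definition contract_bound :: "nat \<Rightarrow> nat \<Rightarrow> real \<Rightarrow> nat \<Rightarrow> real" where
  "contract_bound d r \<eta> s = (sqrt ((1 + 1 / s) / d + 4 / d\<^sup>2) + 2 * r * \<eta>)\<^sup>2"

text \<open>The exponential of \<open>card_trees_avoid_le\<close> for \<open>k\<close> contracted
  vertices and \<open>a * (d - k)\<close> deleted edges: each of the \<open>a\<close> inner vertices
  has at least \<open>d - k\<close> neighbours outside the image.\<close>

definition avoid_bound :: "nat \<Rightarrow> nat \<Rightarrow> nat \<Rightarrow> real" where
  "avoid_bound d k a = exp (- (\<Sum>j<a * (d - k). (1 / d + 1 / (real (k * d) - real j)) * (1 - 2 * k / d)))"

context regular_graph
begin

definition homs :: "nat list set \<Rightarrow> (nat list \<Rightarrow> 'a) set" where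
  "homs W = {\<phi> \<in> W \<rightarrow>\<^sub>E V. \<forall>w\<in>W. w \<noteq> [] \<longrightarrow> {\<phi> (butlast w), \<phi> w} \<in> E}"

definition img_edges :: "(nat list \<Rightarrow> 'a) \<Rightarrow> nat list set \<Rightarrow> 'a set set" where
  "img_edges \<phi> W = (\<lambda>w. {\<phi> (butlast w), \<phi> w}) ` (W - {[]})"

lemma finite_homs: "finite W \<Longrightarrow> finite (homs W)"
  by (rule finite_subset[of _ "W \<rightarrow>\<^sub>E V"]) (auto simp: homs_def finite_V intro: finite_PiE)

lemma homsI_restrict:
  assumes "\<phi> \<in> homs (insert w W)" "w \<notin> W" "word_tree W"
  shows "restrict \<phi> W \<in> homs W"
  using assms unfolding homs_def word_tree_def by (auto simp: PiE_iff)

text \<open>The image of the root is free, and every further word is sent to one of the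
  \<open>d\<close> neighbours of the image of its parent.\<close>

lemma card_homs_le: "word_tree W \<Longrightarrow> card (homs W) \<le> card V * d ^ (card W - 1)"
proof (induction W rule: word_tree_induct)
  case root
  have "homs {[]} = PiE {[] :: nat list} (\<lambda>_. V)" by (auto simp: homs_def)
  then show ?case by (simp add: card_PiE)
next
  case (insert W w)
  have W: "finite W" "[] \<in> W" using insert.hyps(1) by (auto simp: word_tree_def)
  let ?F = "\<lambda>\<phi>. (restrict \<phi> W, \<phi> w)"
  let ?S = "Sigma (homs W) (\<lambda>\<psi>. nb (\<psi> (butlast w)))"
  have "card (homs (insert w W)) \<le> card ?S"
  proof (rule card_inj_on_le[of ?F])
    show "inj_on ?F (homs (insert w W))"
    proof (rule inj_onI)
      fix \<phi> \<psi> assume h: "\<phi> \<in> homs (insert w W)" "\<psi> \<in> homs (insert w W)" and eq: "?F \<phi> = ?F \<psi>"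
      show "\<phi> = \<psi>"
      proof (rule extensionalityI[of _ "insert w W"])
        show "\<phi> \<in> extensional (insert w W)" "\<psi> \<in> extensional (insert w W)"
          using h by (auto simp: homs_def PiE_iff)
        fix u assume "u \<in> insert w W"
        then show "\<phi> u = \<psi> u" using eq by (metis insert_iff prod.inject restrict_apply')
      qed
    qed
    show "?F ` homs (insert w W) \<subseteq> ?S"
      using homsI_restrict[OF _ insert.hyps(2,1)] insert.hyps by (auto simp: homs_def)
    show "finite ?S" by (intro finite_SigmaI finite_homs W finite_nb)
  qed
  also have "card ?S = (\<Sum>\<psi>\<in>homs W. card (nb (\<psi> (butlast w))))"
    by (rule card_SigmaI) (use finite_homs[OF W(1)] finite_nb in auto)
  also have "\<dots> = (\<Sum>\<psi>\<in>homs W. d)"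
    using insert.hyps by (intro sum.cong[OF refl] card_nbrs) (auto simp: homs_def PiE_iff)
  also have "\<dots> \<le> card V * d ^ (card W - 1) * d" using insert.IH by simp
  also have "\<dots> = card V * d ^ (card (insert w W) - 1)"
  proof -
    obtain m where "card W = Suc m" using W by (metis card_gt_0_iff empty_iff gr0_implies_Suc)
    then show ?thesis using W insert.hyps by (simp add: mult_ac)
  qed
  finally show ?case .
qed

lemma img_edges_insert:
  "w \<noteq> [] \<Longrightarrow> img_edges \<phi> (insert w W) = insert {\<phi> (butlast w), \<phi> w} (img_edges \<phi> W)"
  by (auto simp: img_edges_def)

lemma img_edges_subset: "word_tree W \<Longrightarrow> e \<in> img_edges \<phi> W \<Longrightarrow> e \<subseteq> \<phi> ` W"
  by (auto simp: img_edges_def word_tree_def)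

lemma img_edges_conn:
  "word_tree W \<Longrightarrow> w \<in> W \<Longrightarrow> (\<phi> [], \<phi> w) \<in> conn (img_edges \<phi> W)"
proof (induction w rule: rev_induct)
  case (snoc i w)
  have "w \<in> W" using snoc.prems unfolding word_tree_def by (metis butlast_snoc snoc_eq_iff_butlast)
  moreover have "{\<phi> w, \<phi> (w @ [i])} \<in> img_edges \<phi> W"
    unfolding img_edges_def using snoc.prems(2) by (intro image_eqI[of _ _ "w @ [i]"]) auto
  ultimately show ?case using snoc by (meson conn_edge conn_trans)
qed simp

lemma close_pair_word:
  assumes "word_tree W" "\<And>w. w \<in> W \<Longrightarrow> w \<noteq> [] \<Longrightarrow> close_pair \<eta> (\<phi> (butlast w)) (\<phi> w)"
  shows "w \<in> W \<Longrightarrow> close_pair (real (length w) * \<eta>) (\<phi> []) (\<phi> w)"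
proof (induction w rule: rev_induct)
  case Nil
  then show ?case using close_pair_refl by simp
next
  case (snoc i w)
  have "w \<in> W" using assms(1) snoc.prems unfolding word_tree_def by (metis butlast_snoc snoc_eq_iff_butlast)
  then have "close_pair (real (length w) * \<eta> + \<eta>) (\<phi> []) (\<phi> (w @ [i]))"
    using close_pair_trans[OF snoc.IH] assms(2)[OF snoc.prems] by simp
  then show ?case by (simp add: algebra_simps)
qed

text \<open>Reveal the edges in the order of \<open>word_tree_induct\<close>. When \<open>s\<close>
  vertices are present, their tree is contracted and the next edge attaches a new vertex to it,
  which gives the factor \<open>contract_bound d r \<eta> s\<close>.\<close>

lemma card_trees_containing_le:
  assumes "word_tree W" "\<phi> \<in> homs W" "inj_on \<phi> W" "0 \<le> \<eta>"
    "\<And>w. w \<in> W \<Longrightarrow> length w \<le> r"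
    "\<And>w. w \<in> W \<Longrightarrow> w \<noteq> [] \<Longrightarrow> close_pair \<eta> (\<phi> (butlast w)) (\<phi> w)"
  shows "real (card (trees_with (img_edges \<phi> W) {})) \<le>
    card trees * (\<Prod>s\<in>{1..<card W}. contract_bound d r \<eta> s)"
  using assms
proof (induction W arbitrary: \<phi> rule: word_tree_induct)
  case root
  have "trees_with (img_edges \<phi> {[]}) {} = trees" by (simp add: trees_with_def img_edges_def)
  then show ?case by simp
next
  case (insert W w)
  note p = insert.prems and W = insert.hyps
  have fW: "finite W" "[] \<in> W" using W(1) by (auto simp: word_tree_def)
  have wt: "word_tree (insert w W)" using W by (auto simp: word_tree_def)
  let ?A = "img_edges \<phi> W"
  let ?x = "\<phi> (butlast w)" and ?y = "\<phi> w"
  have phiV: "\<phi> u \<in> V" if "u \<in> insert w W" for u using p(1) that by (auto simp: homs_def PiE_iff)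
  have xy: "{?x, ?y} \<in> E" using p(1) W(3) by (auto simp: homs_def)
  have y: "?y \<notin> \<phi> ` W" using p(2) W(2) by (auto simp: inj_on_def)
  then have yA: "{?x, ?y} \<notin> ?A" using img_edges_subset[OF W(1)] by blast
  have "img_edges (restrict \<phi> W) W = ?A" unfolding img_edges_def
    using W(1) by (intro image_cong) (auto simp: word_tree_def)
  moreover have "real (card (trees_with (img_edges (restrict \<phi> W) W) {})) \<le>
    card trees * (\<Prod>s\<in>{1..<card W}. contract_bound d r \<eta> s)"
  proof (rule insert.IH)
    show "restrict \<phi> W \<in> homs W" using homsI_restrict[OF p(1) W(2,1)] .
    show "inj_on (restrict \<phi> W) W" using p(2) by (auto simp: inj_on_def)
    show "close_pair \<eta> (restrict \<phi> W (butlast u)) (restrict \<phi> W u)" if "u \<in> W" "u \<noteq> []" for u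
      using p(5)[of u] that W(1) by (auto simp: word_tree_def)
  qed (use p in auto)
  ultimately have IH: "real (card (trees_with ?A {})) \<le>
    card trees * (\<Prod>s\<in>{1..<card W}. contract_bound d r \<eta> s)" by simp
  have "prob_edge ?A {} {?x, ?y} * card (trees_with ?A {}) \<le>
      contract_bound d r \<eta> (card W) * card (trees_with ?A {})"
  proof (cases "trees_with ?A {} = {}")
    case False
    have cl: "close_pair (real (length u) * \<eta>) (\<phi> []) (\<phi> u)" if "u \<in> insert w W" for u
      using close_pair_word[OF wt _ that, of \<eta> \<phi>] p(5) by blast
    \<comment> \<open>The comparison runs through the root, along two paths of length at most
      \<open>r\<close> each.\<close>
    have "close_pair (2 * real r * \<eta>) ?y (\<phi> u)" if u: "u \<in> W" for u
    proof -
      have "close_pair (real (length w) * \<eta> + real (length u) * \<eta>) ?y (\<phi> u)"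
        using close_pair_trans[OF close_pair_sym[OF cl[of w]] cl[of u]] u by simp
      moreover have "real (length w) * \<eta> + real (length u) * \<eta> \<le> 2 * real r * \<eta>"
        using p(4)[of w] p(4)[of u] u p(3)
          mult_right_mono[of "real (length w + length u)" "2 * real r" \<eta>]
        by (simp add: algebra_simps)
      ultimately show ?thesis by (rule close_pair_mono)
    qed
    then have cp: "close_pair (2 * real r * \<eta>) ?y s" if "s \<in> \<phi> ` W" for s using that by blast
    have cn: "(?x, s) \<in> conn ?A" if "s \<in> \<phi> ` W" for s
      using that img_edges_conn[OF W(1), of _ \<phi>] W(4) by (metis conn_sym conn_trans imageE)
    have "card (\<phi> ` W) = card W" using p(2) by (intro card_image) (auto simp: inj_on_def)
    moreover have "prob_edge ?A {} {?x, ?y} \<le>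
        (sqrt ((1 + 1 / card (\<phi> ` W)) / d + 4 / d\<^sup>2) + 2 * r * \<eta>)\<^sup>2"
      by (rule prob_edge_contract_le[OF xy yA False]) (use W(4) phiV y cn cp in auto)
    ultimately have "prob_edge ?A {} {?x, ?y} \<le> contract_bound d r \<eta> (card W)"
      by (simp add: contract_bound_def)
    then show ?thesis by (rule mult_right_mono) simp
  qed simp
  also have "\<dots> \<le> contract_bound d r \<eta> (card W) *
      (card trees * (\<Prod>s\<in>{1..<card W}. contract_bound d r \<eta> s))"
    by (intro mult_left_mono IH) (simp add: contract_bound_def)
  also have "\<dots> = card trees * (\<Prod>s\<in>{1..<card (insert w W)}. contract_bound d r \<eta> s)"
  proof -
    have "1 \<le> card W" using fW by (metis Suc_leI One_nat_def card_gt_0_iff empty_iff)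
    then show ?thesis using fW W(2) by (simp add: atLeastLessThanSuc)
  qed
  finally show ?case unfolding img_edges_insert[OF W(3)] card_trees_insert by simp
qed

text \<open>Exactness at the inner vertices forbids all their edges out of the image. There are at
  least \<open>card I * (d - card W)\<close> of them, and \<open>card_trees_avoid_le\<close> bounds
  the trees that avoid that many.\<close>

lemma card_trees_exact_le:
  assumes W: "word_tree W" "\<phi> \<in> homs W" "inj_on \<phi> W" and I: "I \<subseteq> W" and d: "2 * card W \<le> d"
  shows "real (card {T \<in> trees. img_edges \<phi> W \<subseteq> T \<and> (\<forall>w\<in>I. \<forall>y. {\<phi> w, y} \<in> T \<longrightarrow> y \<in> \<phi> ` W)})
    \<le> card (trees_with (img_edges \<phi> W) {}) * avoid_bound d (card W) (card I)"
proof -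
  let ?k = "card W" and ?S = "\<phi> ` W" and ?A = "img_edges \<phi> W"
  have fW: "finite W" "[] \<in> W" using W(1) by (auto simp: word_tree_def)
  have k: "?k \<ge> 1" using fW by (metis Suc_leI One_nat_def card_gt_0_iff empty_iff)
  have cS: "card ?S = ?k" using W(3) by (rule card_image)
  have SV: "?S \<subseteq> V" using W(2) by (auto simp: homs_def PiE_iff)
  define P where "P = Sigma (\<phi> ` I) (\<lambda>x. nb x - ?S)"
  define F where "F = (\<lambda>(x, y). {x, y}) ` P"
  \<comment> \<open>One end lies in the image and the other outside, so the unordered edge
    determines the pair.\<close>
  have "inj_on (\<lambda>(x, y). {x, y}) P"
    using I by (auto simp: inj_on_def P_def doubleton_eq_iff)
  then have "card F = card P" unfolding F_def by (rule card_image)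
  have fP: "finite P" unfolding P_def using fW(1) I finite_subset finite_nb by blast
  have "card P = (\<Sum>x\<in>\<phi> ` I. card (nb x - ?S))" unfolding P_def
    by (rule card_SigmaI) (use fW(1) I finite_subset finite_nb in blast)+
  moreover have "(\<Sum>x\<in>\<phi> ` I. d - ?k) \<le> (\<Sum>x\<in>\<phi> ` I. card (nb x - ?S))"
  proof (rule sum_mono)
    fix x assume "x \<in> \<phi> ` I"
    then have "x \<in> V" using I SV by blast
    then show "d - ?k \<le> card (nb x - ?S)"
      using diff_card_le_card_Diff[of ?S "nb x"] fW(1) card_nbrs cS by simp
  qed
  moreover have "card (\<phi> ` I) = card I" using W(3) I by (meson card_image inj_on_subset)
  ultimately have "card I * (d - ?k) \<le> card F" using \<open>card F = card P\<close> by simp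
  \<comment> \<open>Selecting an exact number of edges makes the bound independent of
    \<open>\<phi>\<close>.\<close>
  then obtain B where B: "B \<subseteq> F" "card B = card I * (d - ?k)" "finite B"
    by (meson obtain_subset_with_card_n)
  have "card I \<le> ?k" using fW(1) I by (rule card_mono)
  then have "card I * (d - ?k) \<le> ?k * (d - ?k)" by simp
  also have "\<dots> < ?k * d" using k d by simp
  finally have cB: "card B < card ?S * d" using B(2) cS by simp
  have "{T \<in> trees. ?A \<subseteq> T \<and> (\<forall>w\<in>I. \<forall>y. {\<phi> w, y} \<in> T \<longrightarrow> y \<in> ?S)} \<subseteq> trees_with ?A B"
    using B(1) by (auto simp: trees_with_def F_def P_def)
  then have "real (card {T \<in> trees. ?A \<subseteq> T \<and> (\<forall>w\<in>I. \<forall>y. {\<phi> w, y} \<in> T \<longrightarrow> y \<in> ?S)}) \<le>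
      card (trees_with ?A B)"
    using card_mono[OF finite_trees_with] by simp
  also have "\<dots> \<le> card (trees_with ?A {}) *
      exp (- (\<Sum>j<card B. (1 / d + 1 / (real (card ?S * d) - j)) * (1 - 2 * card ?S / d)))"
  proof (rule card_trees_avoid_le)
    show "e \<in> E \<and> (\<exists>x y. e = {x, y} \<and> x \<in> ?S \<and> y \<notin> ?S)" if eB: "e \<in> B" for e
    proof -
      obtain x y where xy: "(x, y) \<in> P" "e = {x, y}" using eB B(1) by (auto simp: F_def)
      then have "x \<in> ?S" "y \<notin> ?S" "{x, y} \<in> E" using I by (auto simp: P_def)
      then show ?thesis using xy(2) by blast
    qed
  qed (use fW SV B cB d cS img_edges_subset[OF W(1)] in auto)
  finally show ?thesis unfolding cS B(2) avoid_bound_def by simp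
qed

lemma rgraph_tree: "T \<in> trees \<Longrightarrow> \<rho> \<in> V \<Longrightarrow> rgraph ((V, T), \<rho>)"
proof (rule rgraphI)
  assume T: "T \<in> trees"
  show "simple_graph (fst ((V, T), \<rho>))" using treesD(1)[OF T] edgeD by (auto simp: simple_graph_def)
  show "gconnected (fst ((V, T), \<rho>))"
    using treesD(3)[OF T] V_nonempty conn_adj[of T V] by (auto simp: gconnected_def)
  show "locally_finite (fst ((V, T), \<rho>))" unfolding locally_finite_def nbrs_def
    using finite_nb treesD(1)[OF T] by (auto intro: rev_finite_subset)
qed simp

section \<open>Exploration through vertices of bounded degree\<close>

definition tnb :: "'a set set \<Rightarrow> 'a \<Rightarrow> 'a set" where
  "tnb T v = {u. {v, u} \<in> T}"

lemma finite_tnb: "T \<in> trees \<Longrightarrow> finite (tnb T v)"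
  unfolding tnb_def using finite_nb[of v] treesD(1) by (auto intro: rev_finite_subset)

text \<open>Ends of walks of length \<open>j\<close> in which every vertex that is left has degree
  at most \<open>D\<close>. The restriction bounds the set by \<open>D ^ j\<close> in every tree,
  while degrees in a spanning tree have no uniform bound; this is what makes mass transport
  quantitative.\<close>

primrec reach :: "'a set set \<Rightarrow> nat \<Rightarrow> nat \<Rightarrow> 'a \<Rightarrow> 'a set" where
  "reach T D 0 x = {x}"
| "reach T D (Suc j) x = (\<Union>u\<in>{u \<in> reach T D j x. card (tnb T u) \<le> D}. tnb T u)"

lemma finite_reach: "T \<in> trees \<Longrightarrow> finite (reach T D j x)"
  by (induction j) (auto intro: finite_tnb)

lemma card_reach_le: "T \<in> trees \<Longrightarrow> card (reach T D j x) \<le> D ^ j"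
proof (induction j)
  case (Suc j)
  let ?U = "{u \<in> reach T D j x. card (tnb T u) \<le> D}"
  have fin: "finite ?U" using finite_reach[OF Suc.prems] by simp
  have "card (reach T D (Suc j) x) \<le> (\<Sum>u\<in>?U. card (tnb T u))"
    using card_UN_le[OF fin] by simp
  also have "\<dots> \<le> (\<Sum>u\<in>?U. D)" by (rule sum_mono) simp
  also have "\<dots> \<le> card (reach T D j x) * D"
    using card_mono[OF finite_reach[OF Suc.prems, of D j x], of ?U] by simp
  also have "\<dots> \<le> D ^ j * D" using Suc by simp
  finally show ?case by (simp add: mult.commute)
qed simp

definition bad_arcs :: "real \<Rightarrow> ('a \<times> 'a) set" where
  "bad_arcs t = {(z, w)\<in>arcs E. excess {z, w} > t}"

lemma finite_bad_arcs: "finite (bad_arcs t)"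
  by (rule finite_subset[OF _ finite_arcs[of E]]) (auto simp: bad_arcs_def)

lemma sum_card_bad_arcs:
  "real (\<Sum>T\<in>trees. card (bad_arcs t \<inter> arcs T)) =
    card trees * (\<Sum>(z, w)\<in>bad_arcs t. prob_edge {} {} {z, w})"
proof -
  have t: "trees_with {} {} = trees" by (simp add: trees_with_def)
  have c: "0 < card trees" using finite_trees trees_nonempty by (simp add: card_gt_0_iff)
  have "real (\<Sum>T\<in>trees. card (bad_arcs t \<inter> arcs T)) =
      (\<Sum>T\<in>trees. \<Sum>p\<in>bad_arcs t. of_bool (p \<in> arcs T))"
    using finite_bad_arcs by (simp add: sum_of_bool_eq Int_def)
  also have "\<dots> = (\<Sum>p\<in>bad_arcs t. \<Sum>T\<in>trees. of_bool (p \<in> arcs T))" by (rule sum.swap)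
  also have "\<dots> = (\<Sum>p\<in>bad_arcs t. card trees * prob_edge {} {} {fst p, snd p})"
    using c finite_trees by (intro sum.cong[OF refl])
      (simp add: prob_edge_def t case_prod_unfold arcs_def trees_with_def sum_of_bool_eq Int_def)
  finally show ?thesis by (simp add: sum_distrib_left case_prod_unfold)
qed

end

context regular_graph
begin

lemma isos_rball_tree:
  assumes T: "T \<in> trees" and \<rho>: "\<rho> \<in> V" and \<phi>: "\<phi> \<in> isos (rball r (gw_tree k)) (rball r ((V, T), \<rho>))"
  defines "W \<equiv> bverts r (gw_tree k)"
  shows "\<phi> [] = \<rho>" "\<phi> \<in> homs W" "inj_on \<phi> W" "img_edges \<phi> W \<subseteq> T"
    "\<And>w y. w \<in> W \<Longrightarrow> length w < r \<Longrightarrow> {\<phi> w, y} \<in> T \<Longrightarrow> y \<in> \<phi> ` W"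
proof -
  have im: "iso_map \<phi> (rball r (gw_tree k)) (rball r ((V, T), \<rho>))" "\<phi> \<in> extensional W"
    using \<phi> by (auto simp: isos_def W_def)
  note F = rball_gw_iso_facts[OF rgraph_tree[OF T \<rho>] im(1), folded W_def]
  show "\<phi> [] = \<rho>" using F(2) by simp
  show "inj_on \<phi> W" using F(1) by (rule bij_betw_imp_inj_on)
  show sub: "img_edges \<phi> W \<subseteq> T" using F(3) by (auto simp: img_edges_def)
  show "y \<in> \<phi> ` W" if "w \<in> W" "length w < r" "{\<phi> w, y} \<in> T" for w y using F(4)[of w y] that by simp
  have "\<phi> w \<in> V" if "w \<in> W" for w
    using bij_betwE[OF F(1)] that bverts_verts[of _ r "((V, T), \<rho>)"] by auto
  then show "\<phi> \<in> homs W"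
    using sub treesD(1)[OF T] im(2) unfolding homs_def PiE_iff img_edges_def by blast
qed

text \<open>Climb from \<open>w\<close> to the root along prefixes. All words on the way are inner,
  so their images have degree at most \<open>D\<close> and the walk is admissible for
  \<open>reach\<close>.\<close>

lemma root_in_reach:
  assumes W: "word_tree W" and T: "T \<in> trees" and sub: "img_edges \<phi> W \<subseteq> T"
    and deg: "\<And>w. w \<in> W \<Longrightarrow> length w < r \<Longrightarrow> card (tnb T (\<phi> w)) \<le> D"
    and w: "w \<in> W" "length w < r"
  shows "\<phi> [] \<in> reach T D (length w) (\<phi> w)"
proof -
  \<comment> \<open>The word \<open>take (length w - i) w\<close> is the ancestor \<open>i\<close>
    levels above \<open>w\<close>.\<close>
  have "take (length w - i) w \<in> W \<and> \<phi> (take (length w - i) w) \<in> reach T D i (\<phi> w)" if "i \<le> length w" for i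
    using that
  proof (induction i)
    case (Suc i)
    define u where "u = take (length w - i) w"
    have u: "u \<in> W" "\<phi> u \<in> reach T D i (\<phi> w)" using Suc by (auto simp: u_def)
    have "u \<noteq> []" "length u < r" using Suc.prems w by (auto simp: u_def)
    have bu: "take (length w - Suc i) w = butlast u" by (simp add: u_def butlast_take)
    have "{\<phi> (butlast u), \<phi> u} \<in> T" using u \<open>u \<noteq> []\<close> sub by (auto simp: img_edges_def)
    then have "\<phi> (butlast u) \<in> tnb T (\<phi> u)" by (simp add: tnb_def insert_commute)
    then have "\<phi> (butlast u) \<in> reach T D (Suc i) (\<phi> w)"
      using u(2) deg[OF u(1) \<open>length u < r\<close>] by auto
    moreover have "butlast u \<in> W" using W u(1) \<open>u \<noteq> []\<close> by (auto simp: word_tree_def)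
    ultimately show ?case unfolding bu by simp
  qed (use w in simp)
  from this[of "length w"] show ?thesis by simp
qed

text \<open>An isomorphism is bad if it uses an edge of excess above \<open>t\<close>. From such an edge the root is
  reached by a short walk through inner vertices, whose degrees are at most \<open>k\<close>; hence each edge is
  responsible for boundedly many bad roots.\<close>

theorem sum_isos_le:
  fixes \<kappa> :: "nat list \<Rightarrow> nat" and r :: nat and t :: real
  defines "W \<equiv> bverts r (gw_tree \<kappa>)"
  defines "k \<equiv> card W" and "a \<equiv> card {w\<in>W. length w < r}"
  assumes d: "2 * k \<le> d" and t: "t > 0"
  shows "(\<Sum>T\<in>trees. \<Sum>\<rho>\<in>V. real (card (isos (rball r (gw_tree \<kappa>)) (rball r ((V, T), \<rho>))))) \<le>
    card V * card trees * (d ^ (k - 1) * (\<Prod>s\<in>{1..<k}. contract_bound d r (sqrt t) s) * avoid_bound d k a +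
      real (k ^ k * (\<Sum>j<r. k ^ j)) * (2 / d * (1 + 2 / (d * t))))"
proof -
  let ?iso = "\<lambda>T \<rho>. isos (rball r (gw_tree \<kappa>)) (rball r ((V, T), \<rho>))"
  define I where "I = {w\<in>W. length w < r}"
  have W: "word_tree W" unfolding W_def by (rule word_tree_bverts)
  then have fW: "finite W" "[] \<in> W" by (auto simp: word_tree_def)
  define good where "good \<phi> \<longleftrightarrow> (\<forall>w\<in>W. w \<noteq> [] \<longrightarrow> excess {\<phi> (butlast w), \<phi> w} \<le> t)" for \<phi>
  note facts = isos_rball_tree[where k = \<kappa> and r = r, folded W_def]
  have fin: "finite (?iso T \<rho>)" if T: "T \<in> trees" "\<rho> \<in> V" for T \<rho>
    by (rule finite_subset[of _ "homs W"]) (use facts(2)[OF T] finite_homs[OF fW(1)] in auto)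
  have split: "real (card (?iso T \<rho>)) = card {\<phi>\<in>?iso T \<rho>. good \<phi>} + card {\<phi>\<in>?iso T \<rho>. \<not> good \<phi>}"
    if T: "T \<in> trees" "\<rho> \<in> V" for T \<rho>
  proof -
    have "?iso T \<rho> = {\<phi>\<in>?iso T \<rho>. good \<phi>} \<union> {\<phi>\<in>?iso T \<rho>. \<not> good \<phi>}" by auto
    then have "card (?iso T \<rho>) = card ({\<phi>\<in>?iso T \<rho>. good \<phi>} \<union> {\<phi>\<in>?iso T \<rho>. \<not> good \<phi>})" by simp
    also have "\<dots> = card {\<phi>\<in>?iso T \<rho>. good \<phi>} + card {\<phi>\<in>?iso T \<rho>. \<not> good \<phi>}"
      by (rule card_Un_disjoint) (use fin[OF T] in auto)
    finally show ?thesis by simp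
  qed
  define H where "H = {\<phi>\<in>homs W. inj_on \<phi> W \<and> good \<phi>}"
  have fH: "finite H" using finite_homs[OF fW(1)] by (simp add: H_def)
  define ex where "ex \<phi> T \<longleftrightarrow> img_edges \<phi> W \<subseteq> T \<and> (\<forall>w\<in>I. \<forall>y. {\<phi> w, y} \<in> T \<longrightarrow> y \<in> \<phi> ` W)" for \<phi> T
  let ?Q = "(\<Prod>s\<in>{1..<k}. contract_bound d r (sqrt t) s) * avoid_bound d k a"
  have good_le: "real (card {T\<in>trees. ex \<phi> T}) \<le> card trees * ?Q" if \<phi>: "\<phi> \<in> H" for \<phi>
  proof -
    have h: "\<phi> \<in> homs W" "inj_on \<phi> W" "good \<phi>" using \<phi> by (auto simp: H_def)
    have "real (card {T\<in>trees. ex \<phi> T}) \<le> card (trees_with (img_edges \<phi> W) {}) * avoid_bound d (card W) (card I)"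
      unfolding ex_def using d by (intro card_trees_exact_le W h) (auto simp: I_def k_def)
    also have "\<dots> = card (trees_with (img_edges \<phi> W) {}) * avoid_bound d k a"
      by (simp add: k_def a_def I_def)
    also have "\<dots> \<le> card trees * (\<Prod>s\<in>{1..<card W}. contract_bound d r (sqrt t) s) * avoid_bound d k a"
    proof (rule mult_right_mono)
      show "real (card (trees_with (img_edges \<phi> W) {})) \<le>
        card trees * (\<Prod>s\<in>{1..<card W}. contract_bound d r (sqrt t) s)"
      proof (rule card_trees_containing_le[OF W h(1,2)])
        show "length w \<le> r" if "w \<in> W" for w using that by (simp add: W_def bverts_gw_tree)
        show "close_pair (sqrt t) (\<phi> (butlast w)) (\<phi> w)" if w: "w \<in> W" "w \<noteq> []" for w
        proof (rule close_pair_mono[OF close_pair_edge(2)])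
          show "{\<phi> (butlast w), \<phi> w} \<in> E" using h(1) w by (auto simp: homs_def)
          show "sqrt (excess {\<phi> (butlast w), \<phi> w}) \<le> sqrt t" using h(3) w by (auto simp: good_def)
        qed
      qed (use t in simp)
    qed (simp add: avoid_bound_def)
    finally show ?thesis by (simp add: k_def mult.assoc)
  qed
  have "(\<Sum>T\<in>trees. \<Sum>\<rho>\<in>V. real (card {\<phi>\<in>?iso T \<rho>. good \<phi>})) \<le> (\<Sum>T\<in>trees. real (card {\<phi>\<in>H. ex \<phi> T}))"
  proof (rule sum_mono)
    fix T assume T: "T \<in> trees"
    \<comment> \<open>The root is recovered as \<open>\<phi> []\<close>, so isomorphisms for
      different roots are different maps.\<close>
    have "(\<Sum>\<rho>\<in>V. card {\<phi>\<in>?iso T \<rho>. good \<phi>}) = card (\<Union>\<rho>\<in>V. {\<phi>\<in>?iso T \<rho>. good \<phi>})"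
    proof (rule card_UN_disjoint[symmetric])
      show "\<forall>i\<in>V. \<forall>j\<in>V. i \<noteq> j \<longrightarrow> {\<phi>\<in>?iso T i. good \<phi>} \<inter> {\<phi>\<in>?iso T j. good \<phi>} = {}"
        using facts(1)[OF T] by blast
    qed (use fin[OF T] finite_V in auto)
    also have "\<dots> \<le> card {\<phi>\<in>H. ex \<phi> T}"
    proof (rule card_mono)
      show "(\<Union>\<rho>\<in>V. {\<phi>\<in>?iso T \<rho>. good \<phi>}) \<subseteq> {\<phi>\<in>H. ex \<phi> T}"
      proof clarify
        fix \<rho> \<phi> assume \<phi>: "\<rho> \<in> V" "\<phi> \<in> ?iso T \<rho>" "good \<phi>"
        note F = facts[OF T \<phi>(1,2)]
        show "\<phi> \<in> H \<and> ex \<phi> T" using F(2-5) \<phi>(3) unfolding H_def ex_def I_def by blast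
      qed
    qed (use fH in simp)
    finally show "(\<Sum>\<rho>\<in>V. real (card {\<phi>\<in>?iso T \<rho>. good \<phi>})) \<le> card {\<phi>\<in>H. ex \<phi> T}"
      by (simp flip: of_nat_sum)
  qed
  also have "\<dots> = (\<Sum>T\<in>trees. \<Sum>\<phi>\<in>H. of_bool (ex \<phi> T))" using fH by (simp add: sum_of_bool_eq Int_def)
  also have "\<dots> = (\<Sum>\<phi>\<in>H. \<Sum>T\<in>trees. of_bool (ex \<phi> T))" by (rule sum.swap)
  also have "\<dots> = (\<Sum>\<phi>\<in>H. real (card {T\<in>trees. ex \<phi> T}))"
    using finite_trees by (simp add: sum_of_bool_eq Int_def)
  also have "\<dots> \<le> (\<Sum>\<phi>\<in>H. card trees * ?Q)" by (rule sum_mono[OF good_le])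
  also have "\<dots> = card H * (card trees * ?Q)" by simp
  also have "\<dots> \<le> (card V * d ^ (k - 1)) * (card trees * ?Q)"
  proof (rule mult_right_mono)
    have "card H \<le> card (homs W)" by (rule card_mono) (use finite_homs[OF fW(1)] in \<open>auto simp: H_def\<close>)
    then have "card H \<le> card V * d ^ (k - 1)" using card_homs_le[OF W] by (simp add: k_def)
    then show "real (card H) \<le> card V * d ^ (k - 1)" by (metis of_nat_mono)
    show "0 \<le> card trees * ?Q"
      by (intro mult_nonneg_nonneg prod_nonneg) (auto simp: contract_bound_def avoid_bound_def)
  qed
  finally have G: "(\<Sum>T\<in>trees. \<Sum>\<rho>\<in>V. real (card {\<phi>\<in>?iso T \<rho>. good \<phi>})) \<le>
     card V * d ^ (k - 1) * (card trees * ?Q)" .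
  \<comment> \<open>At most \<open>k ^ k\<close> isomorphisms exist at one root, and at most
    \<open>\<Sum>j<r. k ^ j\<close> roots are reached from the inner end of one bad arc.\<close>
  let ?M = "k ^ k * (\<Sum>j<r. k ^ j)"
  have bad_le: "(\<Sum>\<rho>\<in>V. card {\<phi>\<in>?iso T \<rho>. \<not> good \<phi>}) \<le> ?M * card (bad_arcs t \<inter> arcs T)"
    if T: "T \<in> trees" for T
  proof -
    define Y where "Y = (\<Union>p\<in>bad_arcs t \<inter> arcs T. \<Union>j\<in>{..<r}. reach T k j (fst p))"
    have fB: "finite (bad_arcs t \<inter> arcs T)" using finite_bad_arcs by simp
    have fY: "finite Y" unfolding Y_def using fB finite_reach[OF T] by simp
    have iso_card: "card (?iso T \<rho>) \<le> k ^ k" if \<rho>: "\<rho> \<in> V" for \<rho>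
    proof (cases "?iso T \<rho> = {}")
      case False
      let ?B = "bverts r ((V, T), \<rho>)"
      obtain \<phi> where "\<phi> \<in> ?iso T \<rho>" using False by blast
      then have "bij_betw \<phi> W ?B" by (auto simp: isos_def iso_map_def W_def)
      then have "card ?B = k" by (simp add: k_def bij_betw_same_card)
      moreover have fB': "finite ?B"
        by (rule finite_subset[OF _ finite_V]) (use bverts_subset[of r "((V, T), \<rho>)"] in simp)
      have "card (?iso T \<rho>) \<le> card (W \<rightarrow>\<^sub>E ?B)"
        by (rule card_mono) (use isos_subset[of "rball r (gw_tree \<kappa>)" "rball r ((V, T), \<rho>)"] fW fB'
            in \<open>auto simp: W_def intro: finite_PiE\<close>)
      ultimately show ?thesis using fW by (simp add: card_PiE k_def)
    qed simp
    have bad_Y: "\<rho> \<in> Y" if \<rho>: "\<rho> \<in> V" and \<phi>: "\<phi> \<in> ?iso T \<rho>" "\<not> good \<phi>" for \<rho> \<phi>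
    proof -
      note F = facts[OF T \<rho> \<phi>(1)]
      obtain w where w: "w \<in> W" "w \<noteq> []" "excess {\<phi> (butlast w), \<phi> w} > t"
        using \<phi>(2) by (auto simp: good_def not_le)
      have lw: "length w \<le> r" using w(1) by (simp add: W_def bverts_gw_tree)
      have bw: "butlast w \<in> W" using W w by (auto simp: word_tree_def)
      have lbw: "length (butlast w) < r" using w lw by (cases w) auto
      have e: "{\<phi> (butlast w), \<phi> w} \<in> T" using F(4) w by (auto simp: img_edges_def)
      then have p: "(\<phi> (butlast w), \<phi> w) \<in> bad_arcs t \<inter> arcs T"
        using w(3) treesD(1)[OF T] by (auto simp: bad_arcs_def arcs_def)
      \<comment> \<open>The neighbours of an inner vertex lie in the image of \<open>W\<close>,
        which has \<open>k\<close> elements; so \<open>k\<close> serves as degree bound in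
        \<open>reach\<close>.\<close>
      have "card (tnb T (\<phi> u)) \<le> k" if "u \<in> W" "length u < r" for u
      proof -
        have "tnb T (\<phi> u) \<subseteq> \<phi> ` W" using F(5)[OF that] by (auto simp: tnb_def)
        then have "card (tnb T (\<phi> u)) \<le> card (\<phi> ` W)" using fW by (intro card_mono) auto
        also have "\<dots> \<le> k" unfolding k_def by (rule card_image_le[OF fW(1)])
        finally show ?thesis .
      qed
      then have "\<phi> [] \<in> reach T k (length (butlast w)) (\<phi> (butlast w))"
        by (rule root_in_reach[OF W T F(4) _ bw lbw])
      then show ?thesis unfolding Y_def using p lbw F(1) by force
    qed
    have "(\<Sum>\<rho>\<in>V. card {\<phi>\<in>?iso T \<rho>. \<not> good \<phi>}) = (\<Sum>\<rho>\<in>V \<inter> Y. card {\<phi>\<in>?iso T \<rho>. \<not> good \<phi>})"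
    proof (rule sum.mono_neutral_right)
      show "\<forall>\<rho>\<in>V - V \<inter> Y. card {\<phi>\<in>?iso T \<rho>. \<not> good \<phi>} = 0"
        using bad_Y by (metis (mono_tags, lifting) Diff_iff IntI card.empty empty_Collect_eq)
    qed (use finite_V in auto)
    also have "\<dots> \<le> (\<Sum>\<rho>\<in>V \<inter> Y. k ^ k)"
    proof (rule sum_mono)
      fix \<rho> assume "\<rho> \<in> V \<inter> Y"
      then show "card {\<phi>\<in>?iso T \<rho>. \<not> good \<phi>} \<le> k ^ k"
        using iso_card[of \<rho>] card_mono[OF fin[OF T], of \<rho> "{\<phi>\<in>?iso T \<rho>. \<not> good \<phi>}"] by auto
    qed
    also have "\<dots> \<le> card Y * k ^ k" using card_mono[OF fY, of "V \<inter> Y"] by simp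
    also have "card Y \<le> (\<Sum>p\<in>bad_arcs t \<inter> arcs T. card (\<Union>j\<in>{..<r}. reach T k j (fst p)))"
      unfolding Y_def by (rule card_UN_le[OF fB])
    also have "\<dots> \<le> (\<Sum>p\<in>bad_arcs t \<inter> arcs T. \<Sum>j<r. k ^ j)"
    proof (rule sum_mono)
      fix p
      have "card (\<Union>j\<in>{..<r}. reach T k j (fst p)) \<le> (\<Sum>j<r. card (reach T k j (fst p)))"
        by (rule card_UN_le) simp
      also have "\<dots> \<le> (\<Sum>j<r. k ^ j)" by (rule sum_mono[OF card_reach_le[OF T]])
      finally show "card (\<Union>j\<in>{..<r}. reach T k j (fst p)) \<le> (\<Sum>j<r. k ^ j)" .
    qed
    finally show ?thesis by (simp add: mult_ac)
  qed
  have "(\<Sum>T\<in>trees. \<Sum>\<rho>\<in>V. real (card {\<phi>\<in>?iso T \<rho>. \<not> good \<phi>})) =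
      real (\<Sum>T\<in>trees. \<Sum>\<rho>\<in>V. card {\<phi>\<in>?iso T \<rho>. \<not> good \<phi>})" by simp
  also have "\<dots> \<le> real (\<Sum>T\<in>trees. ?M * card (bad_arcs t \<inter> arcs T))"
    by (rule of_nat_mono[OF sum_mono[OF bad_le]])
  also have "\<dots> = ?M * (card trees * (\<Sum>(z, w)\<in>bad_arcs t. prob_edge {} {} {z, w}))"
    unfolding sum_card_bad_arcs[symmetric] sum_distrib_left[symmetric] of_nat_mult by simp
  also have "\<dots> \<le> ?M * (card trees * (2 * card V / d * (1 + 2 / (d * t))))"
    unfolding bad_arcs_def by (intro mult_left_mono sum_bad_prob_edge_le t of_nat_0_le_iff)
  finally have B: "(\<Sum>T\<in>trees. \<Sum>\<rho>\<in>V. real (card {\<phi>\<in>?iso T \<rho>. \<not> good \<phi>})) \<le>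
      ?M * (card trees * (2 * card V / d * (1 + 2 / (d * t))))" .
  have "(\<Sum>T\<in>trees. \<Sum>\<rho>\<in>V. real (card (?iso T \<rho>))) =
     (\<Sum>T\<in>trees. \<Sum>\<rho>\<in>V. real (card {\<phi>\<in>?iso T \<rho>. good \<phi>})) +
     (\<Sum>T\<in>trees. \<Sum>\<rho>\<in>V. real (card {\<phi>\<in>?iso T \<rho>. \<not> good \<phi>}))"
    by (simp add: split sum.distrib)
  also have "\<dots> \<le> card V * d ^ (k - 1) * (card trees * ?Q) +
      ?M * (card trees * (2 * card V / d * (1 + 2 / (d * t))))"
    by (rule add_mono[OF G B])
  also have "\<dots> = card V * card trees * (d ^ (k - 1) * (\<Prod>s\<in>{1..<k}. contract_bound d r (sqrt t) s) * avoid_bound d k a +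
      real ?M * (2 / d * (1 + 2 / (d * t))))"
  proof -
    have "N * p * (K * (a * b)) + M * (K * (2 * N / \<delta> * c)) = N * K * (p * a * b + M * (2 / \<delta> * c))"
      for N p K a b M \<delta> c :: real by (simp add: algebra_simps)
    then show ?thesis unfolding of_nat_mult of_nat_numeral by simp
  qed
  finally show ?thesis .
qed

end

section \<open>Asymptotics of the bound\<close>

text \<open>The threshold \<open>d powr (-3/2)\<close> for the excess is \<open>o(1/d)\<close>, so good edges behave as in the complete
  graph, and of larger order than \<open>1/d\<^sup>2\<close>, the mean excess, so bad edges are rare.\<close>

definition exact_bound :: "nat \<Rightarrow> nat \<Rightarrow> nat \<Rightarrow> nat \<Rightarrow> real" where
  "exact_bound r k a d =
    d ^ (k - 1) * (\<Prod>s\<in>{1..<k}. contract_bound d r (sqrt (d powr (-3/2))) s) * avoid_bound d k a +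
      real (k ^ k * (\<Sum>j<r. k ^ j)) * (2 / d * (1 + 2 / (d * d powr (-3/2))))"

lemma prod_telescope: "k \<ge> 1 \<Longrightarrow> (\<Prod>s\<in>{1..<k}. 1 + 1 / real s) = k"
  by (induction k rule: nat_induct_at_least) (auto simp: atLeastLessThanSuc field_simps)

text \<open>The threshold enters under the square as \<open>2 * r * d^(-3/4)\<close>, which is small
  against the main term of order \<open>d^(-1/2)\<close>.\<close>

lemma contract_bound_limit:
  assumes "s \<ge> 1"
  shows "(\<lambda>d. real d * contract_bound d r (sqrt (d powr (-3/2))) s) \<longlonglongrightarrow> 1 + 1 / real s"
proof -
  define c where "c = 1 + 1 / real s"
  have "c > 0" by (simp add: c_def add_pos_nonneg)
  have "(\<lambda>d::nat. real d * (sqrt (c / real d + 4 / (real d)\<^sup>2) + 2 * real r * sqrt (real d powr (-3/2)))\<^sup>2) \<longlonglongrightarrow> c"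
    using \<open>c > 0\<close> by real_asymp (simp add: powr_half_sqrt)
  then show ?thesis by (simp add: contract_bound_def c_def)
qed

text \<open>Each summand \<open>1/m\<close> with \<open>m = N - j\<close> is at least
  \<open>ln (1 + 1/m)\<close>, and these logarithms telescope.\<close>

lemma harmonic_ge_ln:
  assumes "J \<le> N"
  shows "ln ((real N + 1) / (real N - real J + 1)) \<le> (\<Sum>j<J. 1 / (real N - real j))"
  using assms
proof (induction J)
  case (Suc J)
  define m where "m = real N - real J"
  have m: "m \<ge> 1" using Suc.prems by (simp add: m_def)
  have "ln ((real N + 1) / m) = ln ((real N + 1) / (m + 1)) + ln (1 + 1 / m)"
  proof -
    have "(real N + 1) / m = (real N + 1) / (m + 1) * (1 + 1 / m)"
    proof -
      have "1 + 1 / m = (m + 1) / m" "m + 1 \<noteq> 0" using m by (simp_all add: add_divide_distrib)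
      then show ?thesis by (simp only: times_divide_times_eq) simp
    qed
    moreover have pos: "(real N + 1) / (m + 1) > 0" "1 + 1 / m > 0" using m by (simp_all add: add_pos_pos)
    ultimately show ?thesis by (metis ln_mult_pos)
  qed
  also have "ln (1 + 1 / m) \<le> 1 / m" using m by (intro ln_add_one_self_le_self) simp
  also have "ln ((real N + 1) / (m + 1)) \<le> (\<Sum>j<J. 1 / (real N - real j))"
    using Suc by (simp add: m_def)
  finally show ?case by (simp add: m_def)
qed simp

text \<open>\<open>avoid_bound\<close> with its harmonic sum replaced by a logarithm. The first
  exponential collects the terms \<open>1/d\<close>, the second the terms from the boundary of the
  contracted set.\<close>

definition avoid_upper :: "real \<Rightarrow> real \<Rightarrow> real \<Rightarrow> real" where
  "avoid_upper k a d = exp (- (1 - 2 * k / d) * (a * (d - k) / d)) *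
     exp ((1 - 2 * k / d) * ln (((k - a) * d + a * k + 1) / (k * d + 1)))"

lemma avoid_bound_le:
  assumes k: "k \<ge> 1" "a \<le> k" and d: "2 * k \<le> d"
  shows "avoid_bound d k a \<le> avoid_upper (real k) (real a) (real d)"
proof -
  define J where "J = a * (d - k)"
  have d0: "d > 0" "d \<ge> k" using k d by auto
  have "J \<le> k * (d - k)" unfolding J_def using k by simp
  also have "\<dots> \<le> k * d" by simp
  finally have JN: "J \<le> k * d" .
  have rJ: "real J = a * (real d - k)" using d0 by (simp add: J_def of_nat_diff)
  let ?f = "1 - 2 * real k / d"
  have f: "?f \<ge> 0" using d d0 by (simp add: field_simps)
  have "(\<Sum>j<J. (1 / real d + 1 / (real (k * d) - real j)) * ?f) =
      (J / d + (\<Sum>j<J. 1 / (real (k * d) - real j))) * ?f"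
    by (simp add: sum.distrib flip: sum_distrib_right)
  also have "\<dots> \<ge> (J / d + ln ((real (k * d) + 1) / (real (k * d) - real J + 1))) * ?f"
    by (intro mult_right_mono add_left_mono harmonic_ge_ln JN f)
  finally have "avoid_bound d k a \<le>
      exp (- ((J / d + ln ((real (k * d) + 1) / (real (k * d) - real J + 1))) * ?f))"
    by (simp add: avoid_bound_def J_def)
  also have "ln ((real (k * d) + 1) / (real (k * d) - real J + 1)) =
      - ln ((real (k * d) - real J + 1) / (real (k * d) + 1))"
  proof -
    have "real (k * d) - real J + 1 > 0" using JN by (smt (verit) of_nat_mono)
    moreover have "real (k * d) + 1 > 0" by (simp add: add_nonneg_pos)
    ultimately show ?thesis by (simp add: ln_div)
  qed
  also have "real (k * d) - real J + 1 = (real k - a) * d + real a * k + 1"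
    unfolding rJ by (simp add: algebra_simps)
  finally have "avoid_bound d k a \<le>
      exp (- ((J / d + - ln (((real k - a) * d + real a * k + 1) / (real (k * d) + 1))) * ?f))" .
  moreover have "exp (- ((X + - L) * f)) = exp (- f * X) * exp (f * L)" for X L f :: real
    by (simp add: exp_add[symmetric] algebra_simps)
  ultimately show ?thesis unfolding avoid_upper_def rJ of_nat_mult by (simp only:)
qed

text \<open>For \<open>a = k\<close> the logarithm tends to minus infinity and the limit is 0: a
  ball in which every vertex is inner is a whole finite component, and such balls disappear.
  Otherwise the argument of the logarithm tends to \<open>(k - a) / k\<close>.\<close>

lemma avoid_upper_limit:
  assumes k: "k \<ge> 1" "a \<le> k"
  shows "(\<lambda>d::nat. avoid_upper (real k) (real a) (real d)) \<longlonglongrightarrow> exp (- real a) * (real (k - a) / k)"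
proof (cases "a = k")
  case True
  define K where "K = real k"
  define c where "c = K * K + 1"
  have pos: "K > 0" "c > 0" using k by (simp_all add: K_def c_def add_nonneg_pos)
  have 1: "(\<lambda>d::nat. exp (- (1 - 2 * K / d) * (K * (d - K) / d))) \<longlonglongrightarrow> exp (- K)"
    using pos by real_asymp
  have 2: "(\<lambda>d::nat. exp ((1 - 2 * K / d) * ln (c / (K * d + 1)))) \<longlonglongrightarrow> 0"
    using pos by real_asymp
  have "(\<lambda>d::nat. exp (- (1 - 2 * K / d) * (K * (d - K) / d)) *
     exp ((1 - 2 * K / d) * ln (c / (K * d + 1)))) \<longlonglongrightarrow> exp (- K) * 0"
    by (rule tendsto_mult[OF 1 2])
  then show ?thesis using True by (simp add: avoid_upper_def K_def c_def)
next
  case False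
  define K where "K = real k"
  define A where "A = real a"
  have KA: "K \<ge> 1" "A < K" "A \<ge> 0" using k False by (auto simp: K_def A_def)
  define B where "B = K - A"
  have B: "B > 0" using KA by (simp add: B_def)
  define C where "C = A * K + 1"
  have "(\<lambda>d::nat. (B * d + C) / (K * d + 1)) \<longlonglongrightarrow> B / K" using KA B by real_asymp (simp add: divide_inverse)
  then have 1: "(\<lambda>d::nat. ln ((B * d + C) / (K * d + 1))) \<longlonglongrightarrow> ln (B / K)"
    using KA B by (intro tendsto_ln) auto
  have 2: "(\<lambda>d::nat. 1 - 2 * K / d) \<longlonglongrightarrow> 1" by real_asymp
  have 3: "(\<lambda>d::nat. (real d - K) / d) \<longlonglongrightarrow> 1" by real_asymp
  have "(\<lambda>d::nat. exp (- ((1 - 2 * K / d) * (A * ((d - K) / d)))) *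
     exp ((1 - 2 * K / d) * ln ((B * d + C) / (K * d + 1)))) \<longlonglongrightarrow> exp (- (1 * (A * 1))) * exp (1 * ln (B / K))"
    by (intro tendsto_intros 1 2 3)
  also have "exp (- (1 * (A * 1))) * exp (1 * ln (B / K)) = exp (- A) * (B / K)"
    using KA B by simp
  also have "\<dots> = exp (- A) * (real (k - a) / K)" using k by (simp add: B_def K_def A_def of_nat_diff)
  finally have "(\<lambda>d::nat. exp (- ((1 - 2 * K / d) * (A * ((d - K) / d)))) *
     exp ((1 - 2 * K / d) * ln ((B * d + C) / (K * d + 1)))) \<longlonglongrightarrow> exp (- A) * (real (k - a) / K)" .
  moreover have "avoid_upper (real k) (real a) (real d) = exp (- ((1 - 2 * K / d) * (A * ((d - K) / d)))) *
     exp ((1 - 2 * K / d) * ln ((B * d + C) / (K * d + 1)))" for d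
  proof -
    have "- (1 - 2 * K / d) * (A * (d - K) / d) = - ((1 - 2 * K / d) * (A * ((d - K) / d)))"
      by (simp only: minus_mult_left times_divide_eq_right)
    moreover have "(K - A) * d + A * K + 1 = B * d + C" by (simp add: B_def C_def)
    ultimately show ?thesis unfolding avoid_upper_def K_def[symmetric] A_def[symmetric] by (simp only:)
  qed
  ultimately show ?thesis by (simp add: K_def A_def)
qed

text \<open>The \<open>k\<close> of \<open>prod_telescope\<close> cancels the denominator in the
  limit of \<open>avoid_upper\<close>. The contribution of bad edges is of order
  \<open>d^(-1/2)\<close>.\<close>

lemma exact_bound_asymp:
  assumes k: "k \<ge> 1" "a \<le> k"
  obtains U :: "nat \<Rightarrow> real"
  where "U \<longlonglongrightarrow> real (k - a) * exp (- real a)" "\<And>d. 2 * k \<le> d \<Longrightarrow> exact_bound r k a d \<le> U d"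
proof -
  define M where "M = real (k ^ k * (\<Sum>j<r. k ^ j))"
  define U where "U d = (\<Prod>s\<in>{1..<k}. real d * contract_bound d r (sqrt (d powr (-3/2))) s) *
    avoid_upper (real k) (real a) (real d) + M * (2 / d * (1 + 2 / (d * d powr (-3/2))))" for d :: nat
  have 0: "(\<lambda>d::nat. 2 / d * (1 + 2 / (real d * d powr (-3/2)))) \<longlonglongrightarrow> 0" by real_asymp
  have "U \<longlonglongrightarrow> (\<Prod>s\<in>{1..<k}. 1 + 1 / real s) * (exp (- real a) * (real (k - a) / k)) + M * 0"
    unfolding U_def
    by (intro tendsto_add tendsto_mult tendsto_prod avoid_upper_limit k tendsto_const 0 contract_bound_limit) auto
  also have "(\<Prod>s\<in>{1..<k}. 1 + 1 / real s) * (exp (- real a) * (real (k - a) / k)) + M * 0 =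
      real (k - a) * exp (- real a)" unfolding prod_telescope[OF k(1)] using k by simp
  finally have lim: "U \<longlonglongrightarrow> real (k - a) * exp (- real a)" .
  have "exact_bound r k a d \<le> U d" if d: "2 * k \<le> d" for d
  proof -
    have "real d ^ (k - 1) * (\<Prod>s\<in>{1..<k}. contract_bound d r (sqrt (d powr (-3/2))) s) =
       (\<Prod>s\<in>{1..<k}. real d * contract_bound d r (sqrt (d powr (-3/2))) s)"
      by (simp add: prod.distrib)
    moreover have "(\<Prod>s\<in>{1..<k}. real d * contract_bound d r (sqrt (d powr (-3/2))) s) \<ge> 0"
      by (intro prod_nonneg) (auto simp: contract_bound_def)
    ultimately show ?thesis using avoid_bound_le[OF k d]
      by (simp add: exact_bound_def U_def M_def mult_left_mono)
  qed
  then show ?thesis using lim that by blast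
qed

section \<open>The uniform spanning tree seen from a uniform vertex\<close>

text \<open>The expectation of \<open>f\<close> at a uniform tree and a uniform root, as a plain
  double sum to which counting and mass transport apply directly.\<close>

definition root_sum :: "'a graph \<Rightarrow> ('a rgraph \<Rightarrow> real) \<Rightarrow> real" where
  "root_sum G f = (\<Sum>T\<in>finite_conn_graph.trees (verts G) (edges G). \<Sum>\<rho>\<in>verts G. f ((verts G, T), \<rho>))
     / (card (verts G) * card (finite_conn_graph.trees (verts G) (edges G)))"

lemma finite_conn_graphI:
  assumes "simple_graph G" "finite (verts G)" "gconnected G"
  shows "finite_conn_graph (verts G) (edges G)"
  using assms conn_adj[of "edges G" "verts G"]
  by unfold_locales (auto simp: simple_graph_def gconnected_def)

lemma spanning_trees_eq:
  assumes "simple_graph G" "finite (verts G)" "gconnected G"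
  shows "spanning_trees G = Pair (verts G) ` finite_conn_graph.trees (verts G) (edges G)"
proof -
  interpret finite_conn_graph "verts G" "edges G" using finite_conn_graphI[OF assms] .
  have "is_tree (verts G, T) \<longleftrightarrow> bridges T \<and> (\<forall>u\<in>verts G. \<forall>v\<in>verts G. (u, v) \<in> conn T)"
    if "T \<subseteq> edges G" for T
    using bridges_iff_no_gcycle[of T "verts G"] that edgeD V_nonempty conn_adj[of T "verts G"]
    by (auto simp: is_tree_def gconnected_def)
  then show ?thesis
    unfolding spanning_trees_def trees_def by (auto simp: image_iff)
qed

text \<open>All spanning trees have the same vertex set, so tree and root are independent, and a
  product of uniform laws is uniform on the product set.\<close>

lemma expectation_uniform_root:
  fixes f :: "'a rgraph \<Rightarrow> real"
  assumes G: "simple_graph G" "finite (verts G)" "gconnected G"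
  shows "measure_pmf.expectation (uniform_root (ust G)) f = root_sum G f"
proof -
  interpret finite_conn_graph "verts G" "edges G" using finite_conn_graphI[OF G] .
  let ?P = "Pair (verts G) ` trees \<times> verts G"
  have fin: "finite (Pair (verts G) ` trees)" "Pair (verts G) ` trees \<noteq> {}"
    using finite_trees trees_nonempty by auto
  have "uniform_root (ust G) = do {H \<leftarrow> pmf_of_set (Pair (verts G) ` trees);
      \<rho> \<leftarrow> pmf_of_set (verts G); return_pmf (H, \<rho>)}"
    unfolding uniform_root_def ust_def spanning_trees_eq[OF G]
    by (intro bind_pmf_cong refl) (use fin in auto)
  also have "\<dots> = pair_pmf (pmf_of_set (Pair (verts G) ` trees)) (pmf_of_set (verts G))"
    by (simp add: pair_pmf_def)
  also have "\<dots> = pmf_of_set ?P"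
  proof (rule pmf_eqI)
    fix x show "pmf (pair_pmf (pmf_of_set (Pair (verts G) ` trees)) (pmf_of_set (verts G))) x = pmf (pmf_of_set ?P) x"
      using fin finite_V V_nonempty trees_nonempty
      by (cases x) (auto simp: pmf_pair indicator_def card_cartesian_product)
  qed
  finally have "measure_pmf.expectation (uniform_root (ust G)) f = (\<Sum>x\<in>?P. f x) / card ?P"
    using fin finite_V V_nonempty trees_nonempty by (simp add: integral_pmf_of_set)
  also have "(\<Sum>x\<in>?P. f x) = (\<Sum>T\<in>trees. \<Sum>\<rho>\<in>verts G. f ((verts G, T), \<rho>))"
    by (simp add: sum.cartesian_product' sum.reindex inj_on_def)
  also have "card ?P = card trees * card (verts G)"
    by (simp add: card_cartesian_product card_image inj_on_def)
  finally show ?thesis by (simp add: root_sum_def mult.commute)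
qed

section \<open>The space of rooted graphs\<close>

lemma iso_class_rep:
  assumes "rgraph X"
  obtains Y where "rgraph Y" "rgraph_iso X Y" "iso_class X = abs_gbullet Y"
  using someI_ex[OF ex_nat_rgraph_iso[OF assms]] unfolding iso_class_def by blast

lemma abs_gbullet_eq_iff:
  assumes "rgraph Y" "rgraph Z"
  shows "abs_gbullet Y = abs_gbullet Z \<longleftrightarrow> rgraph_iso Y Z"
  using Quotient_rel_abs2[OF Quotient_gbullet] Quotient_rel[OF Quotient_gbullet, of Y Z] assms
  by (metis rgraph_equiv_def rgraph_iso_refl)

lemma iso_class_eq_iff:
  fixes X :: "'a rgraph" and X' :: "'b rgraph"
  assumes "rgraph X" "rgraph X'"
  shows "iso_class X = iso_class X' \<longleftrightarrow> rgraph_iso X X'"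
proof -
  obtain Y where Y: "rgraph Y" "rgraph_iso X Y" "iso_class X = abs_gbullet Y"
    using iso_class_rep[OF assms(1)] .
  obtain Y' where Y': "rgraph Y'" "rgraph_iso X' Y'" "iso_class X' = abs_gbullet Y'"
    using iso_class_rep[OF assms(2)] .
  have "iso_class X = iso_class X' \<longleftrightarrow> rgraph_iso Y Y'"
    unfolding Y(3) Y'(3) by (rule abs_gbullet_eq_iff[OF Y(1) Y'(1)])
  also have "\<dots> \<longleftrightarrow> rgraph_iso X X'"
  proof
    assume "rgraph_iso Y Y'"
    then have "rgraph_iso X Y'" using Y(2) rgraph_iso_trans by blast
    then show "rgraph_iso X X'" using rgraph_iso_sym[OF assms(2) Y'(2)] rgraph_iso_trans by blast
  next
    assume "rgraph_iso X X'"
    then have "rgraph_iso X Y'" using Y'(2) rgraph_iso_trans by blast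
    then show "rgraph_iso Y Y'" using rgraph_iso_sym[OF assms(1) Y(2)] rgraph_iso_trans by blast
  qed
  finally show ?thesis .
qed

lemma gball_abs: "rgraph Y \<Longrightarrow> gball r (abs_gbullet Y) = abs_gbullet (rball r Y)"
  by (rule gball.abs_eq) (simp add: rgraph_equiv_def rgraph_iso_refl)

lemma iso_class_nat: "rgraph Y \<Longrightarrow> iso_class Y = abs_gbullet Y"
  by (metis abs_gbullet_eq_iff iso_class_rep rgraph_iso_sym)

lemma gball_iso_class:
  assumes "rgraph X" shows "gball r (iso_class X) = iso_class (rball r X)"
proof -
  obtain Y where Y: "rgraph Y" "rgraph_iso X Y" "iso_class X = abs_gbullet Y"
    using iso_class_rep[OF assms(1)] .
  have "gball r (iso_class X) = iso_class (rball r Y)"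
    unfolding Y(3) gball_abs[OF Y(1)] by (rule iso_class_nat[OF rgraph_rball[OF Y(1)], symmetric])
  also have "\<dots> = iso_class (rball r X)"
    using iso_class_eq_iff[OF rgraph_rball[OF assms, of r] rgraph_rball[OF Y(1), of r]]
      rgraph_iso_rball[OF assms Y(1,2), of r] by simp
  finally show ?thesis .
qed

text \<open>Representatives on an initial segment of the naturals. For bounded \<open>N\<close>
  there are finitely many, which supplies the finite sets for tightness.\<close>

definition nat_graph :: "nat \<Rightarrow> nat set set \<Rightarrow> nat \<Rightarrow> gbullet" where
  "nat_graph N F v = iso_class (({..<N}, F), v)"

lemma iso_class_finite_graph:
  fixes X :: "'a rgraph"
  assumes X: "rgraph X" and fin: "finite (verts (fst X))"
  obtains F v where "F \<subseteq> Pow {..<card (verts (fst X))}" "v < card (verts (fst X))"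
    "iso_class X = nat_graph (card (verts (fst X))) F v"
proof -
  note X' = rgraphD[OF X]
  obtain h where h: "bij_betw h (verts (fst X)) {0..<card (verts (fst X))}"
    using ex_bij_betw_finite_nat[OF fin] by blast
  let ?N = "card (verts (fst X))"
  have hN: "bij_betw h (verts (fst X)) {..<?N}" using h by (simp add: atLeast0LessThan)
  have inj: "inj_on h (verts (fst X))" using hN by (rule bij_betw_imp_inj_on)
  define F where "F = (`) h ` edges (fst X)"
  define v where "v = h (snd X)"
  let ?Y = "(({..<?N}, F), v)"
  have sub: "e \<subseteq> verts (fst X)" if "e \<in> edges (fst X)" for e using that X'(1) by (auto simp: simple_graph_def)
  have edge: "{u, w} \<in> edges (fst X) \<longleftrightarrow> {h u, h w} \<in> F"
    if uv: "u \<in> verts (fst X)" "w \<in> verts (fst X)" for u w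
  proof
    assume "{h u, h w} \<in> F"
    then obtain e where e: "e \<in> edges (fst X)" "h ` {u, w} = h ` e" by (auto simp: F_def)
    then have "{u, w} = e" using inj_on_image_eq_iff[OF inj, of "{u, w}" e] uv sub[OF e(1)] by simp
    then show "{u, w} \<in> edges (fst X)" using e by simp
  next
    assume "{u, w} \<in> edges (fst X)"
    then have "h ` {u, w} \<in> F" unfolding F_def by (simp del: image_insert)
    then show "{h u, h w} \<in> F" by simp
  qed
  have FP: "F \<subseteq> Pow {..<?N}" using bij_betwE[OF hN] sub by (fastforce simp: F_def)
  have vN: "v < ?N" using bij_betwE[OF hN] X'(4) by (simp add: v_def)
  have iso: "rgraph_iso X ?Y" unfolding rgraph_iso_iff iso_map_def
    using hN edge by (intro exI[of _ h]) (auto simp: v_def)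
  have "rgraph ?Y"
  proof (rule rgraphI)
    show "simple_graph (fst ?Y)" unfolding simple_graph_def
    proof
      fix e assume "e \<in> edges (fst ?Y)"
      then obtain e' where e': "e' \<in> edges (fst X)" "e = h ` e'" by (auto simp: F_def)
      have "card e = card e'" using e'(2) inj sub[OF e'(1)] by (metis card_image inj_on_subset)
      moreover have "card e' = 2" using X'(1) e'(1) by (simp add: simple_graph_def)
      moreover have "e \<subseteq> verts (fst ?Y)" using FP \<open>e \<in> edges (fst ?Y)\<close> unfolding fst_conv snd_conv by blast
      ultimately show "e \<subseteq> verts (fst ?Y) \<and> card e = 2" by simp
    qed
    have adj_step: "(h u, h w) \<in> adj (fst ?Y)" if "(u, w) \<in> adj (fst X)" for u w
      using that edge adj_verts[OF X'(1) that] by (simp add: adj_iff)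
    have walk: "(h u, h w) \<in> (adj (fst ?Y))\<^sup>*" if "(u, w) \<in> (adj (fst X))\<^sup>*" for u w
      using that
    proof induction
      case (step y z)
      show ?case by (rule rtrancl_into_rtrancl[OF step.IH]) (rule adj_step[OF step.hyps(2)])
    qed simp
    have surj: "{..<?N} = h ` verts (fst X)" using hN by (simp add: bij_betw_def)
    have "\<forall>a\<in>h ` verts (fst X). \<forall>b\<in>h ` verts (fst X). (a, b) \<in> (adj (fst ?Y))\<^sup>*"
      using walk X'(2) by (auto simp: gconnected_def)
    moreover have "h ` verts (fst X) \<noteq> {}" using X'(4) by auto
    ultimately show "gconnected (fst ?Y)" unfolding gconnected_def fst_conv surj by blast
    show "locally_finite (fst ?Y)" unfolding locally_finite_def nbrs_def
      using FP by (auto intro!: finite_subset[of _ "{..<?N}"])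
  qed (use vN in simp)
  then have "iso_class X = iso_class ?Y" using iso_class_eq_iff[OF X] iso by blast
  then show ?thesis using that[OF FP vN] by (simp add: nat_graph_def)
qed

lemma finite_classes: "finite ((\<lambda>(N, F, v). nat_graph N F v) ` (SIGMA N:{..K}. Pow (Pow {..<N}) \<times> {..<N}))"
  by (intro finite_imageI finite_SigmaI finite_cartesian_product) auto

section \<open>Topology and measurability through the ball maps\<close>

lemma open_gball_fibre: "open {y. gball n y = c}"
  unfolding open_dist
proof clarify
  fix y assume c: "c = gball n y"
  show "\<exists>e>0. \<forall>z. dist z y < e \<longrightarrow> z \<in> {z. gball n z = gball n y}"
  proof (intro exI[of _ "(1/2) ^ n"] conjI allI impI)
    fix z assume "dist z y < (1/2) ^ n"
    then have "gball (Suc n) z = gball (Suc n) y" by (simp add: dist_gbullet_less_iff)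
    then show "z \<in> {z. gball n z = gball n y}" using gball_eq_mono[of "Suc n" z y n] by simp
  qed simp
qed

lemma open_gball_iff:
  assumes "open U"
  shows "x \<in> U \<longleftrightarrow> (\<exists>n. {y. gball n y = gball n x} \<subseteq> U)"
proof
  assume "x \<in> U"
  then obtain e where e: "e > 0" "\<And>y. dist y x < e \<Longrightarrow> y \<in> U" using assms unfolding open_dist by blast
  obtain n where n: "(1/2) ^ n < e" using real_arch_pow_inv[OF e(1), of "1/2"] by auto
  have "{y. gball (Suc n) y = gball (Suc n) x} \<subseteq> U"
    using e(2) n dist_gbullet_less_iff by (smt (verit) mem_Collect_eq subsetI)
  then show "\<exists>n. {y. gball n y = gball n x} \<subseteq> U" by blast
qed auto

text \<open>Since \<open>gball n\<close> is locally constant, every function of it is continuous; in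
  particular the indicator of a ball class is an admissible test function.\<close>

lemma continuous_gball_fun:
  fixes g :: "gbullet \<Rightarrow> 'b :: topological_space"
  shows "continuous_on UNIV (\<lambda>x. g (gball n x))"
  unfolding continuous_on_open_vimage[OF open_UNIV]
proof (intro allI impI)
  fix B :: "'b set"
  have "(\<lambda>x. g (gball n x)) -` B \<inter> UNIV = (\<Union>c\<in>g -` B. {y. gball n y = c})" by auto
  then show "open ((\<lambda>x. g (gball n x)) -` B \<inter> UNIV)" using open_gball_fibre by auto
qed

lemma gball_measurable [measurable]: "gball r \<in> borel_measurable borel"
  using continuous_gball_fun[of "\<lambda>x. x" r] by (rule borel_measurable_continuous_onI)

lemma sets_gball_fibre: "{y. gball n y = c} \<in> sets borel"
  by (rule borel_open[OF open_gball_fibre])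

text \<open>An open set is a union over \<open>n\<close> of preimages under \<open>gball n\<close>
  of sets of classes. Measurability into \<open>count_space UNIV\<close> handles any set of classes,
  so only the countable union over the radii remains.\<close>

lemma borel_measurable_gbulletI:
  assumes f: "\<And>n. (\<lambda>x. gball n (f x)) \<in> measurable M (count_space UNIV)"
  shows "f \<in> borel_measurable M"
proof (rule borel_measurableI)
  fix U :: "gbullet set" assume U: "open U"
  define C where "C n = gball n ` {z. {y. gball n y = gball n z} \<subseteq> U}" for n
  have "gball n x \<in> C n \<longleftrightarrow> {y. gball n y = gball n x} \<subseteq> U" for n x
  proof
    assume "gball n x \<in> C n"
    then obtain z where z: "gball n x = gball n z" "{y. gball n y = gball n z} \<subseteq> U" by (auto simp: C_def)
    then show "{y. gball n y = gball n x} \<subseteq> U" by simp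
  qed (auto simp: C_def)
  then have "x \<in> U \<longleftrightarrow> (\<exists>n. gball n x \<in> C n)" for x
    unfolding open_gball_iff[OF U, of x] by simp
  then have "f -` U \<inter> space M = (\<Union>n. (\<lambda>x. gball n (f x)) -` C n \<inter> space M)" by auto
  also have "\<dots> \<in> sets M" using measurable_sets[OF f] by (intro sets.countable_UN) auto
  finally show "f -` U \<inter> space M \<in> sets M" .
qed

section \<open>The Galton--Watson measure\<close>

text \<open>The labelling \<open>g\<close> is arbitrary because survival is considered, through
  \<open>sets_survives\<close>, for whole trees, for shifted subtrees and on subproducts of the
  coordinates.\<close>

lemma sets_gw_verts:
  assumes g: "\<And>w. (\<lambda>x. g x w) \<in> measurable N (count_space UNIV)"
  shows "{x \<in> space N. w \<in> gw_verts (g x)} \<in> sets N"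
proof -
  have "{x \<in> space N. w ! i < g x v} \<in> sets N" for i v
  proof -
    have "{x \<in> space N. w ! i < g x v} = (\<lambda>x. g x v) -` {w ! i<..} \<inter> space N" by auto
    then show ?thesis using measurable_sets[OF g[of v], of "{w ! i<..}"] by simp
  qed
  then show ?thesis unfolding gw_verts_iff by (intro sets.sets_Collect_countable_All sets.sets_Collect_imp) auto
qed

lemma sets_survives:
  assumes g: "\<And>w. (\<lambda>x. g x w) \<in> measurable N (count_space UNIV)"
  shows "{x \<in> space N. survives m (g x)} \<in> sets N"
proof -
  have "{x \<in> space N. survives m (g x)} = {x \<in> space N. \<exists>w. w \<in> gw_verts (g x) \<and> length w = m}"
    by (auto simp: survives_def)
  also have "\<dots> \<in> sets N"
    by (intro sets.sets_Collect_countable_Ex sets.sets_Collect_conj sets_gw_verts g) auto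
  finally show ?thesis .
qed

lemma space_gw_space [simp]: "space (gw_space \<xi>) = UNIV"
  by (simp add: gw_space_def space_PiM)

lemma prob_space_gw_space: "prob_space (gw_space \<xi>)"
  unfolding gw_space_def by (intro prob_space_PiM prob_space_measure_pmf)

lemma measurable_PiM_pmf_component:
  "w \<in> K \<Longrightarrow> (\<lambda>k. k w) \<in> measurable (PiM K (\<lambda>_. measure_pmf \<xi>)) (count_space UNIV)"
  using measurable_component_singleton[of w K "\<lambda>_. measure_pmf \<xi>"]
  by (simp cong: measurable_cong_sets)

lemma measurable_gw_component: "(\<lambda>k. k w) \<in> measurable (gw_space \<xi>) (count_space UNIV)"
  unfolding gw_space_def by (rule measurable_PiM_pmf_component) simp

text \<open>The ball is a function of its finite word set by \<open>rball_gw_eq\<close>, and there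
  are countably many such sets, so singletons suffice.\<close>

lemma bverts_gw_measurable:
  "(\<lambda>k. bverts n (gw_tree k)) \<in> measurable (gw_space \<xi>) (count_space {W. finite W})"
proof (subst measurable_count_space_eq_countable)
  show "countable {W :: nat list set. finite W}" by (rule countable_Collect_finite)
  have "(\<lambda>k. bverts n (gw_tree k)) -` {W} \<inter> space (gw_space \<xi>) \<in> sets (gw_space \<xi>)" for W
  proof -
    have "(\<lambda>k. bverts n (gw_tree k)) -` {W} \<inter> space (gw_space \<xi>) =
       {k \<in> space (gw_space \<xi>). \<forall>w. (w \<in> gw_verts k \<and> length w \<le> n) = (w \<in> W)}"
      unfolding bverts_gw_tree by auto
    also have "\<dots> \<in> sets (gw_space \<xi>)"
    proof (rule sets.sets_Collect_countable_All)
      fix w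
      let ?S = "{k \<in> space (gw_space \<xi>). w \<in> gw_verts k}"
      have S: "?S \<in> sets (gw_space \<xi>)"
        by (rule sets_gw_verts[of "\<lambda>k. k" "gw_space \<xi>" w]) (rule measurable_gw_component)
      have eq: "{k \<in> space (gw_space \<xi>). (w \<in> gw_verts k \<and> length w \<le> n) = (w \<in> W)} =
        (if length w \<le> n then if w \<in> W then ?S else space (gw_space \<xi>) - ?S
         else if w \<in> W then {} else space (gw_space \<xi>))" by auto
      show "{k \<in> space (gw_space \<xi>). (w \<in> gw_verts k \<and> length w \<le> n) = (w \<in> W)} \<in> sets (gw_space \<xi>)"
        unfolding eq using S sets.compl_sets[OF S] by (simp del: space_gw_space)
    qed
    finally show ?thesis .
  qed
  then show "(\<lambda>k. bverts n (gw_tree k)) \<in> space (gw_space \<xi>) \<rightarrow> {W. finite W} \<and>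
    (\<forall>W\<in>{W. finite W}. (\<lambda>k. bverts n (gw_tree k)) -` {W} \<inter> space (gw_space \<xi>) \<in> sets (gw_space \<xi>))"
    using finite_bverts_gw by auto
qed

lemma rball_gw_eq:
  "rball n (gw_tree k) = (\<lambda>W. ((W, {{butlast w, w} |w. w \<in> W \<and> w \<noteq> []}), [])) (bverts n (gw_tree k))"
proof -
  have "{e \<in> edges (fst (gw_tree k)). e \<subseteq> bverts n (gw_tree k)} =
      {{butlast w, w} |w. w \<in> bverts n (gw_tree k) \<and> w \<noteq> []}" (is "?L = ?R")
  proof
    show "?L \<subseteq> ?R"
    proof
      fix e assume e: "e \<in> ?L"
      then obtain w i where "e = {w, w @ [i]}" by (auto simp: gw_tree_def)
      then show "e \<in> ?R" using e by (intro CollectI exI[of _ "w @ [i]"]) auto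
    qed
    show "?R \<subseteq> ?L"
      using rball_gw_edge_iff[of _ _ n k] by auto
  qed
  then show ?thesis by (simp add: rball_eq)
qed

lemma rball_gw_measurable:
  "(\<lambda>k. F (rball n (gw_tree k))) \<in> measurable (gw_space \<xi>) (count_space UNIV)"
  unfolding rball_gw_eq
  by (rule measurable_compose[OF bverts_gw_measurable]) simp

lemma gw_class_measurable: "(\<lambda>k. iso_class (gw_tree k)) \<in> borel_measurable (gw_space \<xi>)"
  by (rule borel_measurable_gbulletI) (simp add: gball_iso_class[OF rgraph_gw_tree] rball_gw_measurable)

section \<open>Branching property and survival probabilities\<close>

definition surv :: "nat pmf \<Rightarrow> nat \<Rightarrow> real" where
  "surv \<xi> m = measure (gw_space \<xi>) {k. survives m k}"

lemma sets_gw_survives: "{k. survives m k} \<in> sets (gw_space \<xi>)"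
  using sets_survives[of "\<lambda>k. k" "gw_space \<xi>" m] measurable_gw_component by simp

text \<open>The labels below \<open>u\<close> are an injective reindexing of the product measure,
  hence again independent with the same law.\<close>

lemma survives_shift_prob:
  "{k. survives m (\<lambda>x. k (u @ x))} \<in> sets (gw_space \<xi>)"
  "measure (gw_space \<xi>) {k. survives m (\<lambda>x. k (u @ x))} = surv \<xi> m"
proof -
  show "{k. survives m (\<lambda>x. k (u @ x))} \<in> sets (gw_space \<xi>)"
    using sets_survives[of "\<lambda>k x. k (u @ x)" "gw_space \<xi>" m] measurable_gw_component by simp
  have "distr (gw_space \<xi>) (gw_space \<xi>) (\<lambda>k. \<lambda>x\<in>UNIV. k (u @ x)) = gw_space \<xi>"
    unfolding gw_space_def
    by (rule distr_PiM_reindex[where K = UNIV and f = "\<lambda>x. u @ x" and I = UNIV])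
      (auto simp: prob_space_measure_pmf inj_on_def)
  then have *: "distr (gw_space \<xi>) (gw_space \<xi>) (\<lambda>k x. k (u @ x)) = gw_space \<xi>"
    by (simp add: restrict_def)
  have m: "(\<lambda>k x. k (u @ x)) \<in> measurable (gw_space \<xi>) (gw_space \<xi>)"
    unfolding gw_space_def by (rule measurable_PiM_single') (auto simp: measurable_component_singleton)
  have "surv \<xi> m = measure (distr (gw_space \<xi>) (gw_space \<xi>) (\<lambda>k x. k (u @ x))) {k. survives m k}"
    unfolding * surv_def ..
  also have "\<dots> = measure (gw_space \<xi>) ((\<lambda>k x. k (u @ x)) -` {k. survives m k} \<inter> space (gw_space \<xi>))"
    by (rule measure_distr[OF m sets_gw_survives])
  also have "(\<lambda>k x. k (u @ x)) -` {k. survives m k} \<inter> space (gw_space \<xi>) = {k. survives m (\<lambda>x. k (u @ x))}"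
    by auto
  finally show "measure (gw_space \<xi>) {k. survives m (\<lambda>x. k (u @ x))} = surv \<xi> m" by simp
qed

lemma sets_gw_value: "{k. k w = n} \<in> sets (gw_space \<xi>)"
  using measurable_sets[OF measurable_gw_component[of w \<xi>], of "{n}"] by (simp add: vimage_def)

lemma gw_value_prob: "measure (gw_space \<xi>) {k. k w = n} = pmf \<xi> n"
proof -
  have "distr (gw_space \<xi>) (measure_pmf \<xi>) (\<lambda>k. k w) = measure_pmf \<xi>"
    unfolding gw_space_def by (rule distr_PiM_component) (auto simp: prob_space_measure_pmf)
  then have "pmf \<xi> n = measure (distr (gw_space \<xi>) (measure_pmf \<xi>) (\<lambda>k. k w)) {n}"
    by (simp add: measure_pmf_single)
  also have "\<dots> = measure (gw_space \<xi>) ((\<lambda>k. k w) -` {n} \<inter> space (gw_space \<xi>))"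
    by (rule measure_distr) (simp_all add: gw_space_def measurable_component_singleton)
  finally show ?thesis by (simp add: vimage_def)
qed

lemma gw_indep_coordinates:
  "prob_space.indep_vars (gw_space \<xi>) (\<lambda>_. measure_pmf \<xi>) (\<lambda>w k. k w) UNIV"
proof -
  interpret prob_space "gw_space \<xi>" by (rule prob_space_gw_space)
  have rv: "(\<lambda>k. k w) \<in> measurable (gw_space \<xi>) (measure_pmf \<xi>)" for w
    by (simp add: gw_space_def measurable_component_singleton)
  have d: "distr (gw_space \<xi>) (measure_pmf \<xi>) (\<lambda>k. k w) = measure_pmf \<xi>" for w
    unfolding gw_space_def by (rule distr_PiM_component) (auto simp: prob_space_measure_pmf)
  have "distr (gw_space \<xi>) (PiM UNIV (\<lambda>_. measure_pmf \<xi>)) (\<lambda>k. \<lambda>w\<in>UNIV. k w) = gw_space \<xi>"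
    using distr_id2[of "gw_space \<xi>" "PiM UNIV (\<lambda>_. measure_pmf \<xi>)"] by (simp add: restrict_def gw_space_def)
  then have "distr (gw_space \<xi>) (PiM UNIV (\<lambda>_. measure_pmf \<xi>)) (\<lambda>k. \<lambda>w\<in>UNIV. k w) =
      PiM UNIV (\<lambda>w. distr (gw_space \<xi>) (measure_pmf \<xi>) (\<lambda>k. k w))"
    unfolding d by (simp only: gw_space_def)
  then show ?thesis by (subst indep_vars_iff_distr_eq_PiM[OF _ rv]) (rule UNIV_not_empty)
qed

text \<open>The labels at the words of \<open>I\<close> and the families below the words of
  \<open>L\<close> occupy pairwise disjoint sets of coordinates, so the events are
  independent.\<close>

lemma gw_prob_extinct:
  fixes I L :: "nat list set"
  assumes fin: "finite I" "finite L"
    and disj: "\<And>u u' x x'. u \<in> L \<Longrightarrow> u' \<in> L \<Longrightarrow> u @ x = u' @ x' \<Longrightarrow> u = u'"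
    and IL: "\<And>u x. u \<in> L \<Longrightarrow> u @ x \<notin> I"
  shows "measure (gw_space \<xi>) {k. (\<forall>w\<in>I. k w = \<kappa> w) \<and> (\<forall>u\<in>L. \<not> survives m (\<lambda>x. k (u @ x)))} =
    (\<Prod>w\<in>I. pmf \<xi> (\<kappa> w)) * (1 - surv \<xi> m) ^ card L"
proof -
  interpret prob_space "gw_space \<xi>" by (rule prob_space_gw_space)
  \<comment> \<open>One index for both kinds of blocks: \<open>Inl w\<close> reads the single label
    at \<open>w\<close>, \<open>Inr u\<close> all labels below \<open>u\<close>.\<close>
  define J where "J = Inl ` I \<union> (Inr ` L :: (nat list + nat list) set)"
  define K where "K j = (case j of Inl w \<Rightarrow> {w} | Inr u \<Rightarrow> range (\<lambda>x. u @ x))" for j :: "nat list + nat list"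
  define A where "A j = (case j of Inl w \<Rightarrow> {f \<in> space (PiM (K j) (\<lambda>_. measure_pmf \<xi>)). f w = \<kappa> w}
     | Inr u \<Rightarrow> {f \<in> space (PiM (K j) (\<lambda>_. measure_pmf \<xi>)). \<not> survives m (\<lambda>x. f (u @ x))})" for j
  let ?X = "\<lambda>j \<omega>. restrict (\<lambda>i. \<omega> i) (K j)"
  have dis: "disjoint_family_on K J"
    unfolding disjoint_family_on_def J_def K_def using disj IL by (auto; metis)
  have ind: "indep_vars (\<lambda>j. PiM (K j) (\<lambda>_. measure_pmf \<xi>)) ?X J"
    by (rule indep_vars_restrict[OF gw_indep_coordinates _ dis]) simp
  have meas: "A j \<in> sets (PiM (K j) (\<lambda>_. measure_pmf \<xi>))" if "j \<in> J" for j
  proof (cases j)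
    case (Inl w)
    have "A j = (\<lambda>f. f w) -` {\<kappa> w} \<inter> space (PiM (K j) (\<lambda>_. measure_pmf \<xi>))" by (auto simp: A_def Inl)
    then show ?thesis
      using measurable_sets[OF measurable_PiM_pmf_component[of w "K j" \<xi>], of "{\<kappa> w}"] by (simp add: K_def Inl)
  next
    case (Inr u)
    have "{f \<in> space (PiM (K j) (\<lambda>_. measure_pmf \<xi>)). survives m (\<lambda>x. f (u @ x))}
        \<in> sets (PiM (K j) (\<lambda>_. measure_pmf \<xi>))"
      by (rule sets_survives, rule measurable_PiM_pmf_component) (simp add: K_def Inr)
    then show ?thesis by (simp add: A_def Inr sets.sets_Collect_neg)
  qed
  have pre: "?X j -` A j \<inter> space (gw_space \<xi>) = (case j of Inl w \<Rightarrow> {k. k w = \<kappa> w}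
     | Inr u \<Rightarrow> {k. \<not> survives m (\<lambda>x. k (u @ x))})" for j
    by (cases j) (auto simp: A_def K_def space_PiM)
  have prob_j: "prob (?X j -` A j \<inter> space (gw_space \<xi>)) = (case j of Inl w \<Rightarrow> pmf \<xi> (\<kappa> w) | Inr u \<Rightarrow> 1 - surv \<xi> m)" for j
  proof (cases j)
    case (Inr u)
    have "prob (space (gw_space \<xi>) - {k. survives m (\<lambda>x. k (u @ x))}) = 1 - surv \<xi> m"
      using prob_compl[OF survives_shift_prob(1)[of m u \<xi>]] survives_shift_prob(2)[of \<xi> m u] by simp
    moreover have "space (gw_space \<xi>) - {k. survives m (\<lambda>x. k (u @ x))} = {k. \<not> survives m (\<lambda>x. k (u @ x))}" by auto
    ultimately show ?thesis unfolding pre by (simp add: Inr)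
  next
    case (Inl w)
    then show ?thesis unfolding pre by (simp add: gw_value_prob)
  qed
  let ?E = "{k. (\<forall>w\<in>I. k w = \<kappa> w) \<and> (\<forall>u\<in>L. \<not> survives m (\<lambda>x. k (u @ x)))}"
  show ?thesis
  proof (cases "J = {}")
    case True
    then have "I = {}" "L = {}" by (auto simp: J_def)
    then show ?thesis using prob_space by simp
  next
    case False
    have "?E = (\<Inter>j\<in>J. ?X j -` A j \<inter> space (gw_space \<xi>))" unfolding pre by (rule set_eqI) (simp add: J_def ball_Un)
    then have "prob ?E = (\<Prod>j\<in>J. prob (?X j -` A j \<inter> space (gw_space \<xi>)))"
      using indep_varsD[OF ind False, of A] fin meas by (simp add: J_def)
    also have "\<dots> = (\<Prod>w\<in>I. pmf \<xi> (\<kappa> w)) * (\<Prod>u\<in>L. 1 - surv \<xi> m)"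
      unfolding prob_j J_def using fin
      by (subst prod.union_disjoint) (auto simp: prod.reindex)
    finally show ?thesis by simp
  qed
qed

section \<open>The conditioned Galton--Watson tree\<close>

lemma gw_verts_append: "u @ x \<in> gw_verts k \<longleftrightarrow> u \<in> gw_verts k \<and> x \<in> gw_verts (\<lambda>y. k (u @ y))"
proof (induction x rule: rev_induct)
  case (snoc i x)
  then show ?case using gw_verts_snoc[of "u @ x" i k] gw_verts_snoc[of x i "\<lambda>y. k (u @ y)"] by auto
qed (simp add: gw_verts.root)

lemma survives_split:
  assumes "r \<le> m"
  shows "survives m k \<longleftrightarrow> (\<exists>u\<in>gw_verts k. length u = r \<and> survives (m - r) (\<lambda>x. k (u @ x)))"
proof
  assume "survives m k"
  then obtain w where w: "w \<in> gw_verts k" "length w = m" by (auto simp: survives_def)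
  have "take r w @ drop r w \<in> gw_verts k" using w by simp
  then have t: "take r w \<in> gw_verts k" "drop r w \<in> gw_verts (\<lambda>y. k (take r w @ y))"
    unfolding gw_verts_append by auto
  show "\<exists>u\<in>gw_verts k. length u = r \<and> survives (m - r) (\<lambda>x. k (u @ x))"
  proof (intro bexI[OF _ t(1)] conjI)
    show "survives (m - r) (\<lambda>x. k (take r w @ x))"
      unfolding survives_def by (rule bexI[OF _ t(2)]) (use w in simp)
  qed (use w assms in simp)
next
  assume "\<exists>u\<in>gw_verts k. length u = r \<and> survives (m - r) (\<lambda>x. k (u @ x))"
  then obtain u x where u: "u \<in> gw_verts k" "length u = r" "x \<in> gw_verts (\<lambda>x. k (u @ x))" "length x = m - r"
    unfolding survives_def by blast
  then have "u @ x \<in> gw_verts k" unfolding gw_verts_append by simp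
  then show "survives m k" unfolding survives_def by (rule bexI[rotated]) (use u assms in simp)
qed

lemma surv_mono: "m \<le> n \<Longrightarrow> surv \<xi> n \<le> surv \<xi> m"
proof -
  assume mn: "m \<le> n"
  interpret prob_space "gw_space \<xi>" by (rule prob_space_gw_space)
  have "survives n k \<Longrightarrow> survives m k" for k
    using survives_split[OF mn, of k] by (auto simp: survives_def)
  then show ?thesis unfolding surv_def by (intro finite_measure_mono sets_gw_survives) auto
qed

lemma surv_bounds: "0 \<le> surv \<xi> m" "surv \<xi> m \<le> 1"
proof -
  interpret prob_space "gw_space \<xi>" by (rule prob_space_gw_space)
  show "0 \<le> surv \<xi> m" "surv \<xi> m \<le> 1" by (simp_all add: surv_def)
qed

lemma surv_0: "surv \<xi> 0 = 1"
proof -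
  interpret prob_space "gw_space \<xi>" by (rule prob_space_gw_space)
  have "{k. survives 0 k} = space (gw_space \<xi>)" by (auto simp: survives_def gw_verts.root)
  then show ?thesis unfolding surv_def using prob_space by simp
qed

lemma sets_gw_extinct:
  assumes "countable I" "countable L"
  shows "{k. (\<forall>w\<in>I. k w = \<kappa> w) \<and> (\<forall>u\<in>L. \<not> survives m (\<lambda>x. k (u @ x)))} \<in> sets (gw_space \<xi>)"
proof -
  have "{k \<in> space (gw_space \<xi>). \<not> survives m (\<lambda>x. k (u @ x))} \<in> sets (gw_space \<xi>)" for u
    using survives_shift_prob(1)[of m u \<xi>] by (intro sets.sets_Collect_neg) simp
  then have "{k \<in> space (gw_space \<xi>). (\<forall>w\<in>I. k w = \<kappa> w) \<and> (\<forall>u\<in>L. \<not> survives m (\<lambda>x. k (u @ x)))} \<in> sets (gw_space \<xi>)"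
    using sets_gw_value assms
    by (intro sets.sets_Collect_conj sets.sets_Collect_countable_Ball) auto
  then show ?thesis by simp
qed

text \<open>Split by the number \<open>j\<close> of children of the root: none of their subtrees
  survives with probability \<open>(1 - s) ^ j\<close>, and the Poisson weights sum these powers to
  \<open>exp (- s)\<close>.\<close>

lemma surv_Suc: "surv (poisson_pmf 1) (Suc m) = 1 - exp (- surv (poisson_pmf 1) m)"
proof -
  let ?\<xi> = "poisson_pmf 1"
  interpret prob_space "gw_space ?\<xi>" by (rule prob_space_gw_space)
  let ?s = "surv ?\<xi> m"
  define L where "L j = (\<lambda>i. [i]) ` {..<j}" for j :: nat
  define D where "D j = {k. (\<forall>w\<in>{[]}. k w = j) \<and> (\<forall>u\<in>L j. \<not> survives m (\<lambda>x. k (u @ x)))}" for j :: nat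
  have sD: "D j \<in> sets (gw_space ?\<xi>)" for j
    unfolding D_def by (rule sets_gw_extinct[where \<kappa> = "\<lambda>_. j"]) (auto simp: L_def)
  have pD: "prob (D j) = exp (- 1) * ((1 - ?s) ^ j / fact j)" for j
  proof -
    have "finite {[] :: nat list}" "finite (L j)" by (simp_all add: L_def)
    moreover have "u = u'" if "u \<in> L j" "u' \<in> L j" "u @ x = u' @ x'" for u u' x x'
      using that by (auto simp: L_def)
    moreover have "u @ x \<notin> {[]}" if "u \<in> L j" for u x using that by (auto simp: L_def)
    ultimately have "prob (D j) = pmf ?\<xi> j * (1 - ?s) ^ card (L j)"
      using gw_prob_extinct[of "{[]}" "L j" ?\<xi> "\<lambda>_. j" m] by (simp add: D_def)
    also have "card (L j) = j" by (simp add: L_def card_image inj_on_def)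
    finally show ?thesis by simp
  qed
  have "(\<lambda>j. exp (- 1) * ((1 - ?s) ^ j / fact j)) sums (exp (- 1) * exp (1 - ?s))"
    using exp_converges[of "1 - ?s"] by (intro sums_mult) (simp add: divide_inverse mult.commute)
  moreover have "(\<lambda>j. prob (D j)) sums prob (\<Union>j. D j)"
    by (rule finite_measure_UNION) (use sD in \<open>auto simp: disjoint_family_on_def D_def\<close>)
  ultimately have "prob (\<Union>j. D j) = exp (- 1) * exp (1 - ?s)"
    unfolding pD by (rule sums_unique2[symmetric])
  also have "\<dots> = exp (- ?s)" by (simp add: exp_add[symmetric])
  also have "(\<Union>j. D j) = space (gw_space ?\<xi>) - {k. survives (Suc m) k}"
  proof -
    have "survives (Suc m) k \<longleftrightarrow> (\<exists>i<k []. survives m (\<lambda>x. k ([i] @ x)))" for k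
    proof -
      have eq: "u \<in> gw_verts k \<and> length u = 1 \<longleftrightarrow> (\<exists>i<k []. u = [i])" for u
        using gw_verts_snoc[of "[]" _ k] gw_verts.root[of k] by (auto simp: length_Suc_conv)
      have "survives (Suc m) k \<longleftrightarrow> (\<exists>u. (u \<in> gw_verts k \<and> length u = 1) \<and> survives m (\<lambda>x. k (u @ x)))"
        using survives_split[of 1 "Suc m" k] by auto
      then show ?thesis unfolding eq by blast
    qed
    then show ?thesis by (auto simp: D_def L_def)
  qed
  also have "prob \<dots> = 1 - surv ?\<xi> (Suc m)"
    unfolding surv_def by (rule prob_compl[OF sets_gw_survives])
  finally show ?thesis by simp
qed

lemma surv_pos: "0 < surv (poisson_pmf 1) m"
  by (induction m) (simp_all add: surv_0 surv_Suc)

text \<open>Criticality: the decreasing sequence has a limit \<open>l\<close> with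
  \<open>exp (- l) = 1 - l\<close>, and strict convexity leaves only \<open>l = 0\<close>.\<close>

lemma surv_tendsto_0: "surv (poisson_pmf 1) \<longlonglongrightarrow> 0"
proof -
  let ?s = "surv (poisson_pmf 1)"
  have "decseq ?s" using surv_mono by (simp add: decseq_def)
  then obtain l where l: "?s \<longlonglongrightarrow> l" "\<And>i. l \<le> ?s i"
    using decseq_convergent[of ?s 0] surv_bounds(1) by blast
  have "(\<lambda>m. 1 - exp (- ?s m)) \<longlonglongrightarrow> 1 - exp (- l)" by (intro tendsto_intros l)
  moreover have "(\<lambda>m. 1 - exp (- ?s m)) \<longlonglongrightarrow> l"
    using LIMSEQ_Suc[OF l(1)] by (simp add: surv_Suc)
  ultimately have eq: "exp (- l) = 1 - l" using LIMSEQ_unique by fastforce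
  have "l = 0"
  proof (rule ccontr)
    assume "l \<noteq> 0"
    then have "1 - l < exp (- l)" by (simp add: exp_minus_greater)
    then show False using eq by simp
  qed
  then show ?thesis using l by simp
qed

section \<open>Permutations of siblings\<close>

definition relabel :: "(nat list \<Rightarrow> nat \<Rightarrow> nat) \<Rightarrow> nat list \<Rightarrow> nat list" where
  "relabel \<sigma> w = map (\<lambda>i. \<sigma> (take i w) (w ! i)) [0..<length w]"

lemma length_relabel [simp]: "length (relabel \<sigma> w) = length w"
  by (simp add: relabel_def)

lemma relabel_Nil [simp]: "relabel \<sigma> [] = []"
  by (simp add: relabel_def)

lemma relabel_snoc [simp]: "relabel \<sigma> (w @ [i]) = relabel \<sigma> w @ [\<sigma> w i]"
  by (auto simp: relabel_def nth_append)

lemma relabel_butlast: "relabel \<sigma> (butlast w) = butlast (relabel \<sigma> w)"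
  by (cases w rule: rev_cases) auto

lemma relabel_inj:
  assumes W: "word_tree W" and \<sigma>: "\<And>w i. w @ [i] \<in> W \<Longrightarrow> inj (\<sigma> w)"
  shows "u \<in> W \<Longrightarrow> v \<in> W \<Longrightarrow> relabel \<sigma> u = relabel \<sigma> v \<Longrightarrow> u = v"
proof (induction u arbitrary: v rule: rev_induct)
  case Nil
  then show ?case by (metis length_0_conv length_relabel)
next
  case (snoc i u)
  obtain j v' where v: "v = v' @ [j]"
    using snoc.prems(3) by (cases v rule: rev_cases) auto
  have "u \<in> W" "v' \<in> W"
    using W snoc.prems(1,2) v unfolding word_tree_def by (metis butlast_snoc snoc_eq_iff_butlast)+
  moreover have "relabel \<sigma> u = relabel \<sigma> v'" "\<sigma> u i = \<sigma> v' j" using snoc.prems(3) v by simp_all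
  ultimately have "u = v'" "\<sigma> u i = \<sigma> u j" using snoc.IH by blast+
  then show ?case using v injD[OF \<sigma>[OF snoc.prems(1)]] by blast
qed

text \<open>Each letter is moved by the permutation attached to the prefix before it in the original
  word. Hence the children of \<open>w\<close> become the children of
  \<open>relabel \<sigma> w\<close> as soon as \<open>k\<close> assigns to the latter the old number
  of children.\<close>

lemma relabel_iso:
  assumes \<sigma>: "\<And>w. w \<in> bverts r (gw_tree \<kappa>) \<Longrightarrow> length w < r \<Longrightarrow> \<sigma> w permutes {..<\<kappa> w}"
    and k: "\<And>w. w \<in> bverts r (gw_tree \<kappa>) \<Longrightarrow> length w < r \<Longrightarrow> k (relabel \<sigma> w) = \<kappa> w"
  shows "iso_map (relabel \<sigma>) (rball r (gw_tree \<kappa>)) (rball r (gw_tree k))"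
proof -
  let ?W = "bverts r (gw_tree \<kappa>)"
  have parent: "w \<in> ?W \<and> length w < r \<and> i < \<kappa> w" if "w @ [i] \<in> ?W" for w i
    using that by (auto simp: bverts_gw_tree gw_verts_snoc)
  have into: "relabel \<sigma> w \<in> bverts r (gw_tree k)" if "w \<in> ?W" for w
    using that
  proof (induction w rule: rev_induct)
    case Nil
    then show ?case by (simp add: bverts_gw_tree gw_verts.root)
  next
    case (snoc i w)
    have w: "w \<in> ?W" "length w < r" "i < \<kappa> w" using parent[OF snoc.prems] by auto
    have "\<sigma> w i < k (relabel \<sigma> w)"
      using permutes_in_image[OF \<sigma>[OF w(1,2)], of i] w(3) k[OF w(1,2)] by simp
    then show ?case using snoc.IH[OF w(1)] w(2) by (simp add: bverts_gw_tree gw_verts_snoc)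
  qed
  have inj: "u = v" if "u \<in> ?W" "v \<in> ?W" "relabel \<sigma> u = relabel \<sigma> v" for u v
    using relabel_inj[OF word_tree_bverts permutes_inj[OF \<sigma>] that] parent by blast
  have surj: "v \<in> relabel \<sigma> ` ?W" if "v \<in> bverts r (gw_tree k)" for v
    using that
  proof (induction v rule: rev_induct)
    case Nil
    then show ?case by (intro image_eqI[of _ _ "[]"]) (auto simp: bverts_gw_tree gw_verts.root)
  next
    case (snoc j v)
    have v: "v \<in> bverts r (gw_tree k)" "length v < r" "j < k v"
      using snoc.prems by (auto simp: bverts_gw_tree gw_verts_snoc)
    obtain w where w: "w \<in> ?W" "v = relabel \<sigma> w" using snoc.IH[OF v(1)] by blast
    have lw: "length w < r" using v(2) w(2) by simp
    have "j \<in> {..<\<kappa> w}" using v(3) k[OF w(1) lw] w(2) by simp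
    then obtain i where i: "i < \<kappa> w" "\<sigma> w i = j"
      using permutes_image[OF \<sigma>[OF w(1) lw]] by (metis imageE lessThan_iff)
    show ?case using i w lw by (intro image_eqI[of _ _ "w @ [i]"]) (auto simp: bverts_gw_tree gw_verts_snoc)
  qed
  have bij: "bij_betw (relabel \<sigma>) ?W (bverts r (gw_tree k))"
    unfolding bij_betw_def inj_on_def using into inj surj by blast
  have bl: "butlast w \<in> ?W" if "w \<in> ?W" "w \<noteq> []" for w
    using word_tree_bverts[of r \<kappa>] that by (auto simp: word_tree_def)
  have half: "v \<noteq> [] \<and> u = butlast v \<longleftrightarrow> relabel \<sigma> v \<noteq> [] \<and> relabel \<sigma> u = butlast (relabel \<sigma> v)"
    if "u \<in> ?W" "v \<in> ?W" for u v
    using inj[of u "butlast v"] bl[of v] that relabel_butlast[of \<sigma> v]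
    by (metis length_0_conv length_relabel)
  have "{u, v} \<in> edges (fst (rball r (gw_tree \<kappa>))) \<longleftrightarrow>
      {relabel \<sigma> u, relabel \<sigma> v} \<in> edges (fst (rball r (gw_tree k)))" if "u \<in> ?W" "v \<in> ?W" for u v
    unfolding rball_gw_edge_iff using half[OF that] half[OF that(2,1)] that into by blast
  then show ?thesis unfolding iso_map_def using bij by (simp del: rball_simps(2))
qed

text \<open>Permuting the children of every vertex below level \<open>r\<close> yields distinct labelled copies of
  \<open>t0\<close>; their number \<open>\<Prod>\<kappa>(w)!\<close> cancels the factorials of the Poisson weights.\<close>

lemma gw_isos_lower:
  fixes \<kappa> :: "nat list \<Rightarrow> nat" and r m :: nat
  defines "t0 \<equiv> rball r (gw_tree \<kappa>)" and "W \<equiv> bverts r (gw_tree \<kappa>)"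
  defines "a \<equiv> card {w\<in>W. length w < r}" and "l \<equiv> card {w\<in>W. length w = r}"
  assumes rm: "r \<le> m"
  shows "exp (- real a) * (1 - (1 - surv (poisson_pmf 1) m) ^ l) \<le> card (isos t0 t0) *
    measure (gw_space (poisson_pmf 1)) {k. survives m k \<and> rgraph_iso t0 (rball r (gw_tree k))}"
proof -
  let ?\<xi> = "poisson_pmf 1"
  let ?s = "surv ?\<xi>"
  interpret prob_space "gw_space ?\<xi>" by (rule prob_space_gw_space)
  define I where "I = {w\<in>W. length w < r}"
  define Lv where "Lv = {w\<in>W. length w = r}"
  have fW: "finite W" unfolding W_def by (rule finite_bverts_gw)
  then have fin: "finite I" "finite Lv" by (auto simp: I_def Lv_def)
  define \<Sigma> where "\<Sigma> = PiE I (\<lambda>w. {p. p permutes {..<\<kappa> w}})"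
  have f\<Sigma>: "finite \<Sigma>" unfolding \<Sigma>_def by (intro finite_PiE fin finite_permutations) simp
  have c\<Sigma>: "card \<Sigma> = (\<Prod>w\<in>I. fact (\<kappa> w))"
    unfolding \<Sigma>_def card_PiE[OF fin(1)] by (intro prod.cong[OF refl] card_permutations) auto
  define E where "E \<sigma> = {k. \<forall>w\<in>I. k (relabel \<sigma> w) = \<kappa> w}" for \<sigma>
  have perm: "\<sigma> w permutes {..<\<kappa> w}" if "\<sigma> \<in> \<Sigma>" "w \<in> I" for \<sigma> w
    using that by (auto simp: \<Sigma>_def)
  have iso: "iso_map (relabel \<sigma>) t0 (rball r (gw_tree k))" if \<sigma>: "\<sigma> \<in> \<Sigma>" and k: "k \<in> E \<sigma>" for \<sigma> k
    unfolding t0_def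
  proof (rule relabel_iso)
    show "\<sigma> w permutes {..<\<kappa> w}" if "w \<in> bverts r (gw_tree \<kappa>)" "length w < r" for w
      using perm[OF \<sigma>] that by (simp add: I_def W_def)
    show "k (relabel \<sigma> w) = \<kappa> w" if "w \<in> bverts r (gw_tree \<kappa>)" "length w < r" for w
      using k that by (simp add: E_def I_def W_def)
  qed
  have t0: "rgraph t0" unfolding t0_def by (rule rgraph_rball[OF rgraph_gw_tree])
  have vt0: "verts (fst t0) = W" by (simp add: t0_def W_def)
  \<comment> \<open>For a fixed labelling \<open>k\<close>, different \<open>\<sigma>\<close> give
    different isomorphisms from \<open>t0\<close> onto the same ball, so their number is at most the
    number of automorphisms.\<close>
  have count: "real (card {\<sigma>\<in>\<Sigma>. k \<in> E \<sigma>}) \<le> card (isos t0 t0) * of_bool (rgraph_iso t0 (rball r (gw_tree k)))" for k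
  proof (cases "{\<sigma>\<in>\<Sigma>. k \<in> E \<sigma>} = {}")
    case False
    then have ri: "rgraph_iso t0 (rball r (gw_tree k))" using iso by (auto simp: rgraph_iso_iff)
    have rk: "rgraph (rball r (gw_tree k))" by (rule rgraph_rball[OF rgraph_gw_tree])
    have fk: "finite (verts (fst (rball r (gw_tree k))))" using finite_bverts_gw by simp
    let ?F = "\<lambda>\<sigma>. restrict (relabel \<sigma>) W"
    have "card {\<sigma>\<in>\<Sigma>. k \<in> E \<sigma>} \<le> card (isos t0 (rball r (gw_tree k)))"
    proof (rule card_inj_on_le[of ?F])
      show "?F ` {\<sigma>\<in>\<Sigma>. k \<in> E \<sigma>} \<subseteq> isos t0 (rball r (gw_tree k))"
      proof clarify
        fix \<sigma> assume "\<sigma> \<in> \<Sigma>" "k \<in> E \<sigma>"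
        then show "?F \<sigma> \<in> isos t0 (rball r (gw_tree k))"
          using iso iso_map_cong[of t0 "?F \<sigma>" "relabel \<sigma>"] rgraphD(4)[OF t0] by (simp add: isos_def vt0)
      qed
      show "inj_on ?F {\<sigma>\<in>\<Sigma>. k \<in> E \<sigma>}"
      proof (rule inj_onI, clarify)
        fix \<sigma> \<tau> assume st: "\<sigma> \<in> \<Sigma>" "\<tau> \<in> \<Sigma>" and eq: "?F \<sigma> = ?F \<tau>"
        show "\<sigma> = \<tau>"
        proof (rule extensionalityI[of _ I])
          fix w assume w: "w \<in> I"
          show "\<sigma> w = \<tau> w"
          proof
            fix i show "\<sigma> w i = \<tau> w i"
            proof (cases "i < \<kappa> w")
              case True
              then have "w @ [i] \<in> W" using w by (auto simp: I_def W_def bverts_gw_tree gw_verts_snoc)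
              then have "relabel \<sigma> (w @ [i]) = relabel \<tau> (w @ [i])"
                using fun_cong[OF eq, of "w @ [i]"] by simp
              then show ?thesis by simp
            next
              case False
              then show ?thesis
                using permutes_not_in[OF perm[OF st(1) w], of i] permutes_not_in[OF perm[OF st(2) w], of i] by simp
            qed
          qed
        qed (use st in \<open>auto simp: \<Sigma>_def PiE_iff\<close>)
      qed
    qed (rule finite_isos, use fk vt0 fW in auto)
    also have "\<dots> = card (isos t0 t0)"
      by (rule card_isos_eq[symmetric, OF t0 rk rgraphD(4)[OF t0] _ _ fk ri]) (simp_all add: vt0 fW)
    finally show ?thesis using ri by simp
  next
    case True
    show ?thesis unfolding True by simp
  qed
  \<comment> \<open>On \<open>E \<sigma>\<close> the first \<open>r\<close> levels are known, and
    the tree dies before generation \<open>m\<close> exactly if none of the \<open>l\<close>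
    subtrees at level \<open>r\<close> survives \<open>m - r\<close> generations.\<close>
  have PE: "prob (E \<sigma> \<inter> {k. survives m k}) = (\<Prod>w\<in>I. pmf ?\<xi> (\<kappa> w)) * (1 - (1 - ?s (m - r)) ^ l)"
    "E \<sigma> \<inter> {k. survives m k} \<in> sets (gw_space ?\<xi>)" if \<sigma>: "\<sigma> \<in> \<Sigma>" for \<sigma>
  proof -
    let ?g = "\<lambda>x. \<kappa> (the_inv_into W (relabel \<sigma>) x)"
    have "inj (\<sigma> w)" if "w @ [i] \<in> W" for w i
      using that permutes_inj[OF perm[OF \<sigma>]] by (auto simp: I_def W_def bverts_gw_tree gw_verts_snoc)
    from relabel_inj[OF word_tree_bverts this[unfolded W_def]]
    have inj: "inj_on (relabel \<sigma>) W" by (auto simp: inj_on_def W_def)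
    have g: "?g (relabel \<sigma> w) = \<kappa> w" if "w \<in> I" for w
      using the_inv_into_f_f[OF inj] that by (simp add: I_def)
    let ?I = "relabel \<sigma> ` I" and ?L = "relabel \<sigma> ` Lv"
    have cL: "card ?L = l" unfolding l_def Lv_def[symmetric]
      using inj by (intro card_image inj_on_subset[OF inj]) (auto simp: Lv_def)
    have pI: "(\<Prod>x\<in>?I. pmf ?\<xi> (?g x)) = (\<Prod>w\<in>I. pmf ?\<xi> (\<kappa> w))"
      using inj_on_subset[OF inj, of I] g by (subst prod.reindex) (auto simp: I_def)
    \<comment> \<open>With an empty second family \<open>gw_prob_extinct\<close> yields the
      probability of the labels alone.\<close>
    have E1: "E \<sigma> = {k. (\<forall>x\<in>?I. k x = ?g x) \<and> (\<forall>u\<in>{}. \<not> survives (m - r) (\<lambda>x. k (u @ x)))}"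
      using g by (auto simp: E_def)
    have E2: "E \<sigma> - {k. survives m k} =
      {k. (\<forall>x\<in>?I. k x = ?g x) \<and> (\<forall>u\<in>?L. \<not> survives (m - r) (\<lambda>x. k (u @ x)))}"
    proof -
      have "survives m k \<longleftrightarrow> (\<exists>u\<in>?L. survives (m - r) (\<lambda>x. k (u @ x)))" if k: "k \<in> E \<sigma>" for k
      proof -
        have "relabel \<sigma> ` W = bverts r (gw_tree k)"
          using iso_mapD(1)[OF iso[OF \<sigma> k]] by (simp add: bij_betw_def vt0)
        moreover have "?L = {u \<in> relabel \<sigma> ` W. length u = r}" unfolding Lv_def by auto
        ultimately have "?L = {u \<in> gw_verts k. length u = r}" by (auto simp: bverts_gw_tree)
        then show ?thesis using survives_split[OF rm, of k] by auto
      qed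
      then show ?thesis using g by (auto simp: E_def)
    qed
    have sE: "E \<sigma> \<in> sets (gw_space ?\<xi>)" "E \<sigma> - {k. survives m k} \<in> sets (gw_space ?\<xi>)"
      unfolding E2 unfolding E1 using fin by (intro sets_gw_extinct; simp add: countable_finite)+
    have "prob (E \<sigma>) = (\<Prod>x\<in>?I. pmf ?\<xi> (?g x)) * (1 - ?s (m - r)) ^ card ({} :: nat list set)"
      unfolding E1 by (rule gw_prob_extinct) (use fin in auto)
    then have p1: "prob (E \<sigma>) = (\<Prod>w\<in>I. pmf ?\<xi> (\<kappa> w))" using pI by simp
    have "prob (E \<sigma> - {k. survives m k}) = (\<Prod>x\<in>?I. pmf ?\<xi> (?g x)) * (1 - ?s (m - r)) ^ card ?L"
      unfolding E2
    proof (rule gw_prob_extinct)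
      show "u = u'" if "u \<in> ?L" "u' \<in> ?L" "u @ x = u' @ x'" for u u' x x'
        using that by (auto simp: Lv_def)
      show "u @ x \<notin> ?I" if "u \<in> ?L" for u x
      proof
        assume "u @ x \<in> ?I"
        then obtain w where "w \<in> I" "u @ x = relabel \<sigma> w" by auto
        then have "length (u @ x) < r" by (simp add: I_def)
        then show False using that by (auto simp: Lv_def)
      qed
    qed (use fin in auto)
    then have p2: "prob (E \<sigma> - {k. survives m k}) = (\<Prod>w\<in>I. pmf ?\<xi> (\<kappa> w)) * (1 - ?s (m - r)) ^ l"
      unfolding pI cL .
    have int: "E \<sigma> \<inter> {k. survives m k} = E \<sigma> - (E \<sigma> - {k. survives m k})" by auto
    show "E \<sigma> \<inter> {k. survives m k} \<in> sets (gw_space ?\<xi>)" unfolding int using sE by simp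
    have "prob (E \<sigma> \<inter> {k. survives m k}) = prob (E \<sigma>) - prob (E \<sigma> - {k. survives m k})"
      unfolding int by (rule finite_measure_Diff) (use sE in auto)
    then show "prob (E \<sigma> \<inter> {k. survives m k}) = (\<Prod>w\<in>I. pmf ?\<xi> (\<kappa> w)) * (1 - (1 - ?s (m - r)) ^ l)"
      unfolding p1 p2 by (simp add: algebra_simps)
  qed
  define B where "B = {k. survives m k \<and> rgraph_iso t0 (rball r (gw_tree k))}"
  have sB: "B \<in> sets (gw_space ?\<xi>)"
  proof -
    have "{k. rgraph_iso t0 (rball r (gw_tree k))} \<in> sets (gw_space ?\<xi>)"
      using measurable_sets[OF rball_gw_measurable[of "\<lambda>X. rgraph_iso t0 X" r ?\<xi>], of "{True}"]
      by (simp add: vimage_def)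
    then have "{k. survives m k} \<inter> {k. rgraph_iso t0 (rball r (gw_tree k))} \<in> sets (gw_space ?\<xi>)"
      using sets_gw_survives by (rule sets.Int[rotated])
    then show ?thesis by (simp add: B_def Collect_conj_eq)
  qed
  have "(\<Sum>\<sigma>\<in>\<Sigma>. prob (E \<sigma> \<inter> {k. survives m k})) =
      (\<Sum>\<sigma>\<in>\<Sigma>. \<integral>k. indicator (E \<sigma> \<inter> {k. survives m k}) k \<partial>gw_space ?\<xi>)"
    using PE(2) by simp
  also have "\<dots> = (\<integral>k. (\<Sum>\<sigma>\<in>\<Sigma>. indicator (E \<sigma> \<inter> {k. survives m k}) k) \<partial>gw_space ?\<xi>)"
    by (rule Bochner_Integration.integral_sum[symmetric]) (use PE(2) in \<open>simp add: emeasure_eq_measure\<close>)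
  also have "\<dots> \<le> (\<integral>k. real (card (isos t0 t0)) * indicator B k \<partial>gw_space ?\<xi>)"
  proof (rule integral_mono)
    show "integrable (gw_space ?\<xi>) (\<lambda>k. \<Sum>\<sigma>\<in>\<Sigma>. indicator (E \<sigma> \<inter> {k. survives m k}) k :: real)"
      by (rule Bochner_Integration.integrable_sum) (use PE(2) in \<open>simp add: emeasure_eq_measure\<close>)
    show "integrable (gw_space ?\<xi>) (\<lambda>k. real (card (isos t0 t0)) * indicator B k :: real)"
      using sB by (simp add: emeasure_eq_measure)
    show "(\<Sum>\<sigma>\<in>\<Sigma>. indicator (E \<sigma> \<inter> {k. survives m k}) k) \<le> (real (card (isos t0 t0)) * indicator B k :: real)" for k
    proof (cases "survives m k")
      case True
      then have "(\<Sum>\<sigma>\<in>\<Sigma>. indicator (E \<sigma> \<inter> {k. survives m k}) k) = (\<Sum>\<sigma>\<in>\<Sigma>. of_bool (k \<in> E \<sigma>) :: real)"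
        by (intro sum.cong) (auto simp: indicator_def)
      also have "\<dots> = card {\<sigma>\<in>\<Sigma>. k \<in> E \<sigma>}" using f\<Sigma> by (simp add: sum_of_bool_eq Int_def)
      also have "\<dots> \<le> card (isos t0 t0) * of_bool (rgraph_iso t0 (rball r (gw_tree k)))" by (rule count)
      also have "\<dots> = real (card (isos t0 t0)) * indicator B k" using True by (simp add: B_def indicator_def)
      finally show ?thesis .
    qed simp
  qed
  also have "\<dots> = card (isos t0 t0) * prob B" using sB by simp
  finally have le: "(\<Sum>\<sigma>\<in>\<Sigma>. prob (E \<sigma> \<inter> {k. survives m k})) \<le> card (isos t0 t0) * prob B" .
  have "(\<Sum>\<sigma>\<in>\<Sigma>. prob (E \<sigma> \<inter> {k. survives m k})) =
      real (card \<Sigma>) * ((\<Prod>w\<in>I. pmf ?\<xi> (\<kappa> w)) * (1 - (1 - ?s (m - r)) ^ l))"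
    using PE(1) by simp
  also have "\<dots> = (\<Prod>w\<in>I. fact (\<kappa> w) * pmf ?\<xi> (\<kappa> w)) * (1 - (1 - ?s (m - r)) ^ l)"
    unfolding c\<Sigma> by (simp only: prod.distrib of_nat_prod of_nat_fact mult.assoc)
  also have "(\<Prod>w\<in>I. fact (\<kappa> w) * pmf ?\<xi> (\<kappa> w)) = (\<Prod>w\<in>I. exp (- 1))"
    by (rule prod.cong) auto
  also have "\<dots> = exp (- real a)" by (simp add: a_def I_def exp_of_nat_mult[symmetric])
  finally have "exp (- real a) * (1 - (1 - ?s (m - r)) ^ l) \<le> card (isos t0 t0) * prob B" using le by simp
  \<comment> \<open>Passing from \<open>m - r\<close> to \<open>m\<close> generations matches the
    normalisation by \<open>?s m\<close> in the conditioned law.\<close>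
  moreover have "(1 - ?s (m - r)) ^ l \<le> (1 - ?s m) ^ l"
    using surv_mono[of "m - r" m ?\<xi>] surv_bounds[of ?\<xi>] by (intro power_mono) auto
  then have "exp (- real a) * (1 - (1 - ?s m) ^ l) \<le> exp (- real a) * (1 - (1 - ?s (m - r)) ^ l)" by simp
  ultimately show ?thesis unfolding B_def by linarith
qed

text \<open>Conditioning divides by \<open>s = surv (poisson_pmf 1) m\<close>. Since
  \<open>1 - (1 - s) ^ l\<close> is \<open>s\<close> times a geometric sum of \<open>l\<close>
  terms, the quotient tends to \<open>l\<close> as \<open>s\<close> tends to 0; this is where the
  weight by the size of the last level arises.\<close>

lemma gw_limit_lower:
  fixes \<kappa> :: "nat list \<Rightarrow> nat" and r :: nat
  defines "t0 \<equiv> rball r (gw_tree \<kappa>)" and "W \<equiv> bverts r (gw_tree \<kappa>)"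
  defines "a \<equiv> card {w\<in>W. length w < r}" and "l \<equiv> card {w\<in>W. length w = r}"
  assumes \<mu>: "gw_conditioned_to_survive (poisson_pmf 1) \<mu>"
  shows "real l * exp (- real a) \<le> card (isos t0 t0) * measure \<mu> {y. gball r y = iso_class t0}"
proof -
  let ?\<xi> = "poisson_pmf 1"
  let ?s = "surv ?\<xi>"
  let ?c = "iso_class t0"
  interpret P: prob_space "gw_space ?\<xi>" by (rule prob_space_gw_space)
  have prob\<mu>: "prob_space \<mu>" and sets\<mu>: "sets \<mu> = sets borel"
    and conv: "conv_in_distr (\<lambda>m. distr (gw_conditioned ?\<xi> m) borel (gball r)) (distr \<mu> borel (gball r))"
    using \<mu> by (auto simp: gw_conditioned_to_survive_def)
  let ?A = "{y. gball r y = ?c}"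
  let ?f = "\<lambda>y. indicator ?A y :: real"
  have "continuous_on UNIV ?f"
    using continuous_gball_fun[of "\<lambda>z. of_bool (z = ?c) :: real" r] by (simp add: indicator_def of_bool_def)
  moreover have "bounded (range ?f)"
    by (rule boundedI[of _ 1]) (auto simp: indicator_def)
  ultimately have lim: "(\<lambda>m. \<integral>x. ?f x \<partial>distr (gw_conditioned ?\<xi> m) borel (gball r)) \<longlonglongrightarrow>
      (\<integral>x. ?f x \<partial>distr \<mu> borel (gball r))"
    using conv unfolding conv_in_distr_def by blast
  have int: "(\<integral>x. ?f x \<partial>distr M borel (gball r)) = measure M ?A" if sM: "sets M = sets borel" for M :: "gbullet measure"
  proof -
    have m: "gball r \<in> borel_measurable M" using gball_measurable measurable_cong_sets[OF sM refl] by blast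
    have "(\<integral>x. ?f x \<partial>distr M borel (gball r)) = measure (distr M borel (gball r)) ?A"
      using sets_gball_fibre[of r ?c] by simp
    also have "\<dots> = measure M (gball r -` ?A \<inter> space M)"
      by (rule measure_distr[OF m]) (rule sets_gball_fibre)
    also have "gball r -` ?A \<inter> space M = ?A"
      using sets_eq_imp_space_eq[OF sM] by (auto simp: gball_gball)
    finally show ?thesis .
  qed
  have t0: "rgraph t0" unfolding t0_def by (rule rgraph_rball[OF rgraph_gw_tree])
  have gwc: "measure (gw_conditioned ?\<xi> m) ?A =
      P.prob {k. survives m k \<and> rgraph_iso t0 (rball r (gw_tree k))} / ?s m" for m
  proof -
    let ?S = "{k \<in> space (gw_space ?\<xi>). survives m k}"
    have S: "?S \<in> sets (gw_space ?\<xi>)" using sets_gw_survives by simp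
    have mf: "(\<lambda>k. iso_class (gw_tree k)) \<in> borel_measurable (uniform_measure (gw_space ?\<xi>) ?S)"
      using gw_class_measurable[of ?\<xi>] by simp
    let ?B = "{k. gball r (iso_class (gw_tree k)) = ?c}"
    have B: "?B = {k. rgraph_iso t0 (rball r (gw_tree k))}"
      unfolding gball_iso_class[OF rgraph_gw_tree]
      using iso_class_eq_iff[OF t0 rgraph_rball[OF rgraph_gw_tree]] by (metis (lifting))
    have sB: "?B \<in> sets (gw_space ?\<xi>)"
      using measurable_sets[OF gw_class_measurable[of ?\<xi>] sets_gball_fibre[of r ?c]] by (simp add: vimage_def)
    have "measure (gw_conditioned ?\<xi> m) ?A =
        measure (uniform_measure (gw_space ?\<xi>) ?S) ((\<lambda>k. iso_class (gw_tree k)) -` ?A \<inter> space (uniform_measure (gw_space ?\<xi>) ?S))"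
      unfolding gw_conditioned_def by (rule measure_distr[OF mf]) (rule sets_gball_fibre)
    also have "\<dots> = measure (uniform_measure (gw_space ?\<xi>) ?S) ?B" by (simp add: vimage_def)
    also have "\<dots> = measure (gw_space ?\<xi>) (?S \<inter> ?B) / measure (gw_space ?\<xi>) ?S"
      using surv_pos[of m] sB S by (intro measure_uniform_measure) (auto simp: P.emeasure_eq_measure surv_def)
    also have "?S \<inter> ?B = {k. survives m k \<and> rgraph_iso t0 (rball r (gw_tree k))}" unfolding B by auto
    also have "measure (gw_space ?\<xi>) ?S = ?s m" by (simp add: surv_def)
    finally show ?thesis .
  qed
  have sc: "sets (gw_conditioned ?\<xi> m) = sets borel" for m by (simp add: gw_conditioned_def)
  have lim': "(\<lambda>m. card (isos t0 t0) * measure (gw_conditioned ?\<xi> m) ?A) \<longlonglongrightarrow> card (isos t0 t0) * measure \<mu> ?A"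
    using lim unfolding int[OF sc] int[OF sets\<mu>] by (intro tendsto_mult tendsto_const)
  have "(\<lambda>m. exp (- real a) * (\<Sum>i<l. (1 - ?s m) ^ i)) \<longlonglongrightarrow> exp (- real a) * (\<Sum>i<l. (1 - 0) ^ i)"
    by (intro tendsto_intros surv_tendsto_0)
  then have lim2: "(\<lambda>m. exp (- real a) * (\<Sum>i<l. (1 - ?s m) ^ i)) \<longlonglongrightarrow> real l * exp (- real a)"
    by (simp add: mult.commute)
  show ?thesis
  proof (rule LIMSEQ_le[OF lim2 lim'], intro exI[of _ r] allI impI)
    fix m assume rm: "r \<le> m"
    have "1 - (1 - ?s m) ^ l = ?s m * (\<Sum>i<l. (1 - ?s m) ^ i)"
      using one_diff_power_eq[of "1 - ?s m" l] by simp
    then have "exp (- real a) * (\<Sum>i<l. (1 - ?s m) ^ i) = exp (- real a) * (1 - (1 - ?s m) ^ l) / ?s m"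
      using surv_pos[of m] by simp
    also have "\<dots> \<le> card (isos t0 t0) *
        P.prob {k. survives m k \<and> rgraph_iso t0 (rball r (gw_tree k))} / ?s m"
      using gw_isos_lower[OF rm, of \<kappa>] surv_pos[of m] unfolding t0_def a_def l_def W_def
      by (intro divide_right_mono) auto
    finally show "exp (- real a) * (\<Sum>i<l. (1 - ?s m) ^ i) \<le> card (isos t0 t0) * measure (gw_conditioned ?\<xi> m) ?A"
      unfolding gwc by simp
  qed
qed

section \<open>Spanning trees as Galton--Watson trees\<close>

context finite_conn_graph
begin

text \<open>The edge from \<open>v\<close> to \<open>u\<close> is oriented by the side on which the
  root lies after its removal, so the parent relation is expressed through \<open>conn\<close> like
  everything else about trees.\<close>

definition children :: "'a set set \<Rightarrow> 'a \<Rightarrow> 'a \<Rightarrow> 'a set" where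
  "children T \<rho> v = {u. {v, u} \<in> T \<and> (\<rho>, v) \<in> conn (T - {{v, u}})}"

context
  fixes T :: "'a set set" and \<rho> :: 'a
  assumes T: "T \<in> trees" and \<rho>: "\<rho> \<in> V"
begin

lemma children_edge: "u \<in> children T \<rho> v \<Longrightarrow> {v, u} \<in> T \<and> u \<in> V \<and> v \<in> V"
  using treesD(1)[OF T] edge_in_V[of v u] by (auto simp: children_def)

lemma finite_children: "finite (children T \<rho> v)"
  using children_edge by (intro finite_subset[OF _ finite_V]) auto

lemma root_not_child: "\<rho> \<notin> children T \<rho> v"
proof
  assume "\<rho> \<in> children T \<rho> v"
  then have "{v, \<rho>} \<in> T" "(\<rho>, v) \<in> conn (T - {{v, \<rho>}})" by (auto simp: children_def)
  then show False using bridgesD[OF treesD(2)[OF T], of v \<rho>] conn_sym by metis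
qed

lemma edge_child: "{u, v} \<in> T \<Longrightarrow> v \<in> children T \<rho> u \<or> u \<in> children T \<rho> v"
  using tree_sides[OF T _ \<rho>, of u v] unfolding children_def
  by (auto simp: insert_commute intro: conn_sym)

text \<open>Removing either parent edge separates \<open>v\<close> from the root, so a connection
  from the root to \<open>v\<close> through one parent cannot avoid the edge from the other.\<close>

lemma parent_unique:
  assumes u: "v \<in> children T \<rho> u" and u': "v \<in> children T \<rho> u'"
  shows "u = u'"
proof (rule ccontr)
  assume ne: "u \<noteq> u'"
  note br = bridgesD[OF treesD(2)[OF T]]
  have e: "{u, v} \<in> T" "(\<rho>, u) \<in> conn (T - {{u, v}})" using u by (auto simp: children_def)
  have e': "{u', v} \<in> T" "(\<rho>, u') \<in> conn (T - {{u', v}})" using u' by (auto simp: children_def)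
  have d: "{u, v} \<noteq> {u', v}" using ne by (auto simp: doubleton_eq_iff)
  let ?H = "T - {{u', v}} - {{u, v}}"
  have sub: "conn ?H \<subseteq> conn (T - {{u, v}})" "conn ?H \<subseteq> conn (T - {{u', v}})"
    by (intro conn_mono; auto)+
  have nv: "(\<rho>, v) \<notin> conn (T - {{u, v}})"
    using br[OF e(1)] e(2) by (meson conn_sym conn_trans)
  have "insert {u, v} ?H = T - {{u', v}}" using e(1) d by auto
  then have "(\<rho>, u') \<in> conn (insert {u, v} ?H)" using e'(2) by simp
  then consider "(\<rho>, u') \<in> conn ?H" | "(v, u') \<in> conn ?H" | "(\<rho>, v) \<in> conn ?H"
    unfolding conn_insert by blast
  then show False
  proof cases
    case 1
    have "(u', v) \<in> conn (T - {{u, v}})" by (rule conn_edge) (use e'(1) d in auto)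
    then show False using 1 sub nv by (meson conn_trans subsetD)
  next
    case 2
    then have "(u', v) \<in> conn (T - {{u', v}})" using sub conn_sym by (meson subsetD)
    then show False using br[OF e'(1)] by simp
  next
    case 3
    then show False using sub nv by blast
  qed
qed

text \<open>Enumerate the children of every vertex and read a word as a sequence of choices from the
  root. Hence balls in spanning trees are balls of trees \<open>gw_tree \<kappa>\<close>, and other
  classes do not occur.\<close>

lemma tree_iso_gw: "\<exists>\<kappa>. rgraph_iso (gw_tree \<kappa>) ((V, T), \<rho>)"
proof -
  have "\<exists>e. bij_betw e {..<card (children T \<rho> v)} (children T \<rho> v)" for v
    using ex_bij_betw_nat_finite[OF finite_children[of v]] by (simp add: atLeast0LessThan)
  then obtain e where e: "\<And>v. bij_betw (e v) {..<card (children T \<rho> v)} (children T \<rho> v)" by metis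
  define \<psi> where "\<psi> w = foldl e \<rho> w" for w
  define \<kappa> where "\<kappa> w = card (children T \<rho> (\<psi> w))" for w
  have \<psi>_Nil: "\<psi> [] = \<rho>" by (simp add: \<psi>_def)
  have \<psi>_snoc: "\<psi> (w @ [i]) = e (\<psi> w) i" for w i by (simp add: \<psi>_def)
  have child: "\<psi> (w @ [i]) \<in> children T \<rho> (\<psi> w)" if "i < \<kappa> w" for w i
    using bij_betwE[OF e[of "\<psi> w"]] that by (simp add: \<psi>_snoc \<kappa>_def)
  have inV: "\<psi> w \<in> V" if "w \<in> gw_verts \<kappa>" for w
    using that
  proof (induction w rule: rev_induct)
    case (snoc i w)
    then show ?case using child[of i w] children_edge by (auto simp: gw_verts_snoc)
  qed (simp add: \<psi>_Nil \<rho>)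
  have last_child: "\<psi> w \<in> children T \<rho> (\<psi> (butlast w))" if "w \<in> gw_verts \<kappa>" "w \<noteq> []" for w
    using child[of "last w" "butlast w"] gw_verts_butlast[OF that] that(2) by simp
  have inj: "u = v" if "u \<in> gw_verts \<kappa>" "v \<in> gw_verts \<kappa>" "\<psi> u = \<psi> v" for u v
    using that
  proof (induction u arbitrary: v rule: rev_induct)
    case Nil
    then show ?case using last_child[of v] root_not_child by (metis \<psi>_Nil)
  next
    case (snoc i u)
    have "v \<noteq> []"
      using last_child[OF snoc.prems(1)] snoc.prems(3) root_not_child \<psi>_Nil by auto
    then obtain v' j where v: "v = v' @ [j]" by (cases v rule: rev_cases) auto
    have u: "u \<in> gw_verts \<kappa>" "i < \<kappa> u" and v': "v' \<in> gw_verts \<kappa>" "j < \<kappa> v'"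
      using snoc.prems v by (auto simp: gw_verts_snoc)
    have "\<psi> u = \<psi> v'"
      using parent_unique[OF child[OF u(2)]] child[OF v'(2)] snoc.prems(3) v by simp
    then have "u = v'" using snoc.IH[OF u(1) v'(1)] by simp
    moreover have "e (\<psi> u) i = e (\<psi> u) j" using snoc.prems(3) v \<open>u = v'\<close> by (simp add: \<psi>_snoc)
    then have "i = j"
      using bij_betw_imp_inj_on[OF e[of "\<psi> u"]] u(2) v'(2) \<open>u = v'\<close> by (auto simp: \<kappa>_def dest: inj_onD)
    ultimately show ?case using v by simp
  qed
  \<comment> \<open>The image contains the root and is closed under tree edges, so it is all of
    \<open>V\<close> by connectivity.\<close>
  have step: "y \<in> \<psi> ` gw_verts \<kappa>" if x: "x \<in> \<psi> ` gw_verts \<kappa>" and xy: "{x, y} \<in> T" for x y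
  proof -
    obtain w where w: "w \<in> gw_verts \<kappa>" "x = \<psi> w" using x by blast
    from edge_child[OF xy] show ?thesis
    proof
      assume "y \<in> children T \<rho> x"
      then obtain i where "i < \<kappa> w" "y = e x i"
        using e[of x] w(2) unfolding bij_betw_def \<kappa>_def by (metis imageE lessThan_iff)
      then show ?thesis using w by (intro image_eqI[of _ _ "w @ [i]"]) (auto simp: \<psi>_snoc gw_verts_snoc)
    next
      assume xc: "x \<in> children T \<rho> y"
      have "w \<noteq> []" using root_not_child xc w(2) \<psi>_Nil by auto
      then have "y = \<psi> (butlast w)" "butlast w \<in> gw_verts \<kappa>"
        using parent_unique[OF xc] last_child[OF w(1)] w gw_verts_butlast[OF w(1)] by auto
      then show ?thesis by blast
    qed
  qed
  have surj: "v \<in> \<psi> ` gw_verts \<kappa>" if "v \<in> V" for v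
  proof -
    have "(\<rho>, v) \<in> conn T" using treesD(3)[OF T \<rho> that] .
    then show ?thesis unfolding conn_def
    proof (induction rule: rtrancl_induct)
      case base
      show ?case by (rule image_eqI[of _ _ "[]"]) (simp_all add: \<psi>_Nil gw_verts.root)
    next
      case (step y z)
      then show ?case using \<open>\<And>x y. x \<in> \<psi> ` gw_verts \<kappa> \<Longrightarrow> {x, y} \<in> T \<Longrightarrow> y \<in> \<psi> ` gw_verts \<kappa>\<close>[of y z] by auto
    qed
  qed
  have ch_iff: "\<psi> v \<in> children T \<rho> (\<psi> u) \<longleftrightarrow> v \<noteq> [] \<and> u = butlast v"
    if "u \<in> gw_verts \<kappa>" "v \<in> gw_verts \<kappa>" for u v
  proof
    assume c: "\<psi> v \<in> children T \<rho> (\<psi> u)"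
    then have "v \<noteq> []" using root_not_child \<psi>_Nil by auto
    moreover have "\<psi> u = \<psi> (butlast v)" using parent_unique[OF c last_child[OF that(2) \<open>v \<noteq> []\<close>]] .
    then have "u = butlast v" using inj[OF that(1)] gw_verts_butlast[OF that(2) \<open>v \<noteq> []\<close>] by blast
    ultimately show "v \<noteq> [] \<and> u = butlast v" by simp
  qed (use last_child that in auto)
  have "iso_map \<psi> (gw_tree \<kappa>) ((V, T), \<rho>)" unfolding iso_map_def
  proof (intro conjI ballI)
    show "bij_betw \<psi> (verts (fst (gw_tree \<kappa>))) (verts (fst ((V, T), \<rho>)))"
      using inj inV surj by (auto simp: bij_betw_def inj_on_def)
    fix u v assume "u \<in> verts (fst (gw_tree \<kappa>))" "v \<in> verts (fst (gw_tree \<kappa>))"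
    then have uv: "u \<in> gw_verts \<kappa>" "v \<in> gw_verts \<kappa>" by auto
    have "{\<psi> u, \<psi> v} \<in> T \<longleftrightarrow> \<psi> v \<in> children T \<rho> (\<psi> u) \<or> \<psi> u \<in> children T \<rho> (\<psi> v)"
      using edge_child[of "\<psi> u" "\<psi> v"] children_edge[of "\<psi> v" "\<psi> u"] children_edge[of "\<psi> u" "\<psi> v"]
      by (auto simp: insert_commute)
    then show "{u, v} \<in> edges (fst (gw_tree \<kappa>)) \<longleftrightarrow> {\<psi> u, \<psi> v} \<in> edges (fst ((V, T), \<rho>))"
      unfolding gw_tree_edge_iff using ch_iff[OF uv] ch_iff[OF uv(2,1)] uv by auto
  qed (simp add: \<psi>_Nil)
  then show ?thesis by (auto simp: rgraph_iso_iff)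
qed

end

end

section \<open>Degrees and tightness\<close>

definition rdeg :: "'a rgraph \<Rightarrow> nat" where
  "rdeg X = card (nbrs (fst X) (snd X))"

text \<open>The star with \<open>j\<close> leaves, written as a ball of some \<open>gw_tree\<close>
  so that the bounds for such balls apply.\<close>

definition star :: "nat \<Rightarrow> nat list rgraph" where
  "star j = rball (Suc 0) (gw_tree (\<lambda>_. j))"

lemma bverts_1_gw: "bverts (Suc 0) (gw_tree k) = insert [] ((\<lambda>i. [i]) ` {..<k []})"
  unfolding bverts_gw_tree
  using gw_verts_snoc[of "[]" _ k] gw_verts.root[of k]
  by (auto simp: le_Suc_eq length_Suc_conv)

lemma card_bverts_1_gw: "card (bverts (Suc 0) (gw_tree k)) = Suc (k [])"
  unfolding bverts_1_gw by (subst card_insert_disjoint) (auto simp: card_image inj_on_def)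

lemma bverts_1: "rgraph X \<Longrightarrow> bverts (Suc 0) X = insert (snd X) (nbrs (fst X) (snd X))"
proof -
  assume X: "rgraph X"
  have "v \<in> verts (fst X)" if "v \<in> nbrs (fst X) (snd X)" for v
    using adj_verts[OF rgraphD(1)[OF X], of "snd X" v] that by (simp add: nbrs_def adj_iff)
  then show ?thesis using rgraphD(4)[OF X]
    by (auto simp: bverts_def le_Suc_eq nbrs_def adj_iff)
qed

lemma card_bverts_1: "rgraph X \<Longrightarrow> card (bverts (Suc 0) X) = Suc (rdeg X)"
proof -
  assume X: "rgraph X"
  have "finite (nbrs (fst X) (snd X))" using rgraphD(3,4)[OF X] by (simp add: locally_finite_def)
  moreover have "snd X \<notin> nbrs (fst X) (snd X)"
    using rgraphD(1)[OF X] by (auto simp: simple_graph_def nbrs_def)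
  ultimately show ?thesis unfolding bverts_1[OF X] rdeg_def by simp
qed

text \<open>An automorphism fixes the centre and permutes the leaves. The permutation is continued
  by the identity beyond \<open>j\<close>, as \<open>permutes\<close> demands.\<close>

lemma card_isos_star: "card (isos (star j) (star j)) \<le> fact j"
proof -
  let ?W = "bverts (Suc 0) (gw_tree (\<lambda>_. j))"
  let ?P = "\<lambda>f i. if i < j then last (f [i]) else i"
  have W: "verts (fst (star j)) = ?W" "snd (star j) = []" by (simp_all add: star_def)
  have fix1: "f [] = []" "bij_betw f ?W ?W" if "f \<in> isos (star j) (star j)" for f
    using that unfolding isos_def iso_map_def W by auto
  have leaf: "\<exists>i'<j. f [i] = [i']" if f: "f \<in> isos (star j) (star j)" and i: "i < j" for f i
  proof -
    have iW: "[i] \<in> ?W" "[] \<in> ?W" using i by (auto simp: bverts_1_gw)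
    then have "f [i] \<in> ?W" using bij_betwE[OF fix1(2)[OF f]] by blast
    moreover have "f [i] \<noteq> f []"
      using inj_onD[OF bij_betw_imp_inj_on[OF fix1(2)[OF f]], of "[i]" "[]"] iW by auto
    ultimately show ?thesis using fix1(1)[OF f] by (auto simp: bverts_1_gw)
  qed
  have "card (isos (star j) (star j)) \<le> card {p. p permutes {..<j}}"
  proof (rule card_inj_on_le[of ?P])
    show "?P ` isos (star j) (star j) \<subseteq> {p. p permutes {..<j}}"
    proof clarify
      fix f assume f: "f \<in> isos (star j) (star j)"
      have "inj_on (?P f) {..<j}"
      proof (rule inj_onI)
        fix a b assume ab: "a \<in> {..<j}" "b \<in> {..<j}" "?P f a = ?P f b"
        then have "f [a] = f [b]" using leaf[OF f, of a] leaf[OF f, of b] by auto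
        then show "a = b"
          using inj_onD[OF bij_betw_imp_inj_on[OF fix1(2)[OF f]], of "[a]" "[b]"] ab by (auto simp: bverts_1_gw)
      qed
      moreover have "?P f ` {..<j} \<subseteq> {..<j}" using leaf[OF f] by fastforce
      ultimately have "bij_betw (?P f) {..<j} {..<j}"
        unfolding bij_betw_def using endo_inj_surj[OF finite_lessThan, of "?P f" j] by blast
      then show "?P f permutes {..<j}" by (rule bij_imp_permutes) auto
    qed
    show "inj_on ?P (isos (star j) (star j))"
    proof (rule inj_onI)
      fix f g assume fg: "f \<in> isos (star j) (star j)" "g \<in> isos (star j) (star j)" "?P f = ?P g"
      show "f = g"
      proof (rule extensionalityI[of _ ?W])
        fix w assume "w \<in> ?W"
        then consider "w = []" | i where "i < j" "w = [i]" by (auto simp: bverts_1_gw)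
        then show "f w = g w"
        proof cases
          case (2 i)
          then show ?thesis using leaf[OF fg(1), of i] leaf[OF fg(2), of i] fun_cong[OF fg(3), of i] by auto
        qed (simp add: fix1 fg)
      qed (use fg in \<open>auto simp: isos_def W\<close>)
    qed
  qed (simp add: finite_permutations)
  also have "\<dots> = fact j" by (simp add: card_permutations)
  finally show ?thesis .
qed

text \<open>The limiting root degree has the size-biased Poisson law, whose mean is the second
  moment 2 of Poisson(1). It agrees with the limit of the mean degree of a spanning tree.\<close>

lemma sums_size_biased: "(\<lambda>j. real j * (real j * exp (- 1) / fact j)) sums 2"
proof -
  have e: "(\<lambda>i. 1 / fact i :: real) sums exp 1"
    using exp_converges[of "1::real"] by (simp add: divide_inverse)
  have "(\<lambda>i. real (Suc i) / fact (Suc i)) = (\<lambda>i. 1 / fact i)"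
    by (rule ext) (simp del: of_nat_Suc)
  then have "(\<lambda>i. real i / fact i) sums exp 1"
    using e sums_Suc_iff[of "\<lambda>i. real i / fact i" "exp 1"] by simp
  then have "(\<lambda>i. real i / fact i + 1 / fact i) sums (exp 1 + exp 1)" using e by (rule sums_add)
  moreover have "(\<lambda>i. real i / fact i + 1 / fact i) = (\<lambda>i. real (Suc i) * real (Suc i) / fact (Suc i))"
    by (rule ext) (simp add: add_divide_distrib del: of_nat_Suc; simp add: add_divide_distrib)
  ultimately have "(\<lambda>j. real j * real j / fact j) sums (exp 1 + exp 1)"
    using sums_Suc_iff[of "\<lambda>i. real i * real i / fact i" "exp 1 + exp 1"] by simp
  then have "(\<lambda>j. exp (- 1) * (real j * real j / fact j)) sums (exp (- 1) * (exp 1 + exp 1))"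
    by (rule sums_mult)
  moreover have "exp (- 1) * (exp 1 + exp 1) = (2 :: real)" by (simp add: exp_minus)
  moreover have "(\<lambda>j. exp (- 1) * (real j * real j / fact j)) = (\<lambda>j. real j * (real j * exp (- 1) / fact j))"
    by (simp add: fun_eq_iff)
  ultimately show ?thesis by (simp only:)
qed

lemma (in regular_graph) sum_rdeg:
  assumes T: "T \<in> trees"
  shows "(\<Sum>\<rho>\<in>V. rdeg ((V, T), \<rho>)) = 2 * (card V - 1)"
proof -
  have "arcs T = Sigma V (tnb T)"
    using treesD(1)[OF T] edge_in_V by (auto simp: arcs_def tnb_def)
  then have "card (arcs T) = (\<Sum>\<rho>\<in>V. card (tnb T \<rho>))"
    using finite_V finite_tnb[OF T] by (simp add: card_SigmaI)
  moreover have "card (arcs T) = 2 * (card V - 1)"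
    using card_arcs[OF treesD(1)[OF T]] card_tree[OF T] by simp
  ultimately show ?thesis by (simp add: rdeg_def nbrs_def tnb_def)
qed

text \<open>A degree bound inside the ball bounds its number of vertices, hence leaves finitely many
  classes.\<close>

definition nice :: "nat \<Rightarrow> nat \<Rightarrow> 'a rgraph \<Rightarrow> bool" where
  "nice D r X \<longleftrightarrow> (\<forall>v\<in>bverts r X. card (nbrs (fst X) v) \<le> D)"

context regular_graph
begin

lemma nice_degree:
  assumes "nice D r ((V, T), \<rho>)" "T \<in> trees" "\<rho> \<in> V" "(\<rho>, v) \<in> adj (V, T) ^^ j" "j \<le> r"
  shows "card (tnb T v) \<le> D"
proof -
  have "v \<in> V"
  proof (cases j)
    case 0
    then show ?thesis using assms by simp
  next
    case (Suc i)
    then obtain u where "(u, v) \<in> adj (V, T)" using assms(4) by auto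
    then show ?thesis using adj_verts[OF rgraphD(1)[OF rgraph_tree[OF assms(2,3)]], of u v] by simp
  qed
  then have "v \<in> bverts r ((V, T), \<rho>)" using assms(4,5) by (auto simp: bverts_def)
  then show ?thesis using assms(1) by (auto simp: nice_def nbrs_def tnb_def)
qed

lemma reach_outward:
  assumes X: "nice D r ((V, T), \<rho>)" "T \<in> trees" "\<rho> \<in> V"
  shows "(\<rho>, v) \<in> adj (V, T) ^^ j \<Longrightarrow> j \<le> r \<Longrightarrow> v \<in> reach T D j \<rho>"
proof (induction j arbitrary: v)
  case (Suc j)
  then obtain u where u: "(\<rho>, u) \<in> adj (V, T) ^^ j" "{u, v} \<in> T" by (auto simp: adj_iff)
  then have "u \<in> reach T D j \<rho>" "card (tnb T u) \<le> D"
    using Suc nice_degree[OF X u(1)] by auto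
  then show ?case using u(2) by (auto simp: tnb_def)
qed simp

lemma card_bverts_nice:
  assumes X: "nice D r ((V, T), \<rho>)" "T \<in> trees" "\<rho> \<in> V"
  shows "card (bverts r ((V, T), \<rho>)) \<le> (\<Sum>j\<le>r. D ^ j)"
proof -
  have "bverts r ((V, T), \<rho>) \<subseteq> (\<Union>j\<in>{..r}. reach T D j \<rho>)"
    using reach_outward[OF X] by (auto simp: bverts_def)
  then have "card (bverts r ((V, T), \<rho>)) \<le> card (\<Union>j\<in>{..r}. reach T D j \<rho>)"
    using finite_reach[OF X(2)] by (intro card_mono) auto
  also have "\<dots> \<le> (\<Sum>j\<le>r. card (reach T D j \<rho>))" by (rule card_UN_le) simp
  also have "\<dots> \<le> (\<Sum>j\<le>r. D ^ j)" by (rule sum_mono[OF card_reach_le[OF X(2)]])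
  finally show ?thesis .
qed

text \<open>The walk is reversed, from \<open>v\<close> back to \<open>x\<close>. Every vertex it
  leaves, \<open>v\<close> included, is within distance \<open>r\<close> of the root, where niceness
  bounds the degree.\<close>

lemma reach_inward:
  assumes X: "nice D r ((V, T), \<rho>)" "T \<in> trees" "\<rho> \<in> V"
  shows "(\<rho>, x) \<in> adj (V, T) ^^ i \<Longrightarrow> (x, v) \<in> adj (V, T) ^^ j \<Longrightarrow> i + j \<le> r \<Longrightarrow> x \<in> reach T D j v"
proof (induction j arbitrary: x i)
  case (Suc j)
  obtain y where y: "(x, y) \<in> adj (V, T)" "(y, v) \<in> adj (V, T) ^^ j"
    using relpow_Suc_D2[OF Suc.prems(2)] by auto
  have \<rho>y: "(\<rho>, y) \<in> adj (V, T) ^^ Suc i" using Suc.prems(1) y(1) by auto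
  have "y \<in> reach T D j v" using Suc.IH[OF \<rho>y y(2)] Suc.prems(3) by simp
  moreover have "card (tnb T y) \<le> D" using nice_degree[OF X \<rho>y] Suc.prems(3) by simp
  moreover have "x \<in> tnb T y" using y(1) by (simp add: tnb_def adj_iff insert_commute)
  ultimately show ?case by auto
qed simp

text \<open>Mass transport from vertices \<open>v\<close> of degree above \<open>D'\<close> to the
  roots that see them first at radius \<open>Suc r\<close>. The first step from \<open>v\<close> can
  go to any of its neighbours, whence the weight \<open>rdeg\<close>; the other \<open>r\<close>
  steps pass vertices of degree at most \<open>D\<close>.\<close>

lemma card_not_nice_Suc:
  assumes T: "T \<in> trees" and D: "D \<le> D'"
  shows "card {\<rho>\<in>V. nice D r ((V, T), \<rho>) \<and> \<not> nice D' (Suc r) ((V, T), \<rho>)} \<le>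
    D ^ r * (\<Sum>v\<in>V. rdeg ((V, T), v) * of_bool (rdeg ((V, T), v) > D'))"
proof -
  let ?B = "{v\<in>V. rdeg ((V, T), v) > D'}"
  have rd: "rdeg ((V, T), v) = card (tnb T v)" for v by (simp add: rdeg_def nbrs_def tnb_def)
  have "{\<rho>\<in>V. nice D r ((V, T), \<rho>) \<and> \<not> nice D' (Suc r) ((V, T), \<rho>)} \<subseteq>
      (\<Union>v\<in>?B. \<Union>u\<in>tnb T v. reach T D r u)"
  proof clarify
    fix \<rho> assume \<rho>: "\<rho> \<in> V" and n: "nice D r ((V, T), \<rho>)" "\<not> nice D' (Suc r) ((V, T), \<rho>)"
    obtain v where v: "v \<in> bverts (Suc r) ((V, T), \<rho>)" "card (tnb T v) > D'"
      using n(2) by (auto simp: nice_def nbrs_def tnb_def not_le)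
    then obtain j where j: "j \<le> Suc r" "(\<rho>, v) \<in> adj (V, T) ^^ j" "v \<in> V" by (auto simp: bverts_def)
    \<comment> \<open>Within radius \<open>r\<close> all degrees are at most
      \<open>D \<le> D'\<close>, so \<open>v\<close> lies exactly at distance
      \<open>Suc r\<close>.\<close>
    have "\<not> j \<le> r" using nice_degree[OF n(1) T \<rho> j(2)] v(2) D by auto
    then have "(\<rho>, v) \<in> adj (V, T) ^^ Suc r" using j by (simp add: le_Suc_eq del: relpow.simps)
    then obtain u where u: "(\<rho>, u) \<in> adj (V, T) ^^ r" "(u, v) \<in> adj (V, T)" by auto
    have "\<rho> \<in> reach T D r u" using reach_inward[OF n(1) T \<rho>, of \<rho> 0 u r] u(1) by simp
    moreover have "u \<in> tnb T v" using u(2) by (simp add: tnb_def adj_iff insert_commute)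
    ultimately show "\<rho> \<in> (\<Union>v\<in>?B. \<Union>u\<in>tnb T v. reach T D r u)" using j(3) v(2) by (auto simp: rd)
  qed
  then have "card {\<rho>\<in>V. nice D r ((V, T), \<rho>) \<and> \<not> nice D' (Suc r) ((V, T), \<rho>)} \<le>
      card (\<Union>v\<in>?B. \<Union>u\<in>tnb T v. reach T D r u)"
    using finite_V finite_tnb[OF T] finite_reach[OF T] by (intro card_mono) auto
  also have "\<dots> \<le> (\<Sum>v\<in>?B. card (\<Union>u\<in>tnb T v. reach T D r u))"
    by (rule card_UN_le) (use finite_V in simp)
  also have "\<dots> \<le> (\<Sum>v\<in>?B. rdeg ((V, T), v) * D ^ r)"
  proof (rule sum_mono)
    fix v
    have "card (\<Union>u\<in>tnb T v. reach T D r u) \<le> (\<Sum>u\<in>tnb T v. card (reach T D r u))"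
      by (rule card_UN_le[OF finite_tnb[OF T]])
    also have "\<dots> \<le> (\<Sum>u\<in>tnb T v. D ^ r)" by (rule sum_mono[OF card_reach_le[OF T]])
    finally show "card (\<Union>u\<in>tnb T v. reach T D r u) \<le> rdeg ((V, T), v) * D ^ r" by (simp add: rd)
  qed
  also have "\<dots> = (\<Sum>v\<in>V. D ^ r * (rdeg ((V, T), v) * of_bool (rdeg ((V, T), v) > D')))"
    by (rule sum.mono_neutral_cong_left) (use finite_V in auto)
  finally show ?thesis by (simp add: sum_distrib_left)
qed

end

section \<open>Convergence in law on a countable discrete space\<close>

text \<open>A Scheffe argument: upper bounds on the atoms suffice because both laws have mass 1. On
  a finite set that carries almost all mass of \<open>P n\<close>, the positive parts of
  \<open>p - q\<close> are small, and equal total mass makes the negative parts small too.\<close>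

lemma pmf_convergence:
  fixes P :: "nat \<Rightarrow> 'b :: metric_space pmf" and N :: "'b measure" and f :: "'b \<Rightarrow> real"
  assumes N: "prob_space N" "sets N = sets borel"
    and le: "\<And>c \<epsilon>. \<epsilon> > 0 \<Longrightarrow> \<forall>\<^sub>F n in sequentially. pmf (P n) c \<le> measure N {c} + \<epsilon>"
    and tight: "\<And>\<epsilon>. \<epsilon> > 0 \<Longrightarrow> \<exists>S. finite S \<and> (\<forall>\<^sub>F n in sequentially. measure_pmf.prob (P n) (- S) \<le> \<epsilon>)"
    and f: "f \<in> borel_measurable borel" "\<And>x. \<bar>f x\<bar> \<le> B"
  shows "(\<lambda>n. measure_pmf.expectation (P n) f) \<longlonglongrightarrow> (\<integral>x. f x \<partial>N)"
proof (rule LIMSEQ_I)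
  fix e :: real assume e: "e > 0"
  interpret N: prob_space N by fact
  have B: "B \<ge> 0" using f(2)[of undefined] by linarith
  \<comment> \<open>The errors below add up to \<open>6 * B * \<eta>\<close>; the seventh part makes
    the final inequality strict, and \<open>B + 1\<close> covers \<open>B = 0\<close>.\<close>
  define \<eta> where "\<eta> = e / (7 * (B + 1))"
  have \<eta>: "\<eta> > 0" using e B by (simp add: \<eta>_def)
  obtain S where S: "finite S" "\<forall>\<^sub>F n in sequentially. measure_pmf.prob (P n) (- S) \<le> \<eta>"
    using tight[OF \<eta>] by blast
  define \<epsilon> where "\<epsilon> = \<eta> / (card S + 1)"
  have \<epsilon>: "\<epsilon> > 0" using \<eta> by (simp add: \<epsilon>_def)
  have sumS: "card S * \<epsilon> \<le> \<eta>" using \<eta> by (simp add: \<epsilon>_def field_simps)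
  have "\<forall>\<^sub>F n in sequentially. \<forall>c\<in>S. pmf (P n) c \<le> measure N {c} + \<epsilon>"
    using S(1) le[OF \<epsilon>] by (intro eventually_ball_finite) auto
  then have ev: "\<forall>\<^sub>F n in sequentially. (\<forall>c\<in>S. pmf (P n) c \<le> measure N {c} + \<epsilon>) \<and> measure_pmf.prob (P n) (- S) \<le> \<eta>"
    using S(2) by (rule eventually_conj)
  have sing: "{c} \<in> sets N" for c unfolding N(2) by (rule borel_closed) simp
  have setS: "S \<in> sets N" unfolding N(2) using S(1) by (intro borel_closed finite_imp_closed)
  have fN: "f \<in> borel_measurable N" using f(1) measurable_cong_sets[OF N(2) refl] by blast
  have measS: "measure N S = (\<Sum>c\<in>S. measure N {c})"
    using N.finite_measure_eq_sum_singleton[OF S(1)] sing by blast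
  have restrict: "\<bar>(\<integral>x. f x \<partial>M) - (\<Sum>c\<in>S. f c * measure M {c})\<bar> \<le> B * measure M (- S)"
    if M: "prob_space M" "f \<in> borel_measurable M" "\<And>c. {c} \<in> sets M" "space M = UNIV" for M :: "'b measure"
  proof -
    interpret M: prob_space M by fact
    have SM: "S \<in> sets M" using sets.finite_UN[of S "\<lambda>c. {c}" M] S(1) M(3) by simp
    have int: "integrable M f"
      by (rule M.integrable_const_bound[of _ B]) (use f(2) M(2) in auto)
    have ind: "integrable M (\<lambda>x. indicator S x * f x)" "integrable M (\<lambda>x. indicator (- S) x * f x)"
      by (rule M.integrable_const_bound[of _ B]; use f(2) M(2) SM M(4) B in \<open>auto simp: indicator_def Compl_eq_Diff_UNIV intro: sets.compl_sets\<close>)+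
    have "(\<integral>x. f x \<partial>M) = (\<integral>x. indicator S x * f x + indicator (- S) x * f x \<partial>M)"
      by (rule Bochner_Integration.integral_cong) (auto simp: indicator_def)
    also have "\<dots> = (\<integral>x. indicator S x * f x \<partial>M) + (\<integral>x. indicator (- S) x * f x \<partial>M)"
      by (rule Bochner_Integration.integral_add[OF ind])
    also have "(\<integral>x. indicator S x * f x \<partial>M) = (\<integral>x. (\<Sum>c\<in>S. f c * indicator {c} x) \<partial>M)"
      using S(1) by (intro Bochner_Integration.integral_cong refl) (auto simp: indicator_def sum.delta if_distrib cong: if_cong)
    also have "\<dots> = (\<Sum>c\<in>S. f c * measure M {c})"
      using M(3) M(4) by (subst Bochner_Integration.integral_sum) (auto simp: M.emeasure_eq_measure)
    finally have "(\<integral>x. f x \<partial>M) - (\<Sum>c\<in>S. f c * measure M {c}) = (\<integral>x. indicator (- S) x * f x \<partial>M)" by simp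
    also have "\<bar>\<dots>\<bar> \<le> (\<integral>x. \<bar>indicator (- S) x * f x\<bar> \<partial>M)" by (rule integral_abs_bound)
    also have "\<dots> \<le> (\<integral>x. B * indicator (- S) x \<partial>M)"
    proof (rule integral_mono)
      show "integrable M (\<lambda>x. \<bar>indicator (- S) x * f x\<bar>)" using ind(2) by (rule integrable_abs)
      have "- S \<in> sets M" using SM M(4) by (metis Compl_eq_Diff_UNIV sets.compl_sets)
      then show "integrable M (\<lambda>x. B * indicator (- S) x)" by (simp add: M.emeasure_eq_measure)
    qed (use f(2) in \<open>auto simp: indicator_def\<close>)
    also have "\<dots> = B * measure M (- S)" using M(4) by simp
    finally show ?thesis .
  qed
  have spN: "space N = UNIV" using sets_eq_imp_space_eq[OF N(2)] by simp
  have "norm (measure_pmf.expectation (P n) f - (\<integral>x. f x \<partial>N)) < e"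
    if n: "\<forall>c\<in>S. pmf (P n) c \<le> measure N {c} + \<epsilon>" "measure_pmf.prob (P n) (- S) \<le> \<eta>" for n
  proof -
    let ?p = "pmf (P n)" and ?q = "\<lambda>c. measure N {c}"
    have p1: "(\<Sum>c\<in>S. ?p c) = 1 - measure_pmf.prob (P n) (- S)"
      using measure_measure_pmf_finite[OF S(1), of "P n"] measure_pmf.prob_compl[of S "P n"]
      by (simp add: Compl_eq_Diff_UNIV)
    have q1: "(\<Sum>c\<in>S. ?q c) = 1 - measure N (- S)"
      using N.prob_compl[OF setS] spN measS by (simp add: Compl_eq_Diff_UNIV)
    have "(\<Sum>c\<in>S. ?p c) \<le> (\<Sum>c\<in>S. ?q c + \<epsilon>)" by (rule sum_mono) (use n(1) in auto)
    then have pq: "(\<Sum>c\<in>S. ?p c) \<le> (\<Sum>c\<in>S. ?q c) + \<eta>" using sumS by (simp add: sum.distrib)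
    \<comment> \<open>On \<open>S\<close> the limit law has at least the mass of \<open>P n\<close>
      up to \<open>\<eta>\<close>, so it inherits tightness.\<close>
    then have qS: "measure N (- S) \<le> 2 * \<eta>" using p1 q1 n(2) by linarith
    \<comment> \<open>The absolute value is \<open>q - p\<close> plus twice the positive part of
      \<open>p - q\<close>, and the latter is at most \<open>\<epsilon>\<close>.\<close>
    have abs_le: "\<bar>?p c - ?q c\<bar> \<le> 2 * \<epsilon> + (?q c - ?p c)" if "c \<in> S" for c
      using n(1) that \<epsilon> by (auto simp: abs_if)
    have "(\<Sum>c\<in>S. \<bar>?p c - ?q c\<bar>) \<le> (\<Sum>c\<in>S. 2 * \<epsilon> + (?q c - ?p c))" by (rule sum_mono[OF abs_le])
    also have "\<dots> = 2 * (card S * \<epsilon>) + ((\<Sum>c\<in>S. ?q c) - (\<Sum>c\<in>S. ?p c))"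
      by (simp add: sum.distrib sum_subtractf)
    also have "\<dots> \<le> 3 * \<eta>" using sumS p1 q1 n(2) measure_nonneg[of N "- S"] by linarith
    finally have tv: "(\<Sum>c\<in>S. \<bar>?p c - ?q c\<bar>) \<le> 3 * \<eta>" .
    have "\<bar>(\<Sum>c\<in>S. f c * ?p c) - (\<Sum>c\<in>S. f c * ?q c)\<bar> \<le> (\<Sum>c\<in>S. \<bar>f c * (?p c - ?q c)\<bar>)"
      using sum_abs[of "\<lambda>c. f c * (?p c - ?q c)" S] by (simp add: sum_subtractf right_diff_distrib)
    also have "\<dots> \<le> (\<Sum>c\<in>S. B * \<bar>?p c - ?q c\<bar>)"
      unfolding abs_mult by (intro sum_mono mult_right_mono f(2)) simp
    also have "\<dots> \<le> B * (3 * \<eta>)" unfolding sum_distrib_left[symmetric] by (rule mult_left_mono[OF tv B])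
    finally have 1: "\<bar>(\<Sum>c\<in>S. f c * ?p c) - (\<Sum>c\<in>S. f c * ?q c)\<bar> \<le> B * (3 * \<eta>)" .
    have 2: "\<bar>measure_pmf.expectation (P n) f - (\<Sum>c\<in>S. f c * ?p c)\<bar> \<le> B * \<eta>"
      using restrict[of "measure_pmf (P n)"] mult_left_mono[OF n(2) B]
      by (simp add: measure_pmf.prob_space_axioms measure_pmf_single)
    have 3: "\<bar>(\<integral>x. f x \<partial>N) - (\<Sum>c\<in>S. f c * ?q c)\<bar> \<le> B * (2 * \<eta>)"
      using restrict[OF N(1) fN sing spN] mult_left_mono[OF qS B] by linarith
    have "\<bar>measure_pmf.expectation (P n) f - (\<integral>x. f x \<partial>N)\<bar> \<le> B * \<eta> + B * (3 * \<eta>) + B * (2 * \<eta>)"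
      using 1 2 3 by linarith
    also have "\<dots> = 6 * (B * \<eta>)" by simp
    also have "\<dots> < 7 * ((B + 1) * \<eta>)" using B \<eta> by (simp add: algebra_simps add_nonneg_pos)
    also have "\<dots> = e"
    proof -
      have "7 * (x * (e / (7 * x))) = e" if "x \<noteq> 0" for x :: real using that by simp
      from this[of "B + 1"] show ?thesis unfolding \<eta>_def using B by linarith
    qed
    finally show ?thesis by simp
  qed
  then have "\<forall>\<^sub>F n in sequentially. norm (measure_pmf.expectation (P n) f - (\<integral>x. f x \<partial>N)) < e"
    by (intro eventually_mono[OF ev]) blast
  then show "\<exists>no. \<forall>n\<ge>no. norm (measure_pmf.expectation (P n) f - (\<integral>x. f x \<partial>N)) < e"
    by (simp add: eventually_sequentially)
qed

section \<open>Local limit of the uniform spanning tree\<close>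

lemma root_sum_mono:
  assumes "\<And>T \<rho>. T \<in> finite_conn_graph.trees (verts G) (edges G) \<Longrightarrow> \<rho> \<in> verts G \<Longrightarrow>
    f ((verts G, T), \<rho>) \<le> g ((verts G, T), \<rho>)"
  shows "root_sum G f \<le> root_sum G g"
  unfolding root_sum_def by (intro divide_right_mono sum_mono assms) auto

lemma root_sum_add: "root_sum G (\<lambda>X. f X + g X) = root_sum G f + root_sum G g"
  by (simp add: root_sum_def sum.distrib add_divide_distrib)

lemma root_sum_cmult: "root_sum G (\<lambda>X. c * f X) = c * root_sum G f"
  by (simp add: root_sum_def sum_distrib_left)

lemma root_sum_sum: "root_sum G (\<lambda>X. \<Sum>i\<in>I. f i X) = (\<Sum>i\<in>I. root_sum G (f i))"
proof (cases "finite I")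
  case True
  then show ?thesis
    by (induction I rule: finite_induct) (simp_all add: root_sum_add, simp add: root_sum_def)
qed (simp add: root_sum_def)

text \<open>For splitting a tolerance by a factor \<open>x\<close> that may vanish.\<close>

lemma mult_divide_Suc_le:
  fixes x e c :: real
  assumes "x \<ge> 0" "e \<ge> 0" "c > 0"
  shows "x * (e / (c * (x + 1))) \<le> e / c"
proof -
  have "x * (e / (c * (x + 1))) = x / (x + 1) * (e / c)"
    by (simp only: times_divide_eq_left times_divide_eq_right divide_divide_eq_left mult.commute[of c])
  also have "\<dots> \<le> 1 * (e / c)" using assms by (intro mult_right_mono) auto
  finally show ?thesis by simp
qed

lemma card_levels_star:
  "card {w \<in> bverts (Suc 0) (gw_tree (\<lambda>_. j)). length w < Suc 0} = 1"
  "card {w \<in> bverts (Suc 0) (gw_tree (\<lambda>_. j)). length w = Suc 0} = j"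
proof -
  have "{w \<in> bverts (Suc 0) (gw_tree (\<lambda>_. j)). length w < Suc 0} = {[]}"
    by (auto simp: bverts_1_gw)
  then show "card {w \<in> bverts (Suc 0) (gw_tree (\<lambda>_. j)). length w < Suc 0} = 1" by simp
  have "{w \<in> bverts (Suc 0) (gw_tree (\<lambda>_. j)). length w = Suc 0} = (\<lambda>i. [i]) ` {..<j}"
    by (auto simp: bverts_1_gw)
  then show "card {w \<in> bverts (Suc 0) (gw_tree (\<lambda>_. j)). length w = Suc 0} = j"
    by (simp add: card_image inj_on_def)
qed

lemma rgraph_star: "rgraph (star j)"
  unfolding star_def by (rule rgraph_rball[OF rgraph_gw_tree])

lemma rball_1_gw_star: "rball (Suc 0) (gw_tree k) = star (k [])"
  unfolding star_def rball_gw_eq bverts_1_gw ..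

lemma iso_class_star_inj: "iso_class (star i) = iso_class (star j) \<Longrightarrow> i = j"
proof -
  assume "iso_class (star i) = iso_class (star j)"
  then have "rgraph_iso (star i) (star j)" using iso_class_eq_iff[OF rgraph_star rgraph_star] by blast
  then obtain f where "bij_betw f (verts (fst (star i))) (verts (fst (star j)))"
    by (auto simp: rgraph_iso_iff iso_map_def)
  then have "card (bverts (Suc 0) (gw_tree (\<lambda>_. i))) = card (bverts (Suc 0) (gw_tree (\<lambda>_. j)))"
    by (auto simp: star_def dest: bij_betw_same_card)
  then show ?thesis by (simp add: card_bverts_1_gw)
qed

locale ust_sequence =
  fixes G :: "nat \<Rightarrow> 'a graph" and d :: "nat \<Rightarrow> nat" and \<mu> :: "gbullet measure"
  assumes graph: "n \<ge> 1 \<Longrightarrow> simple_graph (G n) \<and> finite (verts (G n)) \<and> gconnected (G n)"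
    and reg: "n \<ge> 1 \<Longrightarrow> regular (d n) (G n)"
    and deg: "filterlim d at_top sequentially"
    and cond: "gw_conditioned_to_survive (poisson_pmf 1) \<mu>"
begin

lemma regular_graph_G:
  assumes "n \<ge> 1" "d n \<ge> 1"
  shows "regular_graph (verts (G n)) (edges (G n)) (d n)"
proof -
  interpret finite_conn_graph "verts (G n)" "edges (G n)"
    using graph[OF assms(1)] by (intro finite_conn_graphI) auto
  show ?thesis using reg[OF assms(1)] assms(2)
    by unfold_locales (auto simp: regular_def nbrs_def)
qed

lemma eventually_deg: "\<forall>\<^sub>F n in sequentially. n \<ge> 1 \<and> d n \<ge> D \<and> d n \<ge> 1"
  using filterlim_at_top_ge[of d sequentially 0] deg eventually_ge_at_top[of "1::nat"]
  unfolding filterlim_at_top by (intro eventually_conj) auto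

abbreviation gtrees :: "nat \<Rightarrow> 'a set set set" where
  "gtrees n \<equiv> finite_conn_graph.trees (verts (G n)) (edges (G n))"

lemma tree_facts:
  assumes n: "n \<ge> 1" "d n \<ge> 1" and T: "T \<in> gtrees n" "\<rho> \<in> verts (G n)"
  shows "rgraph ((verts (G n), T), \<rho>)" "\<exists>\<kappa>. rgraph_iso (gw_tree \<kappa>) ((verts (G n), T), \<rho>)"
proof -
  interpret regular_graph "verts (G n)" "edges (G n)" "d n" using regular_graph_G[OF n] .
  show "rgraph ((verts (G n), T), \<rho>)" by (rule rgraph_tree[OF T])
  show "\<exists>\<kappa>. rgraph_iso (gw_tree \<kappa>) ((verts (G n), T), \<rho>)" by (rule tree_iso_gw[OF T])
qed

lemma root_sum_const:
  assumes n: "n \<ge> 1"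
  shows "root_sum (G n) (\<lambda>_. c) = c"
proof -
  interpret finite_conn_graph "verts (G n)" "edges (G n)"
    using graph[OF n] by (intro finite_conn_graphI) auto
  show ?thesis using finite_trees trees_nonempty finite_V V_nonempty by (simp add: root_sum_def)
qed

text \<open>With threshold \<open>d powr (-3/2)\<close> the bound of \<open>sum_isos_le\<close>,
  divided by the number of rooted trees, depends on the graph only through \<open>d n\<close>. Every
  word of the ball is inner or at level \<open>r\<close>, so \<open>k - a = l\<close>.\<close>

lemma eventually_isos_le:
  fixes \<kappa> :: "nat list \<Rightarrow> nat" and r :: nat and \<epsilon> :: real
  defines "t0 \<equiv> rball r (gw_tree \<kappa>)" and "W \<equiv> bverts r (gw_tree \<kappa>)"
  defines "a \<equiv> card {w\<in>W. length w < r}" and "l \<equiv> card {w\<in>W. length w = r}"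
  assumes \<epsilon>: "\<epsilon> > 0"
  shows "\<forall>\<^sub>F n in sequentially. root_sum (G n) (\<lambda>X. real (card (isos t0 (rball r X)))) \<le> l * exp (- real a) + \<epsilon>"
proof -
  define k where "k = card W"
  have fW: "finite W" "[] \<in> W" using word_tree_bverts[of r \<kappa>] by (auto simp: W_def word_tree_def)
  have k1: "k \<ge> 1" using fW by (metis k_def Suc_leI One_nat_def card_gt_0_iff empty_iff)
  have "W = {w\<in>W. length w < r} \<union> {w\<in>W. length w = r}" by (auto simp: W_def bverts_gw_tree)
  then have "k = card ({w\<in>W. length w < r} \<union> {w\<in>W. length w = r})" by (simp add: k_def)
  also have "\<dots> = a + l" unfolding a_def l_def by (rule card_Un_disjoint) (use fW in auto)
  finally have k: "k = a + l" .
  have ak: "a \<le> k" and kl: "k - a = l" using k by auto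
  obtain U where U: "U \<longlonglongrightarrow> real (k - a) * exp (- real a)" "\<And>d. 2 * k \<le> d \<Longrightarrow> exact_bound r k a d \<le> U d"
    using exact_bound_asymp[OF k1 ak, of r] by blast
  have "(\<lambda>n. U (d n)) \<longlonglongrightarrow> l * exp (- real a)"
    using filterlim_compose[OF U(1) deg] kl by simp
  then have "\<forall>\<^sub>F n in sequentially. U (d n) < l * exp (- real a) + \<epsilon>"
    by (rule order_tendstoD) (use \<epsilon> in simp)
  moreover have "\<forall>\<^sub>F n in sequentially. n \<ge> 1 \<and> d n \<ge> 2 * k \<and> d n \<ge> 1" by (rule eventually_deg)
  ultimately show ?thesis
  proof eventually_elim
    case (elim n)
    interpret regular_graph "verts (G n)" "edges (G n)" "d n" using regular_graph_G elim by simp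
    have pos: "real (card (verts (G n)) * card trees) > 0"
      using finite_trees trees_nonempty finite_V V_nonempty by (simp add: card_gt_0_iff)
    have "(\<Sum>T\<in>trees. \<Sum>\<rho>\<in>verts (G n). real (card (isos t0 (rball r ((verts (G n), T), \<rho>))))) \<le>
      card (verts (G n)) * card trees * exact_bound r k a (d n)"
      unfolding exact_bound_def t0_def k_def a_def W_def
      using sum_isos_le[of r \<kappa> "d n powr (-3/2)"] elim d_pos unfolding k_def W_def by simp
    then have "root_sum (G n) (\<lambda>X. real (card (isos t0 (rball r X)))) \<le> exact_bound r k a (d n)"
      unfolding root_sum_def using pos by (simp add: pos_divide_le_eq mult.commute)
    also have "\<dots> \<le> U (d n)" using U(2) elim by simp
    finally show ?case using elim by simp
  qed
qed

definition limit_prob :: "nat \<Rightarrow> gbullet \<Rightarrow> real" where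
  "limit_prob r c = measure \<mu> {y. gball r y = c}"

text \<open>A ball of class \<open>c\<close> has exactly as many isomorphisms from the reference
  ball as that ball has automorphisms. The same number stands in \<open>gw_limit_lower\<close> and
  cancels.\<close>

lemma eventually_class_le:
  assumes \<epsilon>: "\<epsilon> > 0"
  shows "\<forall>\<^sub>F n in sequentially. root_sum (G n) (\<lambda>X. of_bool (iso_class (rball r X) = c)) \<le> limit_prob r c + \<epsilon>"
proof (cases "\<exists>\<kappa>. c = iso_class (rball r (gw_tree \<kappa>))")
  case True
  then obtain \<kappa> where c: "c = iso_class (rball r (gw_tree \<kappa>))" by blast
  let ?t = "rball r (gw_tree \<kappa>)"
  let ?\<alpha> = "real (card (isos ?t ?t))"
  let ?W = "bverts r (gw_tree \<kappa>)"
  let ?R = "card {w\<in>?W. length w = r} * exp (- real (card {w\<in>?W. length w < r}))"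
  have t: "rgraph ?t" by (rule rgraph_rball[OF rgraph_gw_tree])
  have ft: "finite (verts (fst ?t))" using finite_bverts_gw by simp
  have "isos ?t ?t \<noteq> {}" by (rule isos_self_nonempty[OF rgraphD(4)[OF t]])
  then have \<alpha>: "?\<alpha> > 0" using finite_isos[OF ft ft] by (simp add: card_gt_0_iff)
  have "\<forall>\<^sub>F n in sequentially. root_sum (G n) (\<lambda>X. real (card (isos ?t (rball r X)))) \<le> ?R + ?\<alpha> * \<epsilon>"
    by (rule eventually_isos_le) (use \<alpha> \<epsilon> in simp)
  moreover have "\<forall>\<^sub>F n in sequentially. n \<ge> 1 \<and> d n \<ge> 1 \<and> d n \<ge> 1" by (rule eventually_deg)
  ultimately show ?thesis
  proof eventually_elim
    case (elim n)
    have "?\<alpha> * root_sum (G n) (\<lambda>X. of_bool (iso_class (rball r X) = c)) =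
        root_sum (G n) (\<lambda>X. ?\<alpha> * of_bool (iso_class (rball r X) = c))"
      by (rule root_sum_cmult[symmetric])
    also have "\<dots> \<le> root_sum (G n) (\<lambda>X. real (card (isos ?t (rball r X))))"
    proof (rule root_sum_mono)
      fix T \<rho> assume "T \<in> gtrees n" "\<rho> \<in> verts (G n)"
      then have X: "rgraph ((verts (G n), T), \<rho>)" using tree_facts(1) elim by auto
      note bX = rgraph_rball[OF X, of r]
      show "?\<alpha> * of_bool (iso_class (rball r ((verts (G n), T), \<rho>)) = c)
        \<le> real (card (isos ?t (rball r ((verts (G n), T), \<rho>))))"
      proof (cases "iso_class (rball r ((verts (G n), T), \<rho>)) = c")
        case True
        then have "rgraph_iso ?t (rball r ((verts (G n), T), \<rho>))"
          using iso_class_eq_iff[OF t bX] c by simp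
        then have "card (isos ?t ?t) = card (isos ?t (rball r ((verts (G n), T), \<rho>)))"
          by (intro card_isos_eq[OF t bX rgraphD(4)[OF t] ft ft]) (use finite_bverts[OF X] in auto)
        then show ?thesis by simp
      qed simp
    qed
    also have "\<dots> \<le> ?R + ?\<alpha> * \<epsilon>" using elim by simp
    also have "\<dots> \<le> ?\<alpha> * (limit_prob r c + \<epsilon>)"
      using gw_limit_lower[OF cond, of r \<kappa>] by (simp add: limit_prob_def c algebra_simps)
    finally show ?case using \<alpha> by simp
  qed
next
  case False
  have "\<forall>\<^sub>F n in sequentially. n \<ge> 1 \<and> d n \<ge> 1 \<and> d n \<ge> 1" by (rule eventually_deg)
  then show ?thesis
  proof eventually_elim
    case (elim n)
    have "root_sum (G n) (\<lambda>X. of_bool (iso_class (rball r X) = c)) \<le> root_sum (G n) (\<lambda>X. 0)"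
    proof (rule root_sum_mono)
      fix T \<rho> assume T: "T \<in> gtrees n" "\<rho> \<in> verts (G n)"
      then have X: "rgraph ((verts (G n), T), \<rho>)" using tree_facts(1) elim by auto
      obtain \<kappa> where "rgraph_iso (gw_tree \<kappa>) ((verts (G n), T), \<rho>)" using tree_facts(2) elim T by blast
      then have "rgraph_iso (rball r (gw_tree \<kappa>)) (rball r ((verts (G n), T), \<rho>))"
        by (rule rgraph_iso_rball[OF rgraph_gw_tree X])
      then have "iso_class (rball r ((verts (G n), T), \<rho>)) \<noteq> c"
        using False iso_class_eq_iff[OF rgraph_rball[OF rgraph_gw_tree] rgraph_rball[OF X]] by metis
      then show "of_bool (iso_class (rball r ((verts (G n), T), \<rho>)) = c) \<le> (0 :: real)" by simp
    qed
    also have "\<dots> = 0" by (rule root_sum_const) (use elim in simp)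
    also have "\<dots> \<le> limit_prob r c + \<epsilon>" using \<epsilon> by (simp add: limit_prob_def)
    finally show ?case .
  qed
qed

section \<open>Uniform integrability of the root degree and tightness\<close>

lemma class_star:
  assumes n: "n \<ge> 1" "d n \<ge> 1" and T: "T \<in> gtrees n" "\<rho> \<in> verts (G n)"
  shows "iso_class (rball (Suc 0) ((verts (G n), T), \<rho>)) = iso_class (star (rdeg ((verts (G n), T), \<rho>)))"
proof -
  let ?X = "((verts (G n), T), \<rho>)"
  have X: "rgraph ?X" by (rule tree_facts(1)[OF assms])
  obtain \<kappa> where "rgraph_iso (gw_tree \<kappa>) ?X" using tree_facts(2)[OF assms] by blast
  then have "rgraph_iso (rball (Suc 0) (gw_tree \<kappa>)) (rball (Suc 0) ?X)"
    by (rule rgraph_iso_rball[OF rgraph_gw_tree X])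
  then have iso: "rgraph_iso (star (\<kappa> [])) (rball (Suc 0) ?X)" unfolding rball_1_gw_star .
  then obtain f where "bij_betw f (verts (fst (star (\<kappa> [])))) (verts (fst (rball (Suc 0) ?X)))"
    by (auto simp: rgraph_iso_iff iso_map_def)
  then have "card (bverts (Suc 0) (gw_tree (\<lambda>_. \<kappa> []))) = card (bverts (Suc 0) ?X)"
    by (auto simp: star_def dest: bij_betw_same_card)
  then have "\<kappa> [] = rdeg ?X" by (simp add: card_bverts_1_gw card_bverts_1[OF X])
  then show ?thesis using iso iso_class_eq_iff[OF rgraph_star rgraph_rball[OF X]] by metis
qed

text \<open>The case of one inner vertex, \<open>j\<close> leaves and at most \<open>j!\<close>
  automorphisms in \<open>gw_limit_lower\<close>.\<close>

lemma limit_prob_star_ge: "j * exp (- 1) / fact j \<le> limit_prob (Suc 0) (iso_class (star j))"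
proof -
  let ?N = "limit_prob (Suc 0) (iso_class (star j))"
  have "real j * exp (- 1) \<le> card (isos (star j) (star j)) * ?N"
    using gw_limit_lower[OF cond, of "Suc 0" "\<lambda>_. j"]
    unfolding card_levels_star star_def[symmetric] limit_prob_def by simp
  also have "\<dots> \<le> fact j * ?N"
  proof (rule mult_right_mono)
    show "real (card (isos (star j) (star j))) \<le> fact j"
      using of_nat_mono[OF card_isos_star[of j], where ?'a = real] by simp
  qed (simp add: limit_prob_def)
  also have "fact j * ?N = ?N * fact j" by (rule mult.commute)
  finally show ?thesis by (rule pos_divide_le_eq[OF fact_gt_zero, THEN iffD2])
qed

lemma sum_limit_prob_star_le: "finite J \<Longrightarrow> (\<Sum>j\<in>J. limit_prob (Suc 0) (iso_class (star j))) \<le> 1"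
proof -
  assume J: "finite J"
  have p: "prob_space \<mu>" and s: "sets \<mu> = sets borel" using cond by (auto simp: gw_conditioned_to_survive_def)
  interpret prob_space \<mu> by fact
  let ?A = "\<lambda>j. {y. gball (Suc 0) y = iso_class (star j)}"
  have "(\<Sum>j\<in>J. prob (?A j)) = prob (\<Union>j\<in>J. ?A j)"
    by (rule finite_measure_finite_Union[symmetric])
      (use J s sets_gball_fibre iso_class_star_inj in \<open>auto simp: disjoint_family_on_def\<close>)
  then show ?thesis by (simp add: limit_prob_def)
qed

lemma root_sum_rdeg_le:
  assumes n: "n \<ge> 1" "d n \<ge> 1"
  shows "root_sum (G n) (\<lambda>X. real (rdeg X)) \<le> 2"
proof -
  interpret regular_graph "verts (G n)" "edges (G n)" "d n" using regular_graph_G[OF n] .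
  have pos: "card (verts (G n)) > 0" "card (finite_conn_graph.trees (verts (G n)) (edges (G n))) > 0"
    using finite_trees trees_nonempty finite_V V_nonempty by (simp_all add: card_gt_0_iff)
  have "(\<Sum>T\<in>gtrees n. \<Sum>\<rho>\<in>verts (G n). real (rdeg ((verts (G n), T), \<rho>))) =
      (\<Sum>T\<in>gtrees n. real (2 * (card (verts (G n)) - 1)))"
    by (rule sum.cong[OF refl]) (simp only: sum_rdeg flip: of_nat_sum)
  also have "\<dots> \<le> 2 * (card (verts (G n)) * card (gtrees n))"
    using pos by (simp add: of_nat_diff)
  finally show ?thesis unfolding root_sum_def using pos by (simp add: pos_divide_le_eq)
qed

text \<open>With \<open>X\<close> the degree, write \<open>(X - D)^+\<close> as
  \<open>X - D + (D - X)^+\<close>. The mean of \<open>X\<close> is at most 2, and the last part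
  involves only degrees below \<open>D\<close>, for which the class bounds hold. In the limit law
  the weights \<open>\<nu> j\<close> add up to at most 1 while the sum of \<open>j * \<nu> j\<close>
  is nearly 2, so everything but the errors cancels.\<close>

lemma degree_tail:
  assumes \<eta>: "\<eta> > 0"
  shows "\<exists>D. \<forall>D'\<ge>D. \<forall>\<^sub>F n in sequentially.
    root_sum (G n) (\<lambda>X. real (rdeg X) * of_bool (rdeg X > D')) \<le> \<eta>"
proof -
  let ?q = "\<lambda>j. real j * exp (- 1) / fact j"
  have "(\<lambda>m. \<Sum>j<m. real j * ?q j) \<longlonglongrightarrow> 2" using sums_size_biased by (simp add: sums_def)
  then have "\<forall>\<^sub>F m in sequentially. (\<Sum>j<m. real j * ?q j) > 2 - \<eta> / 4"
    by (rule order_tendstoD) (use \<eta> in simp)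
  then obtain D where D: "(\<Sum>j<D. real j * ?q j) > 2 - \<eta> / 4" by (auto simp: eventually_sequentially)
  \<comment> \<open>The error \<open>\<epsilon>\<close> occurs for \<open>D\<close> degrees with
    weight at most \<open>D\<close> each.\<close>
  define \<epsilon> where "\<epsilon> = \<eta> / (4 * (real D * real D + 1))"
  have \<epsilon>: "\<epsilon> > 0" using \<eta> by (simp add: \<epsilon>_def add_nonneg_pos)
  let ?\<nu> = "\<lambda>j. limit_prob (Suc 0) (iso_class (star j))"
  have "\<forall>\<^sub>F n in sequentially. \<forall>j\<in>{..<D}.
      root_sum (G n) (\<lambda>X. of_bool (iso_class (rball (Suc 0) X) = iso_class (star j))) \<le> ?\<nu> j + \<epsilon>"
    by (intro eventually_ball_finite ballI eventually_class_le \<epsilon>) simp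
  then have ev: "\<forall>\<^sub>F n in sequentially. (\<forall>j\<in>{..<D}.
      root_sum (G n) (\<lambda>X. of_bool (iso_class (rball (Suc 0) X) = iso_class (star j))) \<le> ?\<nu> j + \<epsilon>) \<and>
      n \<ge> 1 \<and> d n \<ge> 1 \<and> d n \<ge> 1"
    using eventually_deg by (rule eventually_conj)
  show ?thesis
  proof (intro exI[of _ "2 * D"] allI impI)
    \<comment> \<open>A degree above \<open>2 * D\<close> is at most twice its surplus over
      \<open>D\<close>.\<close>
    fix D' :: nat assume D': "2 * D \<le> D'"
    show "\<forall>\<^sub>F n in sequentially. root_sum (G n) (\<lambda>X. real (rdeg X) * of_bool (rdeg X > D')) \<le> \<eta>"
      using ev
    proof eventually_elim
      case (elim n)
      let ?C = "\<lambda>j X. of_bool (iso_class (rball (Suc 0) X) = iso_class (star j)) :: real"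
      have "root_sum (G n) (\<lambda>X. real (rdeg X) * of_bool (rdeg X > D')) \<le>
          root_sum (G n) (\<lambda>X. 2 * (real (rdeg X) + (- real D + (\<Sum>j<D. (real D - real j) * ?C j X))))"
      proof (rule root_sum_mono)
        fix T \<rho> assume T: "T \<in> gtrees n" "\<rho> \<in> verts (G n)"
        let ?X = "((verts (G n), T), \<rho>)"
        have C: "?C j ?X = of_bool (rdeg ?X = j)" for j
          using class_star[OF _ _ T] elim iso_class_star_inj by auto
        have "(\<Sum>j<D. (real D - real j) * ?C j ?X) = (if rdeg ?X < D then real D - rdeg ?X else 0)"
          unfolding C by (simp add: of_bool_def if_distrib sum.delta cong: if_cong)
        then show "real (rdeg ?X) * of_bool (rdeg ?X > D') \<le>
            2 * (real (rdeg ?X) + (- real D + (\<Sum>j<D. (real D - real j) * ?C j ?X)))"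
          using D' by auto
      qed
      also have "\<dots> = 2 * (root_sum (G n) (\<lambda>X. real (rdeg X)) + (- real D + (\<Sum>j<D. (real D - real j) * root_sum (G n) (?C j))))"
        unfolding root_sum_cmult root_sum_add root_sum_sum using root_sum_const elim by simp
      also have "\<dots> \<le> 2 * (2 + (- real D + (\<Sum>j<D. (real D - real j) * (?\<nu> j + \<epsilon>))))"
        using elim root_sum_rdeg_le by (intro mult_left_mono add_mono sum_mono) auto
      also have "(\<Sum>j<D. (real D - real j) * (?\<nu> j + \<epsilon>)) =
         real D * (\<Sum>j<D. ?\<nu> j) - (\<Sum>j<D. real j * ?\<nu> j) + (\<Sum>j<D. (real D - real j) * \<epsilon>)"
        by (simp add: algebra_simps sum.distrib sum_subtractf sum_distrib_left)
      also have "\<dots> \<le> real D * 1 - (\<Sum>j<D. real j * ?q j) + (\<Sum>j<D. real D * \<epsilon>)"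
        using \<epsilon> limit_prob_star_ge
        by (intro add_mono diff_mono mult_left_mono sum_limit_prob_star_le sum_mono mult_right_mono) auto
      also have "(\<Sum>j<D. real D * \<epsilon>) \<le> \<eta> / 4"
      proof -
        have "real D * real D * (\<eta> / (4 * (real D * real D + 1))) \<le> \<eta> / 4"
          by (rule mult_divide_Suc_le) (use \<eta> in auto)
        then show ?thesis by (simp add: \<epsilon>_def)
      qed
      finally show ?case using D by simp
    qed
  qed
qed

text \<open>Niceness fails at radius \<open>r\<close>, or for the first time at
  \<open>Suc r\<close>. The second case costs at most \<open>D ^ r\<close> times a degree tail,
  which is made small by choosing \<open>D'\<close> after \<open>D\<close>.\<close>

lemma eventually_nice:
  assumes "\<eta> > 0"
  shows "\<exists>D. \<forall>\<^sub>F n in sequentially. root_sum (G n) (\<lambda>X. of_bool (\<not> nice D r X)) \<le> \<eta>"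
  using assms
proof (induction r arbitrary: \<eta>)
  case 0
  obtain D where D: "\<forall>\<^sub>F n in sequentially. root_sum (G n) (\<lambda>X. real (rdeg X) * of_bool (rdeg X > D)) \<le> \<eta>"
    using degree_tail[OF 0] by blast
  have "\<forall>\<^sub>F n in sequentially. root_sum (G n) (\<lambda>X. of_bool (\<not> nice D 0 X)) \<le> \<eta>"
    using D
  proof eventually_elim
    case (elim n)
    have "root_sum (G n) (\<lambda>X. of_bool (\<not> nice D 0 X)) \<le> root_sum (G n) (\<lambda>X. real (rdeg X) * of_bool (rdeg X > D))"
      by (rule root_sum_mono) (auto simp: nice_def bverts_def rdeg_def of_bool_def)
    then show ?case using elim by simp
  qed
  then show ?case by blast
next
  case (Suc r)
  obtain D where D: "\<forall>\<^sub>F n in sequentially. root_sum (G n) (\<lambda>X. of_bool (\<not> nice D r X)) \<le> \<eta> / 2"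
    using Suc.IH[of "\<eta> / 2"] Suc.prems by auto
  have "\<eta> / (2 * (real D ^ r + 1)) > 0" using Suc.prems by (simp add: add_nonneg_pos)
  from degree_tail[OF this] obtain D0 where D0: "\<And>D'. D' \<ge> D0 \<Longrightarrow> \<forall>\<^sub>F n in sequentially.
    root_sum (G n) (\<lambda>X. real (rdeg X) * of_bool (rdeg X > D')) \<le> \<eta> / (2 * (real D ^ r + 1))" by blast
  define D' where "D' = max D D0"
  have "\<forall>\<^sub>F n in sequentially.
    root_sum (G n) (\<lambda>X. real (rdeg X) * of_bool (rdeg X > D')) \<le> \<eta> / (2 * (real D ^ r + 1))"
    by (rule D0) (simp add: D'_def)
  moreover have "\<forall>\<^sub>F n in sequentially. n \<ge> 1 \<and> d n \<ge> 1 \<and> d n \<ge> 1" by (rule eventually_deg)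
  ultimately have "\<forall>\<^sub>F n in sequentially. root_sum (G n) (\<lambda>X. of_bool (\<not> nice D' (Suc r) X)) \<le> \<eta>"
    using D
  proof eventually_elim
    case (elim n)
    interpret regular_graph "verts (G n)" "edges (G n)" "d n" using regular_graph_G elim by simp
    have "root_sum (G n) (\<lambda>X. of_bool (\<not> nice D' (Suc r) X)) \<le>
      root_sum (G n) (\<lambda>X. of_bool (\<not> nice D r X) + of_bool (nice D r X \<and> \<not> nice D' (Suc r) X))"
      by (rule root_sum_mono) (auto simp: of_bool_def)
    also have "\<dots> = root_sum (G n) (\<lambda>X. of_bool (\<not> nice D r X)) +
        root_sum (G n) (\<lambda>X. of_bool (nice D r X \<and> \<not> nice D' (Suc r) X))" by (rule root_sum_add)
    also have "root_sum (G n) (\<lambda>X. of_bool (nice D r X \<and> \<not> nice D' (Suc r) X)) \<le>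
        root_sum (G n) (\<lambda>X. real D ^ r * (real (rdeg X) * of_bool (rdeg X > D')))"
      unfolding root_sum_def
    proof (rule divide_right_mono[OF sum_mono])
      fix T assume T: "T \<in> finite_conn_graph.trees (verts (G n)) (edges (G n))"
      let ?X = "\<lambda>v. ((verts (G n), T), v)"
      have "(\<Sum>\<rho>\<in>verts (G n). of_bool (nice D r (?X \<rho>) \<and> \<not> nice D' (Suc r) (?X \<rho>))) =
          real (card {\<rho>\<in>verts (G n). nice D r (?X \<rho>) \<and> \<not> nice D' (Suc r) (?X \<rho>)})"
        using finite_V by (simp add: sum_of_bool_eq Int_def)
      also have "\<dots> \<le> real (D ^ r * (\<Sum>v\<in>verts (G n). rdeg (?X v) * of_bool (rdeg (?X v) > D')))"
        by (rule of_nat_mono[OF card_not_nice_Suc[OF T]]) (simp add: D'_def)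
      also have "\<dots> = (\<Sum>v\<in>verts (G n). real D ^ r * (real (rdeg (?X v)) * of_bool (rdeg (?X v) > D')))"
        by (simp add: sum_distrib_left of_bool_def if_distrib cong: if_cong)
      finally show "(\<Sum>\<rho>\<in>verts (G n). of_bool (nice D r (?X \<rho>) \<and> \<not> nice D' (Suc r) (?X \<rho>))) \<le>
        (\<Sum>v\<in>verts (G n). real D ^ r * (real (rdeg (?X v)) * of_bool (rdeg (?X v) > D')))" .
    qed simp
    also have "\<dots> = real D ^ r * root_sum (G n) (\<lambda>X. real (rdeg X) * of_bool (rdeg X > D'))" by (rule root_sum_cmult)
    also have "\<dots> \<le> real D ^ r * (\<eta> / (2 * (real D ^ r + 1)))" using elim by (intro mult_left_mono) auto
    also have "\<dots> \<le> \<eta> / 2" by (rule mult_divide_Suc_le) (use Suc.prems in auto)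
    finally show ?case using elim by simp
  qed
  then show ?case by blast
qed

lemma ust_local_limit: "local_limit (\<lambda>n. ust (G n)) \<mu>"
  unfolding local_limit_def
proof (intro conjI allI)
  show p: "prob_space \<mu>" and s: "sets \<mu> = sets borel" using cond by (auto simp: gw_conditioned_to_survive_def)
  fix r
  let ?cl = "\<lambda>X :: 'a rgraph. iso_class (rball r X)"
  define P where "P n = map_pmf ?cl (uniform_root (ust (G n)))" for n
  let ?N = "distr \<mu> borel (gball r)"
  have mr: "gball r \<in> borel_measurable \<mu>"
    using gball_measurable measurable_cong_sets[OF s refl] by blast
  have N: "prob_space ?N" "sets ?N = sets borel"
    using prob_space.prob_space_distr[OF p mr] by auto
  have prob_P: "measure_pmf.prob (P n) S = root_sum (G n) (\<lambda>X. of_bool (?cl X \<in> S))" if "n \<ge> 1" for n S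
  proof -
    have "measure_pmf.prob (P n) S = measure_pmf.expectation (uniform_root (ust (G n))) (\<lambda>X. indicator (?cl -` S) X)"
      by (simp add: P_def)
    also have "\<dots> = root_sum (G n) (\<lambda>X. indicator (?cl -` S) X)"
      using graph[OF that] by (intro expectation_uniform_root) auto
    finally show ?thesis by (simp add: indicator_def of_bool_def)
  qed
  have NC: "measure ?N {c} = limit_prob r c" for c
  proof -
    have "measure ?N {c} = measure \<mu> (gball r -` {c} \<inter> space \<mu>)"
      by (rule measure_distr[OF mr]) (auto intro: borel_closed)
    also have "gball r -` {c} \<inter> space \<mu> = {y. gball r y = c}" using sets_eq_imp_space_eq[OF s] by auto
    finally show ?thesis by (simp add: limit_prob_def)
  qed
  have le: "\<forall>\<^sub>F n in sequentially. pmf (P n) c \<le> measure ?N {c} + \<epsilon>" if "\<epsilon> > 0" for c \<epsilon>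
    using eventually_class_le[OF that, of r c] eventually_ge_at_top[of "1::nat"]
  proof eventually_elim
    case (elim n)
    then show ?case using prob_P[of n "{c}"] NC[of c] by (simp add: measure_pmf_single)
  qed
  have tight: "\<exists>S. finite S \<and> (\<forall>\<^sub>F n in sequentially. measure_pmf.prob (P n) (- S) \<le> \<epsilon>)" if \<epsilon>: "\<epsilon> > 0" for \<epsilon>
  proof -
    obtain D where D: "\<forall>\<^sub>F n in sequentially. root_sum (G n) (\<lambda>X. of_bool (\<not> nice D r X)) \<le> \<epsilon>"
      using eventually_nice[OF \<epsilon>] by blast
    define K where "K = (\<Sum>j\<le>r. D ^ j)"
    \<comment> \<open>All classes of rooted graphs with at most \<open>K\<close> vertices, which
      include every nice ball.\<close>
    define S where "S = (\<lambda>(N, F, v). nat_graph N F v) ` (SIGMA N:{..K}. Pow (Pow {..<N}) \<times> {..<N})"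
    have "finite S" unfolding S_def by (rule finite_classes)
    moreover have "\<forall>\<^sub>F n in sequentially. n \<ge> 1 \<and> d n \<ge> 1 \<and> d n \<ge> 1" by (rule eventually_deg)
    then have "\<forall>\<^sub>F n in sequentially. measure_pmf.prob (P n) (- S) \<le> \<epsilon>"
      using D
    proof eventually_elim
      case (elim n)
      interpret regular_graph "verts (G n)" "edges (G n)" "d n" using regular_graph_G elim by simp
      have "measure_pmf.prob (P n) (- S) = root_sum (G n) (\<lambda>X. of_bool (?cl X \<in> - S))"
        using prob_P elim by simp
      also have "\<dots> \<le> root_sum (G n) (\<lambda>X. of_bool (\<not> nice D r X))"
      proof (rule root_sum_mono)
        fix T \<rho> assume T: "T \<in> finite_conn_graph.trees (verts (G n)) (edges (G n))" "\<rho> \<in> verts (G n)"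
        let ?X = "((verts (G n), T), \<rho>)"
        have X: "rgraph ?X" by (rule rgraph_tree[OF T])
        have "?cl ?X \<in> S" if nice: "nice D r ?X"
        proof -
          have fin: "finite (verts (fst (rball r ?X)))" using finite_bverts[OF X] by simp
          have cK: "card (verts (fst (rball r ?X))) \<le> K"
            using card_bverts_nice[OF nice T] by (simp add: K_def)
          obtain F v where "F \<subseteq> Pow {..<card (verts (fst (rball r ?X)))}" "v < card (verts (fst (rball r ?X)))"
            "iso_class (rball r ?X) = nat_graph (card (verts (fst (rball r ?X)))) F v"
            using iso_class_finite_graph[OF rgraph_rball[OF X] fin] by metis
          then show ?thesis unfolding S_def using cK
            by (intro image_eqI[of _ _ "(card (verts (fst (rball r ?X))), F, v)"]) (auto simp del: rball_simps)
        qed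
        then show "of_bool (?cl ?X \<in> - S) \<le> (of_bool (\<not> nice D r ?X) :: real)" by auto
      qed
      also have "\<dots> \<le> \<epsilon>" using elim by simp
      finally show ?case .
    qed
    ultimately show ?thesis by blast
  qed
  show "conv_in_distr (\<lambda>n. distr (measure_pmf (uniform_root (ust (G n)))) borel ?cl) ?N"
    unfolding conv_in_distr_def
  proof (intro allI impI)
    fix f :: "gbullet \<Rightarrow> real" assume f: "continuous_on UNIV f" "bounded (range f)"
    obtain B where B: "\<And>x. \<bar>f x\<bar> \<le> B" using f(2) unfolding bounded_iff by (auto simp: real_norm_def)
    have fm: "f \<in> borel_measurable borel" by (rule borel_measurable_continuous_onI[OF f(1)])
    have "(\<integral>x. f x \<partial>distr (measure_pmf (uniform_root (ust (G n)))) borel ?cl) = measure_pmf.expectation (P n) f" for n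
      unfolding P_def by (subst integral_distr) (simp_all add: fm)
    then show "(\<lambda>n. \<integral>x. f x \<partial>distr (measure_pmf (uniform_root (ust (G n)))) borel ?cl) \<longlonglongrightarrow> (\<integral>x. f x \<partial>?N)"
      using pmf_convergence[OF N le tight fm B] by simp
  qed
qed

end

theorem theorem1p1:
  fixes G :: "nat \<Rightarrow> 'a graph" and d :: "nat \<Rightarrow> nat" and \<mu> :: "gbullet measure"
  assumes "\<And>n. n \<ge> 1 \<Longrightarrow> simple_graph (G n) \<and> finite (verts (G n)) \<and> gconnected (G n)"
    and "\<And>n. n \<ge> 1 \<Longrightarrow> regular (d n) (G n)"
    and "filterlim d at_top sequentially"
    and "gw_conditioned_to_survive (poisson_pmf 1) \<mu>"
  shows "local_limit (\<lambda>n. ust (G n)) \<mu>"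
proof -
  interpret ust_sequence G d \<mu> using assms by unfold_locales
  show ?thesis by (rule ust_local_limit)
qed

end
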